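(* Let $K$ be a commutative ring with identity, let $G$ be a finite groupoid, and let $\beta=\{\beta_g:E_{g^{-1}}\to E_g\}_{g\in G}$ be an action of $G$ on a faithful commutative $K$-algebra $R$ such that each $E_e$ ($e\in G_0$) is unital with identity element $1_e$, $R=\bigoplus_{e\in G_0}E_e$ and $R^\beta=K$. Assume that $R$ is a $\beta$-Galois extension of $K$ and that $E_g$ is a faithfully projective $K$-module for every $g\in G$. Then the correspondence $H\mapsto R^{\beta_H}$ is one-to-one (a bijection) between the set of all wide subgroupoids $H$ of $G$ and the set of all $K$-subalgebras of $R$ which are separable over $K$ and $\beta$-strong.
   Context: All algebras are commutative and unital. A $K$-module is faithfully projective if it is faithful, projective and finitely generated. A $K$-algebra $T$ is separable if it is projective as a $T\otimes_K T$-module. Groupoid: a nonempty set $G$ with a partially defined associative product in which every $g$ has a right identity $d(g)=g^{-1}g$ and a left identity $r(g)=gg^{-1}$ (a small category with all arrows invertible); $gh$ is defined iff $d(g)=r(h)$. $G_0$ is the set of identities. A subgroupoid is a nonempty subset closed under existing products and inverses; it is wide if it contains all of $G_0$. Action of $G$ on a $K$-algebra $R$: ideals $E_g=E_{r(g)}$ of $R$ and $K$-algebra isomorphisms $\beta_g:E_{g^{-1}}\to E_g$ ($g\in G$) with $\beta_e=\mathrm{Id}_{E_e}$ for $e\in G_0$ and $\beta_g\beta_h=\beta_{gh}$ when $gh$ is defined. Write $1_g=1_{r(g)}$ for the identity of $E_g$. $R^\beta=\{r\in R: \beta_g(r1_{g^{-1}})=r1_g\ \forall g\in G\}$. $R$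 is a $\beta$-Galois extension of $R^\beta$ if there are $x_i,y_i\in R$, $1\le i\le m$, such that, for every $g\in G$, $\sum_i x_i\beta_g(y_i1_{g^{-1}})$ equals $1_g$ if $g\in G_0$ and $0$ if $g\notin G_0$. For a wide subgroupoid $H$ of $G$, $\beta_H=\{\beta_h\}_{h\in H}$ is the restricted action and $R^{\beta_H}=\{r\in R:\beta_h(r1_{h^{-1}})=r1_h\ \forall h\in H\}$. For a $K$-subalgebra $T$ of $R$, $H_T=\{g\in G: \beta_g(t1_{g^{-1}})=t1_g\ \forall t\in T\}$. $T$ is $\beta$-strong if for all $g,h\in G$ with $r(g)=r(h)$ and $g^{-1}h\notin H_T$, and every nonzero idempotent $\epsilon\in E_g=E_h$, there is $t\in T$ with $\beta_g(t1_{g^{-1}})\epsilon\ne\beta_h(t1_{h^{-1}})\epsilon$.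
   Formalization: The ring K is assumed to be nonzero (1 ≠ 0); for K = R = 0 and G the group of order two all hypotheses hold, but two wide subgroupoids correspond to a single subalgebra. *)

theory Defs
  imports "HOL-Algebra.Algebra"
begin

text \<open>
  The product of a groupoid is a total HOL function of which only the values at composable pairs
  matter; \<open>g\<close> and \<open>h\<close> are composable iff \<open>gdom G g = gcod G h\<close>, where \<open>gdom\<close> and \<open>gcod\<close> are the
  maps \<open>d(g) = g\<inverse> g\<close> and \<open>r(g) = g g\<inverse>\<close>.
\<close>

record 'g groupoid = "'g partial_object" +
  gmult :: "'g \<Rightarrow> 'g \<Rightarrow> 'g"
  ginv :: "'g \<Rightarrow> 'g"

definition gdom :: "('g, 'z) groupoid_scheme \<Rightarrow> 'g \<Rightarrow> 'g" where
  "gdom G g = gmult G (ginv G g) g"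

definition gcod :: "('g, 'z) groupoid_scheme \<Rightarrow> 'g \<Rightarrow> 'g" where
  "gcod G g = gmult G g (ginv G g)"

definition identities :: "('g, 'z) groupoid_scheme \<Rightarrow> 'g set" where
  "identities G = gdom G ` carrier G"

locale groupoid =
  fixes G :: "('g, 'z) groupoid_scheme"
  assumes nonempty: "carrier G \<noteq> {}"
    and ginv_closed: "g \<in> carrier G \<Longrightarrow> ginv G g \<in> carrier G"
    and gdom_ginv: "g \<in> carrier G \<Longrightarrow> gdom G (ginv G g) = gcod G g"
    and gcod_ginv: "g \<in> carrier G \<Longrightarrow> gcod G (ginv G g) = gdom G g"
    and gmult_closed: "\<lbrakk>g \<in> carrier G; h \<in> carrier G; gdom G g = gcod G h\<rbrakk> \<Longrightarrow>
          gmult G g h \<in> carrier G"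
    and gdom_gmult: "\<lbrakk>g \<in> carrier G; h \<in> carrier G; gdom G g = gcod G h\<rbrakk> \<Longrightarrow>
          gdom G (gmult G g h) = gdom G h"
    and gcod_gmult: "\<lbrakk>g \<in> carrier G; h \<in> carrier G; gdom G g = gcod G h\<rbrakk> \<Longrightarrow>
          gcod G (gmult G g h) = gcod G g"
    and gmult_assoc: "\<lbrakk>g \<in> carrier G; h \<in> carrier G; k \<in> carrier G;
          gdom G g = gcod G h; gdom G h = gcod G k\<rbrakk> \<Longrightarrow>
          gmult G (gmult G g h) k = gmult G g (gmult G h k)"
    and gmult_gdom: "g \<in> carrier G \<Longrightarrow> gmult G g (gdom G g) = g"
    and gmult_gcod: "g \<in> carrier G \<Longrightarrow> gmult G (gcod G g) g = g"

definition subgroupoid :: "'g set \<Rightarrow> ('g, 'z) groupoid_scheme \<Rightarrow> bool" where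
  "subgroupoid H G \<longleftrightarrow> H \<noteq> {} \<and> H \<subseteq> carrier G \<and> (\<forall>h\<in>H. ginv G h \<in> H) \<and>
     (\<forall>g\<in>H. \<forall>h\<in>H. gdom G g = gcod G h \<longrightarrow> gmult G g h \<in> H)"

definition wide_subgroupoid :: "'g set \<Rightarrow> ('g, 'z) groupoid_scheme \<Rightarrow> bool" where
  "wide_subgroupoid H G \<longleftrightarrow> subgroupoid H G \<and> identities G \<subseteq> H"

definition module_homs ::
  "('a, 'x) ring_scheme \<Rightarrow> ('a, 'm, 'y) module_scheme \<Rightarrow> ('a, 'n, 'w) module_scheme \<Rightarrow> ('m \<Rightarrow> 'n) set"
where
  "module_homs A M N = {f \<in> carrier M \<rightarrow> carrier N.
     (\<forall>x\<in>carrier M. \<forall>y\<in>carrier M. f (x \<oplus>\<^bsub>M\<^esub> y) = f x \<oplus>\<^bsub>N\<^esub> f y) \<and>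
     (\<forall>a\<in>carrier A. \<forall>x\<in>carrier M. f (a \<odot>\<^bsub>M\<^esub> x) = a \<odot>\<^bsub>N\<^esub> f x)}"

text \<open>
  The free \<open>A\<close>-module on \<open>I\<close>: finitely supported functions, extended by zero outside \<open>I\<close>.
  The fields \<open>mult\<close> and \<open>one\<close> of the library's module record play no role in the module structure.
\<close>

definition free_module :: "('a, 'x) ring_scheme \<Rightarrow> 'i set \<Rightarrow> ('a, 'i \<Rightarrow> 'a) module" where
  "free_module A I = \<lparr>
     carrier = {f. (\<forall>i. f i \<in> carrier A) \<and> {i. f i \<noteq> \<zero>\<^bsub>A\<^esub>} \<subseteq> I \<and> finite {i. f i \<noteq> \<zero>\<^bsub>A\<^esub>}},
     monoid.mult = (\<lambda>f g i. f i \<otimes>\<^bsub>A\<^esub> g i),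
     monoid.one = (\<lambda>i. \<one>\<^bsub>A\<^esub>),
     ring.zero = (\<lambda>i. \<zero>\<^bsub>A\<^esub>),
     ring.add = (\<lambda>f g i. f i \<oplus>\<^bsub>A\<^esub> g i),
     module.smult = (\<lambda>a f i. a \<otimes>\<^bsub>A\<^esub> f i)\<rparr>"

definition free_basis :: "('a, 'x) ring_scheme \<Rightarrow> 'i \<Rightarrow> 'i \<Rightarrow> 'a" where
  "free_basis A i = (\<lambda>j. if j = i then \<one>\<^bsub>A\<^esub> else \<zero>\<^bsub>A\<^esub>)"

text \<open>
  Projective means isomorphic to a direct summand (equivalently, a retract) of a free module. Index sets
  inside the type of elements of \<open>M\<close> suffice, since \<open>M\<close> is a quotient of the free module on
  \<open>carrier M\<close>.
\<close>

definition projective_module :: "('a, 'x) ring_scheme \<Rightarrow> ('a, 'm, 'y) module_scheme \<Rightarrow> bool" where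
  "projective_module A M \<longleftrightarrow> (\<exists>(I :: 'm set) s p.
     s \<in> module_homs A M (free_module A I) \<and> p \<in> module_homs A (free_module A I) M \<and>
     (\<forall>x\<in>carrier M. p (s x) = x))"

definition faithful_module :: "('a, 'x) ring_scheme \<Rightarrow> ('a, 'm, 'y) module_scheme \<Rightarrow> bool" where
  "faithful_module A M \<longleftrightarrow>
     (\<forall>a\<in>carrier A. (\<forall>x\<in>carrier M. a \<odot>\<^bsub>M\<^esub> x = \<zero>\<^bsub>M\<^esub>) \<longrightarrow> a = \<zero>\<^bsub>A\<^esub>)"

definition finitely_generated_module ::
  "('a, 'x) ring_scheme \<Rightarrow> ('a, 'm, 'y) module_scheme \<Rightarrow> bool" where
  "finitely_generated_module A M \<longleftrightarrow> (\<exists>S. finite S \<and> S \<subseteq> carrier M \<and>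
     (\<forall>x\<in>carrier M. \<exists>c \<in> S \<rightarrow> carrier A. x = (\<Oplus>\<^bsub>M\<^esub>s\<in>S. c s \<odot>\<^bsub>M\<^esub> s)))"

definition faithfully_projective_module ::
  "('a, 'x) ring_scheme \<Rightarrow> ('a, 'm, 'y) module_scheme \<Rightarrow> bool" where
  "faithfully_projective_module A M \<longleftrightarrow>
     faithful_module A M \<and> projective_module A M \<and> finitely_generated_module A M"

text \<open>
  For commutative \<open>K\<close>-algebras \<open>A\<close> and \<open>B\<close>, the free \<open>K\<close>-module on \<open>A \<times> B\<close> is a ring with the
  convolution product extending \<open>(a,b)(a',b') = (aa',bb')\<close>.
  Multiplication by a basis element maps bilinearity relators to bilinearity relators, so the ideal they
  generate is their \<open>K\<close>-span and the quotient ring is the usual module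
  \<open>A \<otimes>\<^sub>K B\<close> with its usual product.
\<close>

definition pair_algebra ::
  "('k, 'x) ring_scheme \<Rightarrow> ('k, 'a, 'y) module_scheme \<Rightarrow> ('k, 'b, 'w) module_scheme \<Rightarrow>
    ('k, 'a \<times> 'b \<Rightarrow> 'k) module"
where
  "pair_algebra K A B = (free_module K (carrier A \<times> carrier B))\<lparr>
     monoid.mult := (\<lambda>f g q. finsum K (\<lambda>(u, v). f u \<otimes>\<^bsub>K\<^esub> g v)
       {(u, v). f u \<noteq> \<zero>\<^bsub>K\<^esub> \<and> g v \<noteq> \<zero>\<^bsub>K\<^esub> \<and>
                (fst u \<otimes>\<^bsub>A\<^esub> fst v, snd u \<otimes>\<^bsub>B\<^esub> snd v) = q}),
     monoid.one := free_basis K (\<one>\<^bsub>A\<^esub>, \<one>\<^bsub>B\<^esub>)\<rparr>"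

definition bilinear_relators ::
  "('k, 'x) ring_scheme \<Rightarrow> ('k, 'a, 'y) module_scheme \<Rightarrow> ('k, 'b, 'w) module_scheme \<Rightarrow>
    ('a \<times> 'b \<Rightarrow> 'k) set"
where
  "bilinear_relators K A B = (let P = pair_algebra K A B; \<delta> = free_basis K in
     {\<delta> (a \<oplus>\<^bsub>A\<^esub> a', b) \<ominus>\<^bsub>P\<^esub> (\<delta> (a, b) \<oplus>\<^bsub>P\<^esub> \<delta> (a', b)) | a a' b.
        a \<in> carrier A \<and> a' \<in> carrier A \<and> b \<in> carrier B} \<union>
     {\<delta> (a, b \<oplus>\<^bsub>B\<^esub> b') \<ominus>\<^bsub>P\<^esub> (\<delta> (a, b) \<oplus>\<^bsub>P\<^esub> \<delta> (a, b')) | a b b'.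
        a \<in> carrier A \<and> b \<in> carrier B \<and> b' \<in> carrier B} \<union>
     {\<delta> (k \<odot>\<^bsub>A\<^esub> a, b) \<ominus>\<^bsub>P\<^esub> (k \<odot>\<^bsub>P\<^esub> \<delta> (a, b)) | k a b.
        k \<in> carrier K \<and> a \<in> carrier A \<and> b \<in> carrier B} \<union>
     {\<delta> (a, k \<odot>\<^bsub>B\<^esub> b) \<ominus>\<^bsub>P\<^esub> (k \<odot>\<^bsub>P\<^esub> \<delta> (a, b)) | k a b.
        k \<in> carrier K \<and> a \<in> carrier A \<and> b \<in> carrier B})"

definition tensor_algebra ::
  "('k, 'x) ring_scheme \<Rightarrow> ('k, 'a, 'y) module_scheme \<Rightarrow> ('k, 'b, 'w) module_scheme \<Rightarrow>
    ('a \<times> 'b \<Rightarrow> 'k) set ring"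
where
  "tensor_algebra K A B =
     pair_algebra K A B Quot (Idl\<^bsub>pair_algebra K A B\<^esub> (bilinear_relators K A B))"

text \<open>
  \<open>T\<close> as a \<open>T \<otimes>\<^sub>K T\<close>-module, \<open>(a \<otimes> b) t = a b t\<close>. An element \<open>\<Xi>\<close> of the tensor product is
  a coset, on which \<open>f \<mapsto> \<Sum> f(a,b) a b t\<close> is constant.
\<close>

definition mult_module ::
  "('k, 'x) ring_scheme \<Rightarrow> ('k, 't, 'y) module_scheme \<Rightarrow> (('t \<times> 't \<Rightarrow> 'k) set, 't) module" where
  "mult_module K T = \<lparr>carrier = carrier T,
     monoid.mult = monoid.mult T, monoid.one = \<one>\<^bsub>T\<^esub>,
     ring.zero = \<zero>\<^bsub>T\<^esub>, ring.add = ring.add T,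
     module.smult = (\<lambda>\<Xi> t. the_elem ((\<lambda>f. finsum T
       (\<lambda>q. f q \<odot>\<^bsub>T\<^esub> (fst q \<otimes>\<^bsub>T\<^esub> snd q \<otimes>\<^bsub>T\<^esub> t)) {q. f q \<noteq> \<zero>\<^bsub>K\<^esub>}) ` \<Xi>))\<rparr>"

definition separable_algebra :: "('k, 'x) ring_scheme \<Rightarrow> ('k, 't, 'y) module_scheme \<Rightarrow> bool" where
  "separable_algebra K T \<longleftrightarrow> projective_module (tensor_algebra K T T) (mult_module K T)"

definition unital_subalgebra ::
  "'r set \<Rightarrow> ('k, 'x) ring_scheme \<Rightarrow> ('k, 'r, 'y) module_scheme \<Rightarrow> bool" where
  "unital_subalgebra T K R \<longleftrightarrow> subring T R \<and> (\<forall>k\<in>carrier K. \<forall>t\<in>T. k \<odot>\<^bsub>R\<^esub> t \<in> T)"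

locale groupoid_action = groupoid G + algebra K R
  for G :: "('g, 'z) groupoid_scheme"
    and K :: "('k, 'x) ring_scheme"
    and R :: "('k, 'r, 'y) module_scheme" +
  fixes E :: "'g \<Rightarrow> 'r set" and \<beta> :: "'g \<Rightarrow> 'r \<Rightarrow> 'r"
  assumes E_ideal: "g \<in> carrier G \<Longrightarrow> ideal (E g) R"
    and E_gcod: "g \<in> carrier G \<Longrightarrow> E g = E (gcod G g)"
    and \<beta>_bij: "g \<in> carrier G \<Longrightarrow> bij_betw (\<beta> g) (E (ginv G g)) (E g)"
    and \<beta>_add: "\<lbrakk>g \<in> carrier G; x \<in> E (ginv G g); y \<in> E (ginv G g)\<rbrakk> \<Longrightarrow>
          \<beta> g (x \<oplus>\<^bsub>R\<^esub> y) = \<beta> g x \<oplus>\<^bsub>R\<^esub> \<beta> g y"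
    and \<beta>_mult: "\<lbrakk>g \<in> carrier G; x \<in> E (ginv G g); y \<in> E (ginv G g)\<rbrakk> \<Longrightarrow>
          \<beta> g (x \<otimes>\<^bsub>R\<^esub> y) = \<beta> g x \<otimes>\<^bsub>R\<^esub> \<beta> g y"
    and \<beta>_smult: "\<lbrakk>g \<in> carrier G; k \<in> carrier K; x \<in> E (ginv G g)\<rbrakk> \<Longrightarrow>
          \<beta> g (k \<odot>\<^bsub>R\<^esub> x) = k \<odot>\<^bsub>R\<^esub> \<beta> g x"
    and \<beta>_identity: "\<lbrakk>e \<in> identities G; x \<in> E e\<rbrakk> \<Longrightarrow> \<beta> e x = x"
    and \<beta>_comp: "\<lbrakk>g \<in> carrier G; h \<in> carrier G; gdom G g = gcod G h; x \<in> E (ginv G h)\<rbrakk> \<Longrightarrow>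
          \<beta> g (\<beta> h x) = \<beta> (gmult G g h) x"

definition is_ideal_one :: "('r, 'y) ring_scheme \<Rightarrow> 'r set \<Rightarrow> 'r \<Rightarrow> bool" where
  "is_ideal_one R I u \<longleftrightarrow> u \<in> I \<and> (\<forall>x\<in>I. u \<otimes>\<^bsub>R\<^esub> x = x \<and> x \<otimes>\<^bsub>R\<^esub> u = x)"

definition ideal_one :: "('r, 'y) ring_scheme \<Rightarrow> 'r set \<Rightarrow> 'r" where
  "ideal_one R I = (THE u. is_ideal_one R I u)"

definition internal_direct_sum :: "('r, 'y) ring_scheme \<Rightarrow> 'i set \<Rightarrow> ('i \<Rightarrow> 'r set) \<Rightarrow> bool" where
  "internal_direct_sum R J E \<longleftrightarrow>
     bij_betw (\<lambda>f. finsum R f J) (Pi\<^sub>E J E) (carrier R)"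

definition translate ::
  "('g, 'z) groupoid_scheme \<Rightarrow> ('r, 'y) ring_scheme \<Rightarrow> ('g \<Rightarrow> 'r set) \<Rightarrow> ('g \<Rightarrow> 'r \<Rightarrow> 'r) \<Rightarrow> 'g \<Rightarrow> 'r \<Rightarrow> 'r"
where
  "translate G R E \<beta> g x = \<beta> g (x \<otimes>\<^bsub>R\<^esub> ideal_one R (E (ginv G g)))"

definition invariant_subring ::
  "('g, 'z) groupoid_scheme \<Rightarrow> ('r, 'y) ring_scheme \<Rightarrow> ('g \<Rightarrow> 'r set) \<Rightarrow> ('g \<Rightarrow> 'r \<Rightarrow> 'r) \<Rightarrow>
    'g set \<Rightarrow> 'r set"
where
  "invariant_subring G R E \<beta> H =
     {x \<in> carrier R. \<forall>h\<in>H. translate G R E \<beta> h x = x \<otimes>\<^bsub>R\<^esub> ideal_one R (E h)}"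

definition galois_extension ::
  "('g, 'z) groupoid_scheme \<Rightarrow> ('r, 'y) ring_scheme \<Rightarrow> ('g \<Rightarrow> 'r set) \<Rightarrow> ('g \<Rightarrow> 'r \<Rightarrow> 'r) \<Rightarrow> bool"
where
  "galois_extension G R E \<beta> \<longleftrightarrow> (\<exists>(m::nat) x y.
     x \<in> {1..m} \<rightarrow> carrier R \<and> y \<in> {1..m} \<rightarrow> carrier R \<and>
     (\<forall>g\<in>carrier G. (\<Oplus>\<^bsub>R\<^esub>i\<in>{1..m}. x i \<otimes>\<^bsub>R\<^esub> translate G R E \<beta> g (y i)) =
        (if g \<in> identities G then ideal_one R (E g) else \<zero>\<^bsub>R\<^esub>)))"

definition fixing_set ::
  "('g, 'z) groupoid_scheme \<Rightarrow> ('r, 'y) ring_scheme \<Rightarrow> ('g \<Rightarrow> 'r set) \<Rightarrow> ('g \<Rightarrow> 'r \<Rightarrow> 'r) \<Rightarrow>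
    'r set \<Rightarrow> 'g set"
where
  "fixing_set G R E \<beta> T =
     {g \<in> carrier G. \<forall>t\<in>T. translate G R E \<beta> g t = t \<otimes>\<^bsub>R\<^esub> ideal_one R (E g)}"

definition strong ::
  "('g, 'z) groupoid_scheme \<Rightarrow> ('r, 'y) ring_scheme \<Rightarrow> ('g \<Rightarrow> 'r set) \<Rightarrow> ('g \<Rightarrow> 'r \<Rightarrow> 'r) \<Rightarrow>
    'r set \<Rightarrow> bool"
where
  "strong G R E \<beta> T \<longleftrightarrow> (\<forall>g\<in>carrier G. \<forall>h\<in>carrier G.
     gcod G g = gcod G h \<and> gmult G (ginv G g) h \<notin> fixing_set G R E \<beta> T \<longrightarrow>
     (\<forall>\<epsilon>\<in>E g. \<epsilon> \<otimes>\<^bsub>R\<^esub> \<epsilon> = \<epsilon> \<and> \<epsilon> \<noteq> \<zero>\<^bsub>R\<^esub> \<longrightarrow>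
        (\<exists>t\<in>T. translate G R E \<beta> g t \<otimes>\<^bsub>R\<^esub> \<epsilon> \<noteq> translate G R E \<beta> h t \<otimes>\<^bsub>R\<^esub> \<epsilon>)))"

end

theory Submission
  imports Defs
begin

text \<open>
  Write \<open>tr\<^sub>H z\<close> for the sum of \<open>\<beta>\<^sub>h (z 1\<^sub>h\<^sub>-\<^sub>1)\<close> over \<open>h \<in> H\<close>. The Galois coordinates
  satisfy \<open>\<Sum> x\<^sub>i tr\<^sub>H (y\<^sub>i z) = z\<close> for every wide \<open>H\<close>, so a Nakayama argument over the invariants \<open>T\<close>
  of \<open>H\<close> gives \<open>c\<close> with \<open>tr\<^sub>H c = 1\<close>. Then \<open>\<Sum> tr\<^sub>H (c x\<^sub>i) \<otimes> tr\<^sub>H y\<^sub>i\<close> is a separability idempotent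
  of \<open>T\<close>, because multiplication by \<open>t \<in> T\<close> acts on both families through the same matrix
  \<open>tr\<^sub>G (y\<^sub>j t x\<^sub>i)\<close> over \<open>K\<close>. Evaluating on \<open>tr\<^sub>H\<close> of translated \<open>y\<^sub>i\<close> and pairing with the \<open>x\<^sub>i\<close>
  separates the translates of \<open>T\<close>, so \<open>T\<close> is strong and is fixed by no element outside \<open>H\<close>.

  Conversely, if \<open>\<Sum> a\<^sub>i \<otimes> b\<^sub>i\<close> is a separability idempotent of a strong \<open>T\<close>, then
  \<open>\<epsilon>\<^sub>g = \<Sum> a\<^sub>i \<beta>\<^sub>g (b\<^sub>i 1\<^sub>g\<^sub>-\<^sub>1)\<close> is an idempotent on which \<open>t\<close> and its translate agree, so it is \<open>1\<^sub>g\<close> for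
  \<open>g\<close> fixing \<open>T\<close> and \<open>0\<close> otherwise. Hence \<open>tr\<^sub>H w = \<Sum> a\<^sub>i tr\<^sub>G (b\<^sub>i w) \<in> T\<close> for the set \<open>H\<close> fixing \<open>T\<close>, and
  an invariant \<open>z = tr\<^sub>H (z c)\<close> lies in \<open>T\<close>.
\<close>

section \<open>Finite sums\<close>

text \<open>The Galois relation is symmetric under inversion: applying the translate of g to the
  relation for the inverse of g moves the action from the \<open>y i\<close> to the
  \<open>x i\<close>. Hence z is also the sum of tr(z \<open>x i\<close>) \<open>y i\<close>, traces
  over all of \<open>G\<close>, and this is why one matrix serves both families. Its entries are
  scalars because R^\<beta> = K, and scalars may cross the tensor sign. Separability is given as a
  splitting over a quotient of a ring of functions on pairs, so it has to be exchanged for an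
  idempotent. For a given separable T this idempotent is seen in R through maps a \<otimes> b
  \<mapsto> a \<sigma>(b), where \<sigma> is a translate. Such a \<sigma> sends 1 to the unit of
  \<open>E g\<close>, not to 1, so \<sigma>(1) stays in the formulas. The groupoid is felt in two
  ways. Translates along arrows that do not compose give zero, since the ideals at different
  identities are orthogonal. And an arrow g is compared with the identity r(g) of its own component,
  as there is no common neutral element. That H can be recovered from its invariants rests on the
  unit of \<open>E g\<close> being nonzero, which faithfulness over a nonzero K provides.\<close>

lemma (in abelian_monoid) finsum_swap:
  assumes "finite A" "finite B" "\<And>x y. \<lbrakk>x \<in> A; y \<in> B\<rbrakk> \<Longrightarrow> f x y \<in> carrier G"
  shows "(\<Oplus>x\<in>A. \<Oplus>y\<in>B. f x y) = (\<Oplus>y\<in>B. \<Oplus>x\<in>A. f x y)"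
  using assms(1,3)
proof (induction A rule: finite_induct)
  case empty
  then show ?case by (simp add: finsum_zero)
next
  case (insert a A)
  have "(\<Oplus>x\<in>insert a A. \<Oplus>y\<in>B. f x y) = (\<Oplus>y\<in>B. f a y) \<oplus> (\<Oplus>y\<in>B. \<Oplus>x\<in>A. f x y)"
    using insert by (subst finsum_insert) (auto intro!: finsum_closed)
  also have "\<dots> = (\<Oplus>y\<in>B. f a y \<oplus> (\<Oplus>x\<in>A. f x y))"
    using insert by (subst finsum_addf) (auto intro!: finsum_closed)
  also have "\<dots> = (\<Oplus>y\<in>B. \<Oplus>x\<in>insert a A. f x y)"
    using insert by (intro finsum_cong') (auto intro!: finsum_closed)
  finally show ?case .
qed

text \<open>In monoids additivity does not force zero to go to zero, hence the separate hypothesis.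
  Besides genuine homomorphisms this serves for the identity map between two records with the same
  addition, showing that their finite sums agree.\<close>

lemma finsum_additive:
  assumes "abelian_monoid M" "abelian_monoid N"
    and "h \<in> carrier M \<rightarrow> carrier N" "h \<zero>\<^bsub>M\<^esub> = \<zero>\<^bsub>N\<^esub>"
    and "\<And>x y. \<lbrakk>x \<in> carrier M; y \<in> carrier M\<rbrakk> \<Longrightarrow> h (x \<oplus>\<^bsub>M\<^esub> y) = h x \<oplus>\<^bsub>N\<^esub> h y"
    and "finite A" "f \<in> A \<rightarrow> carrier M"
  shows "h (finsum M f A) = finsum N (\<lambda>i. h (f i)) A"
proof -
  interpret M: abelian_monoid M by fact
  interpret N: abelian_monoid N by fact
  show ?thesis
    using assms(6,7)
  proof (induction A rule: finite_induct)
    case empty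
    then show ?case by (simp add: assms)
  next
    case (insert a A)
    then have "f \<in> A \<rightarrow> carrier M" "f a \<in> carrier M"
      by auto
    with insert assms(3) show ?case
      by (subst N.finsum_insert) (auto simp: M.finsum_insert assms(5) M.finsum_closed)
  qed
qed

section \<open>The tensor product of two algebras\<close>

locale algebra_pair = A: algebra K A + B: algebra K B
  for K :: "('k, 'x) ring_scheme"
    and A :: "('k, 'a, 'y) module_scheme"
    and B :: "('k, 'b, 'w) module_scheme"
begin

abbreviation "P \<equiv> pair_algebra K A B"

abbreviation "S \<equiv> carrier A \<times> carrier B"

section \<open>The convolution ring on the free module over pairs\<close>

definition "supp f = {q. f q \<noteq> \<zero>\<^bsub>K\<^esub>}"

definition "single k u = (\<lambda>q. if q = u then k else \<zero>\<^bsub>K\<^esub>)"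

definition "pmult u v = (fst u \<otimes>\<^bsub>A\<^esub> fst v, snd u \<otimes>\<^bsub>B\<^esub> snd v)"

lemma P_carrier_iff: "f \<in> carrier P \<longleftrightarrow> (\<forall>q. f q \<in> carrier K) \<and> supp f \<subseteq> S \<and> finite (supp f)"
  by (simp add: pair_algebra_def free_module_def supp_def)

lemma P_coeff: "f \<in> carrier P \<Longrightarrow> f q \<in> carrier K"
  by (simp add: P_carrier_iff del: split_paired_All)

lemma P_add: "f \<oplus>\<^bsub>P\<^esub> g = (\<lambda>q. f q \<oplus>\<^bsub>K\<^esub> g q)"
  and P_zero: "\<zero>\<^bsub>P\<^esub> = (\<lambda>q. \<zero>\<^bsub>K\<^esub>)"
  and P_one: "\<one>\<^bsub>P\<^esub> = single \<one>\<^bsub>K\<^esub> (\<one>\<^bsub>A\<^esub>, \<one>\<^bsub>B\<^esub>)"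
  and P_smult: "k \<odot>\<^bsub>P\<^esub> f = (\<lambda>q. k \<otimes>\<^bsub>K\<^esub> f q)"
  by (simp_all add: pair_algebra_def free_module_def free_basis_def single_def)

lemma P_mult:
  "f \<otimes>\<^bsub>P\<^esub> g = (\<lambda>q. \<Oplus>\<^bsub>K\<^esub>p\<in>{p \<in> supp f \<times> supp g. pmult (fst p) (snd p) = q}. f (fst p) \<otimes>\<^bsub>K\<^esub> g (snd p))"
proof -
  have "{p \<in> supp f \<times> supp g. pmult (fst p) (snd p) = q}
      = {(u, v). f u \<noteq> \<zero>\<^bsub>K\<^esub> \<and> g v \<noteq> \<zero>\<^bsub>K\<^esub> \<and> (fst u \<otimes>\<^bsub>A\<^esub> fst v, snd u \<otimes>\<^bsub>B\<^esub> snd v) = q}" for q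
    by (auto simp: supp_def pmult_def)
  then show ?thesis
    by (simp add: pair_algebra_def case_prod_unfold)
qed

lemma free_basis_eq_single: "free_basis K u = single \<one>\<^bsub>K\<^esub> u"
  by (simp add: free_basis_def single_def)

lemma pmult_closed: "u \<in> S \<Longrightarrow> v \<in> S \<Longrightarrow> pmult u v \<in> S"
  by (auto simp: pmult_def)

lemma pmult_assoc: "u \<in> S \<Longrightarrow> v \<in> S \<Longrightarrow> w \<in> S \<Longrightarrow> pmult (pmult u v) w = pmult u (pmult v w)"
  by (auto simp: pmult_def A.m_assoc B.m_assoc)

lemma single_closed: "k \<in> carrier K \<Longrightarrow> u \<in> S \<Longrightarrow> single k u \<in> carrier P"
  unfolding P_carrier_iff by (auto simp: single_def supp_def intro: finite_subset[of _ "{u}"])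

lemma P_add_closed: "f \<in> carrier P \<Longrightarrow> g \<in> carrier P \<Longrightarrow> f \<oplus>\<^bsub>P\<^esub> g \<in> carrier P"
  unfolding P_carrier_iff P_add
proof (intro conjI)
  assume *: "(\<forall>q. f q \<in> carrier K) \<and> supp f \<subseteq> S \<and> finite (supp f)"
    "(\<forall>q. g q \<in> carrier K) \<and> supp g \<subseteq> S \<and> finite (supp g)"
  have "supp (\<lambda>q. f q \<oplus>\<^bsub>K\<^esub> g q) \<subseteq> supp f \<union> supp g"
    by (auto simp: supp_def)
  with * show "supp (\<lambda>q. f q \<oplus>\<^bsub>K\<^esub> g q) \<subseteq> S" "finite (supp (\<lambda>q. f q \<oplus>\<^bsub>K\<^esub> g q))"
    by (auto intro: finite_subset)
qed auto

lemma P_zero_closed: "\<zero>\<^bsub>P\<^esub> \<in> carrier P"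
  by (simp add: P_carrier_iff P_zero supp_def)

lemma P_abelian_group: "abelian_group P"
proof (rule abelian_groupI)
  fix f assume f: "f \<in> carrier P"
  have "\<ominus>\<^bsub>K\<^esub> f q = \<zero>\<^bsub>K\<^esub> \<longleftrightarrow> f q = \<zero>\<^bsub>K\<^esub>" for q
    using P_coeff[OF f, of q] by (metis A.R.minus_minus A.R.minus_zero)
  then have "supp (\<lambda>q. \<ominus>\<^bsub>K\<^esub> f q) = supp f"
    by (simp add: supp_def)
  then have "(\<lambda>q. \<ominus>\<^bsub>K\<^esub> f q) \<in> carrier P"
    using f by (simp add: P_carrier_iff)
  with f show "\<exists>g\<in>carrier P. g \<oplus>\<^bsub>P\<^esub> f = \<zero>\<^bsub>P\<^esub>"
    by (intro bexI[of _ "\<lambda>q. \<ominus>\<^bsub>K\<^esub> f q"]) (auto simp: P_add P_zero A.R.l_neg P_coeff)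
qed (simp_all add: P_add_closed P_zero_closed, simp_all add: P_add P_zero P_coeff A.R.add.m_ac)

text \<open>Peeling off one point of the support at a time leaves the ring laws, and
  multiplicativity of maps out of \<open>P\<close>, to be checked on the functions
  \<open>single k u\<close>, where the product is explicit.\<close>

lemma P_induct [consumes 1, case_names zero base add]:
  assumes "f \<in> carrier P" and zero: "Q \<zero>\<^bsub>P\<^esub>"
    and base: "\<And>k u. \<lbrakk>k \<in> carrier K; u \<in> S\<rbrakk> \<Longrightarrow> Q (single k u)"
    and add: "\<And>f g. \<lbrakk>f \<in> carrier P; g \<in> carrier P; Q f; Q g\<rbrakk> \<Longrightarrow> Q (f \<oplus>\<^bsub>P\<^esub> g)"
  shows "Q f"
proof -
  have "finite (supp f)" using assms(1) by (simp add: P_carrier_iff)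
  then show ?thesis
    using assms(1)
  proof (induction "supp f" arbitrary: f rule: finite_induct)
    case empty
    then have "f = \<zero>\<^bsub>P\<^esub>"
      by (auto simp: supp_def P_zero)
    then show ?case using zero by simp
  next
    case (insert u F)
    define g where "g = f(u := \<zero>\<^bsub>K\<^esub>)"
    have F: "F = supp g"
      using insert.hyps(2,4) by (auto simp: g_def supp_def)
    have g: "g \<in> carrier P"
      using insert.prems insert.hyps(1,4) F by (auto simp: P_carrier_iff g_def)
    have u: "u \<in> S" "f u \<in> carrier K"
      using insert.prems insert.hyps(4) by (auto simp: P_carrier_iff)
    have "f = single (f u) u \<oplus>\<^bsub>P\<^esub> g"
      using insert.prems by (auto simp: P_add single_def g_def P_coeff)
    with insert.hyps(3)[OF F g] base[OF u(2,1)] add[OF single_closed[OF u(2,1)] g] show ?case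
      by simp
  qed
qed

text \<open>The product sums over the exact supports, and these change under addition. Allowing
  larger finite sets puts both sides of a distributive law over one index set.\<close>

lemma P_mult_eq:
  assumes "f \<in> carrier P" "g \<in> carrier P" "finite U" "finite V" "supp f \<subseteq> U" "supp g \<subseteq> V"
  shows "(f \<otimes>\<^bsub>P\<^esub> g) q = (\<Oplus>\<^bsub>K\<^esub>p\<in>{p \<in> U \<times> V. pmult (fst p) (snd p) = q}. f (fst p) \<otimes>\<^bsub>K\<^esub> g (snd p))"
  unfolding P_mult
proof (rule A.R.add.finprod_mono_neutral_cong_left)
  fix i assume "i \<in> {p \<in> U \<times> V. pmult (fst p) (snd p) = q} - {p \<in> supp f \<times> supp g. pmult (fst p) (snd p) = q}"
  then have "f (fst i) = \<zero>\<^bsub>K\<^esub> \<or> g (snd i) = \<zero>\<^bsub>K\<^esub>"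
    by (auto simp: supp_def)
  moreover have "f (fst i) \<in> carrier K" "g (snd i) \<in> carrier K"
    using assms by (auto simp: P_coeff)
  ultimately show "f (fst i) \<otimes>\<^bsub>K\<^esub> g (snd i) = \<zero>\<^bsub>K\<^esub>"
    by auto
qed (use assms in \<open>auto simp: P_coeff\<close>)

lemma P_mult_closed:
  assumes "f \<in> carrier P" "g \<in> carrier P"
  shows "f \<otimes>\<^bsub>P\<^esub> g \<in> carrier P"
  unfolding P_carrier_iff
proof (intro conjI allI)
  show "(f \<otimes>\<^bsub>P\<^esub> g) q \<in> carrier K" for q
    unfolding P_mult using assms by (intro A.R.finsum_closed) (auto simp: P_carrier_iff)
  have *: "supp (f \<otimes>\<^bsub>P\<^esub> g) \<subseteq> (\<lambda>p. pmult (fst p) (snd p)) ` (supp f \<times> supp g)"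
  proof
    fix q assume q: "q \<in> supp (f \<otimes>\<^bsub>P\<^esub> g)"
    show "q \<in> (\<lambda>p. pmult (fst p) (snd p)) ` (supp f \<times> supp g)"
    proof (rule ccontr)
      assume "\<not> ?thesis"
      then have "{p \<in> supp f \<times> supp g. pmult (fst p) (snd p) = q} = {}"
        by blast
      then have "(f \<otimes>\<^bsub>P\<^esub> g) q = \<zero>\<^bsub>K\<^esub>"
        by (simp only: P_mult A.R.finsum_empty)
      with q show False by (simp add: supp_def)
    qed
  qed
  have "(\<lambda>p. pmult (fst p) (snd p)) ` (supp f \<times> supp g) \<subseteq> S"
  proof
    fix q assume "q \<in> (\<lambda>p. pmult (fst p) (snd p)) ` (supp f \<times> supp g)"
    then obtain u v where "u \<in> supp f" "v \<in> supp g" and q: "q = pmult u v"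
      by auto
    with assms have "u \<in> S" "v \<in> S"
      by (auto simp: P_carrier_iff)
    then show "q \<in> S"
      unfolding q by (rule pmult_closed)
  qed
  with * show "supp (f \<otimes>\<^bsub>P\<^esub> g) \<subseteq> S" by blast
  show "finite (supp (f \<otimes>\<^bsub>P\<^esub> g))"
    using assms by (intro finite_subset[OF *]) (auto simp: P_carrier_iff)
qed

lemma single_mult_single:
  assumes "k \<in> carrier K" "l \<in> carrier K" "u \<in> S" "v \<in> S"
  shows "single k u \<otimes>\<^bsub>P\<^esub> single l v = single (k \<otimes>\<^bsub>K\<^esub> l) (pmult u v)"
proof
  fix q
  have "(single k u \<otimes>\<^bsub>P\<^esub> single l v) q
     = (\<Oplus>\<^bsub>K\<^esub>p\<in>{p \<in> {u} \<times> {v}. pmult (fst p) (snd p) = q}. single k u (fst p) \<otimes>\<^bsub>K\<^esub> single l v (snd p))"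
    using assms by (intro P_mult_eq single_closed) (auto simp: supp_def single_def)
  also have "{p \<in> {u} \<times> {v}. pmult (fst p) (snd p) = q} = (if q = pmult u v then {(u, v)} else {})"
    by auto
  finally show "(single k u \<otimes>\<^bsub>P\<^esub> single l v) q = single (k \<otimes>\<^bsub>K\<^esub> l) (pmult u v) q"
    using assms by (auto simp: single_def)
qed

lemma P_l_distr:
  assumes "f \<in> carrier P" "g \<in> carrier P" "h \<in> carrier P"
  shows "(f \<oplus>\<^bsub>P\<^esub> g) \<otimes>\<^bsub>P\<^esub> h = f \<otimes>\<^bsub>P\<^esub> h \<oplus>\<^bsub>P\<^esub> g \<otimes>\<^bsub>P\<^esub> h"
proof
  fix q
  define U where "U = supp f \<union> supp g"
  have U: "finite U" "supp f \<subseteq> U" "supp g \<subseteq> U" "supp (f \<oplus>\<^bsub>P\<^esub> g) \<subseteq> U" "finite (supp h)"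
    using assms by (auto simp: U_def P_carrier_iff P_add supp_def)
  have c: "f u \<in> carrier K" "g u \<in> carrier K" "h u \<in> carrier K" for u
    using assms by (auto simp: P_coeff)
  let ?Z = "{p \<in> U \<times> supp h. pmult (fst p) (snd p) = q}"
  have "((f \<oplus>\<^bsub>P\<^esub> g) \<otimes>\<^bsub>P\<^esub> h) q = (\<Oplus>\<^bsub>K\<^esub>p\<in>?Z. f (fst p) \<otimes>\<^bsub>K\<^esub> h (snd p) \<oplus>\<^bsub>K\<^esub> g (fst p) \<otimes>\<^bsub>K\<^esub> h (snd p))"
    using P_mult_eq[OF P_add_closed[OF assms(1,2)] assms(3) U(1,5,4) order_refl]
    by (simp add: P_add A.R.l_distr c)
  also have "\<dots> = (f \<otimes>\<^bsub>P\<^esub> h) q \<oplus>\<^bsub>K\<^esub> (g \<otimes>\<^bsub>P\<^esub> h) q"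
    using P_mult_eq[OF assms(1,3) U(1,5,2) order_refl] P_mult_eq[OF assms(2,3) U(1,5,3) order_refl]
    by (simp add: A.R.finsum_addf Pi_def c)
  finally show "((f \<oplus>\<^bsub>P\<^esub> g) \<otimes>\<^bsub>P\<^esub> h) q = (f \<otimes>\<^bsub>P\<^esub> h \<oplus>\<^bsub>P\<^esub> g \<otimes>\<^bsub>P\<^esub> h) q"
    by (simp add: P_add)
qed

lemma P_r_distr:
  assumes "f \<in> carrier P" "g \<in> carrier P" "h \<in> carrier P"
  shows "h \<otimes>\<^bsub>P\<^esub> (f \<oplus>\<^bsub>P\<^esub> g) = h \<otimes>\<^bsub>P\<^esub> f \<oplus>\<^bsub>P\<^esub> h \<otimes>\<^bsub>P\<^esub> g"
proof
  fix q
  define U where "U = supp f \<union> supp g"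
  have U: "finite U" "supp f \<subseteq> U" "supp g \<subseteq> U" "supp (f \<oplus>\<^bsub>P\<^esub> g) \<subseteq> U" "finite (supp h)"
    using assms by (auto simp: U_def P_carrier_iff P_add supp_def)
  have c: "f u \<in> carrier K" "g u \<in> carrier K" "h u \<in> carrier K" for u
    using assms by (auto simp: P_coeff)
  let ?Z = "{p \<in> supp h \<times> U. pmult (fst p) (snd p) = q}"
  have "(h \<otimes>\<^bsub>P\<^esub> (f \<oplus>\<^bsub>P\<^esub> g)) q = (\<Oplus>\<^bsub>K\<^esub>p\<in>?Z. h (fst p) \<otimes>\<^bsub>K\<^esub> f (snd p) \<oplus>\<^bsub>K\<^esub> h (fst p) \<otimes>\<^bsub>K\<^esub> g (snd p))"
    using P_mult_eq[OF assms(3) P_add_closed[OF assms(1,2)] U(5,1) order_refl U(4)]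
    by (simp add: P_add A.R.r_distr c)
  also have "\<dots> = (h \<otimes>\<^bsub>P\<^esub> f) q \<oplus>\<^bsub>K\<^esub> (h \<otimes>\<^bsub>P\<^esub> g) q"
    using P_mult_eq[OF assms(3,1) U(5,1) order_refl U(2)] P_mult_eq[OF assms(3,2) U(5,1) order_refl U(3)]
    by (simp add: A.R.finsum_addf Pi_def c)
  finally show "(h \<otimes>\<^bsub>P\<^esub> (f \<oplus>\<^bsub>P\<^esub> g)) q = (h \<otimes>\<^bsub>P\<^esub> f \<oplus>\<^bsub>P\<^esub> h \<otimes>\<^bsub>P\<^esub> g) q"
    by (simp add: P_add)
qed

sublocale P: abelian_group P
  by (rule P_abelian_group)

lemma P_zero_mult:
  assumes "f \<in> carrier P"
  shows "\<zero>\<^bsub>P\<^esub> \<otimes>\<^bsub>P\<^esub> f = \<zero>\<^bsub>P\<^esub>" "f \<otimes>\<^bsub>P\<^esub> \<zero>\<^bsub>P\<^esub> = \<zero>\<^bsub>P\<^esub>"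
  unfolding P_mult by (simp_all add: P_zero supp_def)

text \<open>Both sides are additive in each argument, so three nested inductions reduce the law to
  \<open>pmult_assoc\<close> and associativity in \<open>K\<close>.\<close>

lemma P_assoc:
  assumes "f \<in> carrier P" "g \<in> carrier P" "h \<in> carrier P"
  shows "(f \<otimes>\<^bsub>P\<^esub> g) \<otimes>\<^bsub>P\<^esub> h = f \<otimes>\<^bsub>P\<^esub> (g \<otimes>\<^bsub>P\<^esub> h)"
  using assms
proof (induction f arbitrary: g h rule: P_induct)
  case (base k u)
  note ku = base(1,2)
  from base(3,4) show ?case
  proof (induction g arbitrary: h rule: P_induct)
    case (base l v)
    note lv = base(1,2)
    from base(3) show ?case
    proof (induction h rule: P_induct)
      case (base m w)
      then show ?case
        using ku lv by (simp only: single_mult_single pmult_closed pmult_assoc A.R.m_assoc A.R.m_closed)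
    qed (simp_all add: ku lv single_closed P_mult_closed P_zero_mult P_r_distr del: mem_Sigma_iff)
  qed (simp_all add: ku single_closed P_mult_closed P_zero_mult P_l_distr P_r_distr del: mem_Sigma_iff)
qed (simp_all add: P_mult_closed P_zero_mult P_l_distr)

lemma P_ring: "ring P"
proof (rule ringI)
  have one: "\<one>\<^bsub>P\<^esub> \<in> carrier P" "(\<one>\<^bsub>A\<^esub>, \<one>\<^bsub>B\<^esub>) \<in> S"
    by (auto simp: P_one intro!: single_closed)
  show "Group.monoid P"
  proof (rule monoidI)
    fix f assume "f \<in> carrier P"
    then show "\<one>\<^bsub>P\<^esub> \<otimes>\<^bsub>P\<^esub> f = f"
    proof (induction rule: P_induct)
      case (base k u)
      have "pmult (\<one>\<^bsub>A\<^esub>, \<one>\<^bsub>B\<^esub>) u = u"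
        using base(2) by (cases u) (simp add: pmult_def)
      then show ?case
        using base one(2) by (simp only: P_one single_mult_single A.R.one_closed A.R.l_one)
    qed (simp_all add: P_zero_mult P_r_distr one)
    from \<open>f \<in> carrier P\<close> show "f \<otimes>\<^bsub>P\<^esub> \<one>\<^bsub>P\<^esub> = f"
    proof (induction rule: P_induct)
      case (base k u)
      have "pmult u (\<one>\<^bsub>A\<^esub>, \<one>\<^bsub>B\<^esub>) = u"
        using base(2) by (cases u) (simp add: pmult_def)
      then show ?case
        using base one(2) by (simp only: P_one single_mult_single A.R.one_closed A.R.r_one)
    qed (simp_all add: P_zero_mult P_l_distr one)
  qed (simp_all add: P_mult_closed P_assoc one)
qed (simp_all add: P_abelian_group P_l_distr P_r_distr)

sublocale P: ring P
  by (rule P_ring)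

section \<open>The tensor product as a quotient of the convolution ring\<close>

abbreviation "J \<equiv> Idl\<^bsub>P\<^esub> (bilinear_relators K A B)"

abbreviation "Q \<equiv> tensor_algebra K A B"

definition "tens a b = J +>\<^bsub>P\<^esub> single \<one>\<^bsub>K\<^esub> (a, b)"

lemma smult_single_one: "k \<in> carrier K \<Longrightarrow> k \<odot>\<^bsub>P\<^esub> single \<one>\<^bsub>K\<^esub> u = single k u"
  by (auto simp: P_smult single_def)

text \<open>Scaled basis vectors become \<open>single k u\<close>, so that every relator is a
  combination of \<open>single\<close> terms, and being a relator is settled by naming the ring
  elements involved.\<close>

lemma bilinear_relators_eq: "bilinear_relators K A B =
    {single \<one>\<^bsub>K\<^esub> (a \<oplus>\<^bsub>A\<^esub> a', b) \<ominus>\<^bsub>P\<^esub> (single \<one>\<^bsub>K\<^esub> (a, b) \<oplus>\<^bsub>P\<^esub> single \<one>\<^bsub>K\<^esub> (a', b)) | a a' b.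
      a \<in> carrier A \<and> a' \<in> carrier A \<and> b \<in> carrier B} \<union>
    {single \<one>\<^bsub>K\<^esub> (a, b \<oplus>\<^bsub>B\<^esub> b') \<ominus>\<^bsub>P\<^esub> (single \<one>\<^bsub>K\<^esub> (a, b) \<oplus>\<^bsub>P\<^esub> single \<one>\<^bsub>K\<^esub> (a, b')) | a b b'.
      a \<in> carrier A \<and> b \<in> carrier B \<and> b' \<in> carrier B} \<union>
    {single \<one>\<^bsub>K\<^esub> (k \<odot>\<^bsub>A\<^esub> a, b) \<ominus>\<^bsub>P\<^esub> single k (a, b) | k a b.
      k \<in> carrier K \<and> a \<in> carrier A \<and> b \<in> carrier B} \<union>
    {single \<one>\<^bsub>K\<^esub> (a, k \<odot>\<^bsub>B\<^esub> b) \<ominus>\<^bsub>P\<^esub> single k (a, b) | k a b.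
      k \<in> carrier K \<and> a \<in> carrier A \<and> b \<in> carrier B}"
proof -
  have *: "{F k a b (k \<odot>\<^bsub>P\<^esub> single \<one>\<^bsub>K\<^esub> (a, b)) | k a b. k \<in> carrier K \<and> a \<in> carrier A \<and> b \<in> carrier B}
    = {F k a b (single k (a, b)) | k a b. k \<in> carrier K \<and> a \<in> carrier A \<and> b \<in> carrier B}" for F
    using smult_single_one by (intro Collect_cong ex_cong1) metis
  show ?thesis
    unfolding bilinear_relators_def Let_def free_basis_eq_single
      *[of "\<lambda>k a b s. single \<one>\<^bsub>K\<^esub> (k \<odot>\<^bsub>A\<^esub> a, b) \<ominus>\<^bsub>P\<^esub> s"]
      *[of "\<lambda>k a b s. single \<one>\<^bsub>K\<^esub> (a, k \<odot>\<^bsub>B\<^esub> b) \<ominus>\<^bsub>P\<^esub> s"] ..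
qed

lemma bilinear_relators_cases [consumes 1, case_names add_left add_right smult_left smult_right]:
  assumes "x \<in> bilinear_relators K A B"
  obtains a a' b where "a \<in> carrier A" "a' \<in> carrier A" "b \<in> carrier B"
      "x = single \<one>\<^bsub>K\<^esub> (a \<oplus>\<^bsub>A\<^esub> a', b) \<ominus>\<^bsub>P\<^esub> (single \<one>\<^bsub>K\<^esub> (a, b) \<oplus>\<^bsub>P\<^esub> single \<one>\<^bsub>K\<^esub> (a', b))"
  | a b b' where "a \<in> carrier A" "b \<in> carrier B" "b' \<in> carrier B"
      "x = single \<one>\<^bsub>K\<^esub> (a, b \<oplus>\<^bsub>B\<^esub> b') \<ominus>\<^bsub>P\<^esub> (single \<one>\<^bsub>K\<^esub> (a, b) \<oplus>\<^bsub>P\<^esub> single \<one>\<^bsub>K\<^esub> (a, b'))"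
  | k a b where "k \<in> carrier K" "a \<in> carrier A" "b \<in> carrier B"
      "x = single \<one>\<^bsub>K\<^esub> (k \<odot>\<^bsub>A\<^esub> a, b) \<ominus>\<^bsub>P\<^esub> single k (a, b)"
  | k a b where "k \<in> carrier K" "a \<in> carrier A" "b \<in> carrier B"
      "x = single \<one>\<^bsub>K\<^esub> (a, k \<odot>\<^bsub>B\<^esub> b) \<ominus>\<^bsub>P\<^esub> single k (a, b)"
  using assms unfolding bilinear_relators_eq
  by (elim UnE CollectE exE conjE; use that in metis)

lemma bilinear_relators_subset: "bilinear_relators K A B \<subseteq> carrier P"
proof
  fix x assume "x \<in> bilinear_relators K A B"
  then show "x \<in> carrier P"
    by (cases rule: bilinear_relators_cases) (simp_all add: single_closed)
qed

lemma J_ideal: "ideal J P"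
  by (rule P.genideal_ideal) (rule bilinear_relators_subset)

lemma ring_Q: "ring Q"
  unfolding tensor_algebra_def by (rule ideal.quotient_is_ring[OF J_ideal])

sublocale Q: ring Q
  by (rule ring_Q)

lemma coset_hom: "(+>\<^bsub>P\<^esub>) J \<in> ring_hom P Q"
  unfolding tensor_algebra_def by (rule ideal.rcos_ring_hom[OF J_ideal])

lemma coset_closed: "f \<in> carrier P \<Longrightarrow> J +>\<^bsub>P\<^esub> f \<in> carrier Q"
  and coset_mult: "f \<in> carrier P \<Longrightarrow> g \<in> carrier P \<Longrightarrow> J +>\<^bsub>P\<^esub> (f \<otimes>\<^bsub>P\<^esub> g) = (J +>\<^bsub>P\<^esub> f) \<otimes>\<^bsub>Q\<^esub> (J +>\<^bsub>P\<^esub> g)"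
  and coset_add: "f \<in> carrier P \<Longrightarrow> g \<in> carrier P \<Longrightarrow> J +>\<^bsub>P\<^esub> (f \<oplus>\<^bsub>P\<^esub> g) = (J +>\<^bsub>P\<^esub> f) \<oplus>\<^bsub>Q\<^esub> (J +>\<^bsub>P\<^esub> g)"
  using ring_hom_memE[OF coset_hom] by blast+

lemma coset_zero: "J +>\<^bsub>P\<^esub> \<zero>\<^bsub>P\<^esub> = \<zero>\<^bsub>Q\<^esub>"
  using coset_add[of "\<zero>\<^bsub>P\<^esub>" "\<zero>\<^bsub>P\<^esub>"] coset_closed[of "\<zero>\<^bsub>P\<^esub>"] by (metis P.r_zero P.zero_closed Q.add.l_cancel_one')

lemma coset_finsum:
  assumes "finite I" "f \<in> I \<rightarrow> carrier P"
  shows "J +>\<^bsub>P\<^esub> (finsum P f I) = (\<Oplus>\<^bsub>Q\<^esub>i\<in>I. J +>\<^bsub>P\<^esub> f i)"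
  using assms
  by (intro finsum_additive[where h = "(+>\<^bsub>P\<^esub>) J"] P.abelian_monoid_axioms Q.abelian_monoid_axioms)
     (auto simp: coset_closed coset_add coset_zero)

lemma coset_cases:
  assumes "x \<in> carrier Q"
  obtains f where "f \<in> carrier P" "x = J +>\<^bsub>P\<^esub> f"
  using assms unfolding tensor_algebra_def FactRing_def A_RCOSETS_def' by auto

lemma coset_eqI: "f \<in> carrier P \<Longrightarrow> g \<in> carrier P \<Longrightarrow> f \<ominus>\<^bsub>P\<^esub> g \<in> bilinear_relators K A B \<Longrightarrow> J +>\<^bsub>P\<^esub> f = J +>\<^bsub>P\<^esub> g"
  using P.quotient_eq_iff_same_a_r_cos[OF J_ideal] P.genideal_self[OF bilinear_relators_subset] by blast

text \<open>The coefficient may be read into either factor, since both readings differ from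
  \<open>single k (a, b)\<close> by a relator. Comparing them lets scalars cross the tensor
  sign.\<close>

lemma coset_single:
  assumes "k \<in> carrier K" "a \<in> carrier A" "b \<in> carrier B"
  shows "J +>\<^bsub>P\<^esub> single k (a, b) = tens (k \<odot>\<^bsub>A\<^esub> a) b" "J +>\<^bsub>P\<^esub> single k (a, b) = tens a (k \<odot>\<^bsub>B\<^esub> b)"
proof -
  have c: "single k (a, b) \<in> carrier P" "single \<one>\<^bsub>K\<^esub> (k \<odot>\<^bsub>A\<^esub> a, b) \<in> carrier P"
    "single \<one>\<^bsub>K\<^esub> (a, k \<odot>\<^bsub>B\<^esub> b) \<in> carrier P"
    using assms by (simp_all add: single_closed)
  show "J +>\<^bsub>P\<^esub> single k (a, b) = tens (k \<odot>\<^bsub>A\<^esub> a) b"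
    unfolding tens_def
    by (rule coset_eqI[symmetric, OF c(2,1)]) (use assms in \<open>unfold bilinear_relators_eq, blast\<close>)
  show "J +>\<^bsub>P\<^esub> single k (a, b) = tens a (k \<odot>\<^bsub>B\<^esub> b)"
    unfolding tens_def
    by (rule coset_eqI[symmetric, OF c(3,1)]) (use assms in \<open>unfold bilinear_relators_eq, blast\<close>)
qed

lemma tens_closed [simp, intro]: "a \<in> carrier A \<Longrightarrow> b \<in> carrier B \<Longrightarrow> tens a b \<in> carrier Q"
  unfolding tens_def by (intro coset_closed single_closed) auto

lemma tens_smult_swap:
  assumes "k \<in> carrier K" "a \<in> carrier A" "b \<in> carrier B"
  shows "tens (k \<odot>\<^bsub>A\<^esub> a) b = tens a (k \<odot>\<^bsub>B\<^esub> b)"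
  using coset_single[OF assms] by simp

lemma tens_add_left:
  assumes "a \<in> carrier A" "a' \<in> carrier A" "b \<in> carrier B"
  shows "tens (a \<oplus>\<^bsub>A\<^esub> a') b = tens a b \<oplus>\<^bsub>Q\<^esub> tens a' b"
proof -
  have c: "single \<one>\<^bsub>K\<^esub> (a, b) \<in> carrier P" "single \<one>\<^bsub>K\<^esub> (a', b) \<in> carrier P"
    "single \<one>\<^bsub>K\<^esub> (a \<oplus>\<^bsub>A\<^esub> a', b) \<in> carrier P"
    using assms by (simp_all add: single_closed)
  show ?thesis
    unfolding tens_def coset_add[OF c(1,2), symmetric]
    by (rule coset_eqI[OF c(3) P.a_closed[OF c(1,2)]]) (use assms in \<open>unfold bilinear_relators_eq, blast\<close>)
qed

lemma tens_add_right:
  assumes "a \<in> carrier A" "b \<in> carrier B" "b' \<in> carrier B"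
  shows "tens a (b \<oplus>\<^bsub>B\<^esub> b') = tens a b \<oplus>\<^bsub>Q\<^esub> tens a b'"
proof -
  have c: "single \<one>\<^bsub>K\<^esub> (a, b) \<in> carrier P" "single \<one>\<^bsub>K\<^esub> (a, b') \<in> carrier P"
    "single \<one>\<^bsub>K\<^esub> (a, b \<oplus>\<^bsub>B\<^esub> b') \<in> carrier P"
    using assms by (simp_all add: single_closed)
  show ?thesis
    unfolding tens_def coset_add[OF c(1,2), symmetric]
    by (rule coset_eqI[OF c(3) P.a_closed[OF c(1,2)]]) (use assms in \<open>unfold bilinear_relators_eq, blast\<close>)
qed

lemma tens_mult:
  assumes "a \<in> carrier A" "a' \<in> carrier A" "b \<in> carrier B" "b' \<in> carrier B"
  shows "tens a b \<otimes>\<^bsub>Q\<^esub> tens a' b' = tens (a \<otimes>\<^bsub>A\<^esub> a') (b \<otimes>\<^bsub>B\<^esub> b')"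
  unfolding tens_def using assms
  by (subst coset_mult[symmetric]; simp add: single_closed single_mult_single pmult_def)

lemma tens_zero_left: "b \<in> carrier B \<Longrightarrow> tens \<zero>\<^bsub>A\<^esub> b = \<zero>\<^bsub>Q\<^esub>"
  using tens_add_left[of "\<zero>\<^bsub>A\<^esub>" "\<zero>\<^bsub>A\<^esub>" b] tens_closed[of "\<zero>\<^bsub>A\<^esub>" b]
  by (metis A.r_zero A.zero_closed Q.add.l_cancel_one')

lemma tens_zero_right: "a \<in> carrier A \<Longrightarrow> tens a \<zero>\<^bsub>B\<^esub> = \<zero>\<^bsub>Q\<^esub>"
  using tens_add_right[of a "\<zero>\<^bsub>B\<^esub>" "\<zero>\<^bsub>B\<^esub>"] tens_closed[of a "\<zero>\<^bsub>B\<^esub>"]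
  by (metis B.r_zero B.zero_closed Q.add.l_cancel_one')

lemma tens_finsum_left:
  assumes "finite I" "f \<in> I \<rightarrow> carrier A" "b \<in> carrier B"
  shows "tens (finsum A f I) b = (\<Oplus>\<^bsub>Q\<^esub>i\<in>I. tens (f i) b)"
  using assms
  by (intro finsum_additive[where h = "\<lambda>a. tens a b"] A.abelian_monoid_axioms Q.abelian_monoid_axioms)
     (auto simp: tens_add_left tens_zero_left)

lemma tens_finsum_right:
  assumes "finite I" "f \<in> I \<rightarrow> carrier B" "a \<in> carrier A"
  shows "tens a (finsum B f I) = (\<Oplus>\<^bsub>Q\<^esub>i\<in>I. tens a (f i))"
  using assms
  by (intro finsum_additive[where h = "\<lambda>b. tens a b"] B.abelian_monoid_axioms Q.abelian_monoid_axioms)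
     (auto simp: tens_add_right tens_zero_right)

section \<open>Linear extension and descent to the tensor product\<close>

definition "lin_ext N \<phi> f = (\<Oplus>\<^bsub>N\<^esub>q\<in>supp f. f q \<odot>\<^bsub>N\<^esub> \<phi> q)"

lemma lin_ext_eq:
  assumes "module K N" "\<phi> \<in> S \<rightarrow> carrier N" "f \<in> carrier P" "finite U" "supp f \<subseteq> U" "U \<subseteq> S"
  shows "lin_ext N \<phi> f = (\<Oplus>\<^bsub>N\<^esub>q\<in>U. f q \<odot>\<^bsub>N\<^esub> \<phi> q)"
proof -
  interpret N: module K N by fact
  show ?thesis
    unfolding lin_ext_def
  proof (rule N.M.add.finprod_mono_neutral_cong_left)
    fix q assume q: "q \<in> U - supp f"
    then have "\<phi> q \<in> carrier N" using assms by auto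
    moreover have "f q = \<zero>\<^bsub>K\<^esub>" using q by (simp add: supp_def)
    ultimately show "f q \<odot>\<^bsub>N\<^esub> \<phi> q = \<zero>\<^bsub>N\<^esub>"
      by simp
  next
    show "(\<lambda>q. f q \<odot>\<^bsub>N\<^esub> \<phi> q) \<in> U \<rightarrow> carrier N"
      using assms(2,6) by (intro Pi_I N.smult_closed P_coeff[OF assms(3)]) auto
  qed (use assms in auto)
qed

lemma lin_ext_zero: "module K N \<Longrightarrow> lin_ext N \<phi> \<zero>\<^bsub>P\<^esub> = \<zero>\<^bsub>N\<^esub>"
  by (simp add: lin_ext_def P_zero supp_def abelian_monoid.finsum_empty module_def abelian_group_def)

lemma lin_ext_closed:
  assumes "module K N" "\<phi> \<in> S \<rightarrow> carrier N" "f \<in> carrier P"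
  shows "lin_ext N \<phi> f \<in> carrier N"
proof -
  interpret N: module K N by fact
  have "supp f \<subseteq> S" using assms(3) by (simp add: P_carrier_iff)
  with assms(2) show ?thesis
    unfolding lin_ext_def by (intro N.M.finsum_closed Pi_I N.smult_closed P_coeff[OF assms(3)]) auto
qed

lemma lin_ext_add:
  assumes "module K N" "\<phi> \<in> S \<rightarrow> carrier N" "f \<in> carrier P" "g \<in> carrier P"
  shows "lin_ext N \<phi> (f \<oplus>\<^bsub>P\<^esub> g) = lin_ext N \<phi> f \<oplus>\<^bsub>N\<^esub> lin_ext N \<phi> g"
proof -
  interpret N: module K N by fact
  define U where "U = supp f \<union> supp g"
  have fg: "supp f \<subseteq> S" "finite (supp f)" "supp g \<subseteq> S" "finite (supp g)"
    using assms(3,4) by (auto simp: P_carrier_iff)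
  have c: "f q \<in> carrier K" "g q \<in> carrier K" for q
    using assms(3,4) by (auto intro: P_coeff)
  have U: "finite U" "supp f \<subseteq> U" "supp g \<subseteq> U" "supp (f \<oplus>\<^bsub>P\<^esub> g) \<subseteq> U" "U \<subseteq> S"
    using fg by (auto simp: U_def P_add supp_def)
  have \<phi>: "q \<in> U \<Longrightarrow> \<phi> q \<in> carrier N" for q
    using U(5) assms(2) by auto
  have "lin_ext N \<phi> (f \<oplus>\<^bsub>P\<^esub> g) = (\<Oplus>\<^bsub>N\<^esub>q\<in>U. f q \<odot>\<^bsub>N\<^esub> \<phi> q \<oplus>\<^bsub>N\<^esub> g q \<odot>\<^bsub>N\<^esub> \<phi> q)"
    unfolding lin_ext_eq[OF assms(1,2) P_add_closed[OF assms(3,4)] U(1,4,5)]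
    by (intro N.M.finsum_cong') (auto simp: P_add N.smult_l_distr c \<phi>)
  also have "\<dots> = lin_ext N \<phi> f \<oplus>\<^bsub>N\<^esub> lin_ext N \<phi> g"
    unfolding lin_ext_eq[OF assms(1,2,3) U(1,2,5)] lin_ext_eq[OF assms(1,2,4) U(1,3,5)]
    by (rule N.M.finsum_addf) (auto simp: c \<phi>)
  finally show ?thesis .
qed

lemma lin_ext_single:
  assumes "module K N" "\<phi> \<in> S \<rightarrow> carrier N" "k \<in> carrier K" "u \<in> S"
  shows "lin_ext N \<phi> (single k u) = k \<odot>\<^bsub>N\<^esub> \<phi> u"
proof -
  interpret N: module K N by fact
  have "\<phi> u \<in> carrier N" using assms by auto
  moreover have "lin_ext N \<phi> (single k u) = (\<Oplus>\<^bsub>N\<^esub>q\<in>{u}. single k u q \<odot>\<^bsub>N\<^esub> \<phi> q)"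
    using assms by (intro lin_ext_eq single_closed) (auto simp: supp_def single_def)
  ultimately show ?thesis
    using assms by (simp add: single_def)
qed

lemma lin_ext_finsum:
  assumes "module K N" "\<phi> \<in> S \<rightarrow> carrier N" "finite I" "f \<in> I \<rightarrow> carrier P"
  shows "lin_ext N \<phi> (finsum P f I) = (\<Oplus>\<^bsub>N\<^esub>i\<in>I. lin_ext N \<phi> (f i))"
proof -
  interpret N: module K N by fact
  show ?thesis
    by (rule finsum_additive[OF P.abelian_monoid_axioms N.M.abelian_monoid_axioms _
          lin_ext_zero[OF assms(1)] lin_ext_add[OF assms(1,2)] assms(3,4)])
       (auto intro: lin_ext_closed[OF assms(1,2)])
qed

text \<open>
  Multiplicativity makes the kernel of the linear extension an ideal, so that it contains \<open>J\<close> as soon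
  as it contains the relators.
\<close>

definition "algebra_bilinear N \<phi> \<longleftrightarrow> \<phi> \<in> S \<rightarrow> carrier N \<and>
  (\<forall>a\<in>carrier A. \<forall>a'\<in>carrier A. \<forall>b\<in>carrier B. \<phi> (a \<oplus>\<^bsub>A\<^esub> a', b) = \<phi> (a, b) \<oplus>\<^bsub>N\<^esub> \<phi> (a', b)) \<and>
  (\<forall>a\<in>carrier A. \<forall>b\<in>carrier B. \<forall>b'\<in>carrier B. \<phi> (a, b \<oplus>\<^bsub>B\<^esub> b') = \<phi> (a, b) \<oplus>\<^bsub>N\<^esub> \<phi> (a, b')) \<and>
  (\<forall>k\<in>carrier K. \<forall>a\<in>carrier A. \<forall>b\<in>carrier B.
     \<phi> (k \<odot>\<^bsub>A\<^esub> a, b) = k \<odot>\<^bsub>N\<^esub> \<phi> (a, b) \<and> \<phi> (a, k \<odot>\<^bsub>B\<^esub> b) = k \<odot>\<^bsub>N\<^esub> \<phi> (a, b)) \<and>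
  (\<forall>a\<in>carrier A. \<forall>a'\<in>carrier A. \<forall>b\<in>carrier B. \<forall>b'\<in>carrier B.
     \<phi> (a \<otimes>\<^bsub>A\<^esub> a', b \<otimes>\<^bsub>B\<^esub> b') = \<phi> (a, b) \<otimes>\<^bsub>N\<^esub> \<phi> (a', b'))"

text \<open>Both sides are additive in \<open>f\<close> and in \<open>g\<close>, which leaves basis
  vectors; there the claim is the last clause of \<open>algebra_bilinear\<close>, up to moving
  scalars.\<close>

lemma lin_ext_mult:
  assumes "algebra K N" "algebra_bilinear N \<phi>" "f \<in> carrier P" "g \<in> carrier P"
  shows "lin_ext N \<phi> (f \<otimes>\<^bsub>P\<^esub> g) = lin_ext N \<phi> f \<otimes>\<^bsub>N\<^esub> lin_ext N \<phi> g"
proof -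
  interpret N: algebra K N by fact
  have \<phi>: "\<phi> \<in> S \<rightarrow> carrier N"
    using assms(2) by (simp add: algebra_bilinear_def)
  note lin = lin_ext_zero[OF N.module_axioms] lin_ext_closed[OF N.module_axioms \<phi>]
    lin_ext_add[OF N.module_axioms \<phi>]
  from assms(3,4) show ?thesis
  proof (induction f rule: P_induct)
    case (base k u)
    note ku = base(1,2)
    from base(3) show ?case
    proof (induction g rule: P_induct)
      case (base l v)
      have uv: "\<phi> (pmult u v) = \<phi> u \<otimes>\<^bsub>N\<^esub> \<phi> v"
        using ku base assms(2) by (cases u; cases v) (simp add: pmult_def algebra_bilinear_def)
      have c: "\<phi> u \<in> carrier N" "\<phi> v \<in> carrier N"
        using \<phi> ku base by auto
      have "(k \<odot>\<^bsub>N\<^esub> \<phi> u) \<otimes>\<^bsub>N\<^esub> (l \<odot>\<^bsub>N\<^esub> \<phi> v) = (k \<otimes>\<^bsub>K\<^esub> l) \<odot>\<^bsub>N\<^esub> (\<phi> u \<otimes>\<^bsub>N\<^esub> \<phi> v)"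
        using c ku(1) base(1)
        by (simp add: N.smult_assoc1 N.smult_assoc2 N.m_comm[of "\<phi> u"])
      then show ?case
        unfolding single_mult_single[OF ku(1) base(1) ku(2) base(2)] uv
          lin_ext_single[OF N.module_axioms \<phi> A.R.m_closed[OF ku(1) base(1)] pmult_closed[OF ku(2) base(2)]]
          lin_ext_single[OF N.module_axioms \<phi> ku] lin_ext_single[OF N.module_axioms \<phi> base(1,2)]
        by (rule sym)
    qed (simp_all add: lin P_r_distr N.r_distr single_closed ku P_zero_mult P_mult_closed)
  qed (simp_all add: lin P_l_distr N.l_distr P_zero_mult P_mult_closed)
qed

text \<open>This is what makes maps out of the tensor product available although its elements are
  cosets: a value may be computed from any representative.\<close>

lemma lin_ext_coset:
  assumes "algebra K N" "algebra_bilinear N \<phi>" "f \<in> carrier P" "g \<in> carrier P"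
    and "J +>\<^bsub>P\<^esub> f = J +>\<^bsub>P\<^esub> g"
  shows "lin_ext N \<phi> f = lin_ext N \<phi> g"
proof -
  interpret N: algebra K N by fact
  have \<phi>: "\<phi> \<in> S \<rightarrow> carrier N"
    using assms(2) by (simp add: algebra_bilinear_def)
  let ?L = "lin_ext N \<phi>"
  note zero = lin_ext_zero[OF N.module_axioms, of \<phi>]
    and closed = lin_ext_closed[OF N.module_axioms \<phi>]
    and add = lin_ext_add[OF N.module_axioms \<phi>]
    and single = lin_ext_single[OF N.module_axioms \<phi>]
  have minus: "?L (h \<ominus>\<^bsub>P\<^esub> h') = ?L h \<ominus>\<^bsub>N\<^esub> ?L h'" if "h \<in> carrier P" "h' \<in> carrier P" for h h'
  proof -
    have "?L (h \<ominus>\<^bsub>P\<^esub> h') \<oplus>\<^bsub>N\<^esub> ?L h' = ?L h"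
      using that add[of "h \<ominus>\<^bsub>P\<^esub> h'" h'] by (simp add: P.minus_eq P.a_assoc P.l_neg)
    then show ?thesis
      using that closed by (metis N.add.inv_solve_right' N.minus_eq P.minus_closed)
  qed
  define Z where "Z = {h \<in> carrier P. ?L h = \<zero>\<^bsub>N\<^esub>}"
  have "ideal Z P"
  proof (rule idealI[OF P_ring])
    show "subgroup Z (add_monoid P)"
    proof (rule P.add.subgroupI)
      fix h assume h: "h \<in> Z"
      then have "?L (\<zero>\<^bsub>P\<^esub> \<ominus>\<^bsub>P\<^esub> h) = \<zero>\<^bsub>N\<^esub>"
        by (subst minus) (auto simp: Z_def zero N.minus_eq)
      with h show "\<ominus>\<^bsub>P\<^esub> h \<in> Z"
        by (simp add: Z_def P.minus_eq)
    qed (auto simp: Z_def zero add intro: exI[of _ "\<zero>\<^bsub>P\<^esub>"])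
  qed (auto simp: Z_def lin_ext_mult[OF assms(1,2)] closed P_mult_closed)
  moreover have "bilinear_relators K A B \<subseteq> Z"
  proof -
    have c: "a \<in> carrier A \<Longrightarrow> b \<in> carrier B \<Longrightarrow> \<phi> (a, b) \<in> carrier N" for a b
      using \<phi> by auto
    have "h \<in> Z" if "h \<in> bilinear_relators K A B" for h
      using that
    proof (cases rule: bilinear_relators_cases)
      case (add_left a a' b)
      with assms(2) show ?thesis
        by (simp add: Z_def minus single_closed single add c N.minus_eq N.r_neg algebra_bilinear_def)
    next
      case (add_right a b b')
      with assms(2) show ?thesis
        by (simp add: Z_def minus single_closed single add c N.minus_eq N.r_neg algebra_bilinear_def)
    next
      case (smult_left k a b)
      with assms(2) show ?thesis
        by (simp add: Z_def minus single_closed single c N.minus_eq N.r_neg algebra_bilinear_def)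
    next
      case (smult_right k a b)
      with assms(2) show ?thesis
        by (simp add: Z_def minus single_closed single c N.minus_eq N.r_neg algebra_bilinear_def)
    qed
    then show ?thesis by blast
  qed
  ultimately have "J \<subseteq> Z"
    by (rule P.genideal_minimal)
  moreover have "f \<ominus>\<^bsub>P\<^esub> g \<in> J"
    using P.quotient_eq_iff_same_a_r_cos[OF J_ideal assms(3,4)] assms(5) by simp
  ultimately have "?L f \<ominus>\<^bsub>N\<^esub> ?L g = \<zero>\<^bsub>N\<^esub>"
    using minus[OF assms(3,4)] by (auto simp: Z_def)
  then show ?thesis
    using closed assms(3,4) by (simp add: N.r_right_minus_eq)
qed

end

lemma (in algebra) mult_smult:
  assumes "k \<in> carrier R" "x \<in> carrier M" "y \<in> carrier M"
  shows "x \<otimes>\<^bsub>M\<^esub> (k \<odot>\<^bsub>M\<^esub> y) = k \<odot>\<^bsub>M\<^esub> (x \<otimes>\<^bsub>M\<^esub> y)"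
  using assms smult_assoc2[of k y x] by (simp add: m_comm[of x])

section \<open>Separable algebras\<close>

text \<open>\<open>M\<close> is just an abelian group with a scalar operation, so that
  \<open>mult_module\<close> can be inserted without a proof of the module axioms. The closure and
  linearity facts are read off from \<open>p\<close> on scaled basis vectors.\<close>

lemma module_hom_free_expansion:
  assumes "ring A" "abelian_group M" and p: "p \<in> module_homs A (free_module A I) M"
    and f: "f \<in> carrier (free_module A I)"
  shows "p f = (\<Oplus>\<^bsub>M\<^esub>i\<in>{i. f i \<noteq> \<zero>\<^bsub>A\<^esub>}. f i \<odot>\<^bsub>M\<^esub> p (free_basis A i))"
    and "i \<in> I \<Longrightarrow> free_basis A i \<in> carrier (free_module A I)"
proof -
  interpret A: ring A by fact
  interpret M: abelian_group M by fact
  let ?F = "free_module A I"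
  have F_iff: "f \<in> carrier ?F \<longleftrightarrow> (\<forall>i. f i \<in> carrier A) \<and> {i. f i \<noteq> \<zero>\<^bsub>A\<^esub>} \<subseteq> I \<and> finite {i. f i \<noteq> \<zero>\<^bsub>A\<^esub>}" for f
    by (simp add: free_module_def)
  have basis: "free_basis A i \<in> carrier ?F" if "i \<in> I" for i
    using that by (auto simp: F_iff free_basis_def intro: finite_subset[of _ "{i}"])
  then show "i \<in> I \<Longrightarrow> free_basis A i \<in> carrier ?F" .
  have p_closed: "f \<in> carrier ?F \<Longrightarrow> p f \<in> carrier M"
    and p_add: "f \<in> carrier ?F \<Longrightarrow> g \<in> carrier ?F \<Longrightarrow> p (f \<oplus>\<^bsub>?F\<^esub> g) = p f \<oplus>\<^bsub>M\<^esub> p g"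
    and p_smult: "a \<in> carrier A \<Longrightarrow> f \<in> carrier ?F \<Longrightarrow> p (a \<odot>\<^bsub>?F\<^esub> f) = a \<odot>\<^bsub>M\<^esub> p f" for a f g
    using p by (auto simp: module_homs_def)
  have scaled: "a \<odot>\<^bsub>?F\<^esub> free_basis A i = (\<lambda>j. if j = i then a else \<zero>\<^bsub>A\<^esub>)" if "a \<in> carrier A" for a i
    using that by (auto simp: free_module_def free_basis_def)
  have scaled_closed: "a \<odot>\<^bsub>?F\<^esub> free_basis A i \<in> carrier ?F" if "a \<in> carrier A" "i \<in> I" for a i
    unfolding scaled[OF that(1)] using that by (auto simp: F_iff intro: finite_subset[of _ "{i}"])
  have "finite {i. f i \<noteq> \<zero>\<^bsub>A\<^esub>}" using f by (simp add: F_iff)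
  then show "p f = (\<Oplus>\<^bsub>M\<^esub>i\<in>{i. f i \<noteq> \<zero>\<^bsub>A\<^esub>}. f i \<odot>\<^bsub>M\<^esub> p (free_basis A i))"
    using f
  proof (induction "{i. f i \<noteq> \<zero>\<^bsub>A\<^esub>}" arbitrary: f rule: finite_induct)
    case empty
    \<comment> \<open>Homomorphisms are described by additivity and scaling; that zero goes to zero
      follows by cancelling in \<open>p f + p f = p f\<close>.\<close>
    then have ff: "f \<oplus>\<^bsub>?F\<^esub> f = f"
      by (auto simp: free_module_def)
    have "p f \<oplus>\<^bsub>M\<^esub> p f = p f"
      by (rule trans[OF p_add[OF empty(2,2), symmetric] arg_cong[where f = p, OF ff]])
    then have "p f = \<zero>\<^bsub>M\<^esub>"
      using p_closed[OF empty(2)] by simp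
    then show ?case
      unfolding empty(1)[symmetric] by simp
  next
    case (insert i U)
    define g where "g = f(i := \<zero>\<^bsub>A\<^esub>)"
    have U: "U = {j. g j \<noteq> \<zero>\<^bsub>A\<^esub>}"
      using insert.hyps(2,4) by (auto simp: g_def)
    have g: "g \<in> carrier ?F"
      using insert.prems insert.hyps(1,4) U by (auto simp: F_iff g_def)
    have i: "i \<in> I" and fA: "f j \<in> carrier A" for j
      using insert.prems insert.hyps(4) by (auto simp: F_iff)
    have f_eq: "f = f i \<odot>\<^bsub>?F\<^esub> free_basis A i \<oplus>\<^bsub>?F\<^esub> g"
      unfolding scaled[OF fA] using fA by (auto simp: free_module_def g_def)
    have UI: "U \<subseteq> I"
      using insert.prems insert.hyps(4) by (auto simp: F_iff)
    have c: "f j \<odot>\<^bsub>M\<^esub> p (free_basis A j) \<in> carrier M" if "j \<in> I" for j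
      using p_closed[OF scaled_closed[OF fA that]] unfolding p_smult[OF fA basis[OF that]] .
    have "p f = p (f i \<odot>\<^bsub>?F\<^esub> free_basis A i) \<oplus>\<^bsub>M\<^esub> p g"
      by (rule trans[OF arg_cong[where f = p, OF f_eq] p_add[OF scaled_closed[OF fA i] g]])
    also have "p (f i \<odot>\<^bsub>?F\<^esub> free_basis A i) = f i \<odot>\<^bsub>M\<^esub> p (free_basis A i)"
      by (rule p_smult[OF fA basis[OF i]])
    also have "p g = (\<Oplus>\<^bsub>M\<^esub>j\<in>U. g j \<odot>\<^bsub>M\<^esub> p (free_basis A j))"
      using insert.hyps(3)[OF U g] U by simp
    also have "\<dots> = (\<Oplus>\<^bsub>M\<^esub>j\<in>U. f j \<odot>\<^bsub>M\<^esub> p (free_basis A j))"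
      using insert.hyps(2) UI c by (intro M.finsum_cong'[OF refl]) (auto simp: g_def)
    also have "f i \<odot>\<^bsub>M\<^esub> p (free_basis A i) \<oplus>\<^bsub>M\<^esub> \<dots> = (\<Oplus>\<^bsub>M\<^esub>j\<in>insert i U. f j \<odot>\<^bsub>M\<^esub> p (free_basis A j))"
      using insert.hyps(1,2) UI i c by (intro M.finsum_insert[symmetric]) auto
    finally show ?case
      using insert.hyps(4) by simp
  qed
qed

section \<open>Separability idempotents and splittings of the multiplication map\<close>

locale tensor_square = algebra K A
  for K :: "('k, 'x) ring_scheme"
    and A :: "('k, 'a, 'y) module_scheme"
begin

sublocale algebra_pair K A A
  by unfold_locales

text \<open>The multiplication map a \<otimes> b \<mapsto> a b, taken on representatives in
  \<open>P\<close>; \<open>mu_coset\<close> makes it descend to the tensor product.\<close>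

definition "mu = lin_ext A (\<lambda>q. fst q \<otimes>\<^bsub>A\<^esub> snd q)"

abbreviation "act \<equiv> module.smult (mult_module K A)"

lemma product_bilinear: "algebra_bilinear A (\<lambda>q. fst q \<otimes>\<^bsub>A\<^esub> snd q)"
  unfolding algebra_bilinear_def
proof (intro conjI ballI)
  show "(\<lambda>q. fst q \<otimes>\<^bsub>A\<^esub> snd q) \<in> S \<rightarrow> carrier A"
    by auto
qed (simp_all add: l_distr r_distr smult_assoc2 mult_smult m_assoc m_lcomm)

lemma product_closed: "(\<lambda>q. fst q \<otimes>\<^bsub>A\<^esub> snd q) \<in> S \<rightarrow> carrier A"
  by auto

lemma mu_closed: "f \<in> carrier P \<Longrightarrow> mu f \<in> carrier A"
  and mu_zero: "mu \<zero>\<^bsub>P\<^esub> = \<zero>\<^bsub>A\<^esub>"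
  and mu_add: "f \<in> carrier P \<Longrightarrow> g \<in> carrier P \<Longrightarrow> mu (f \<oplus>\<^bsub>P\<^esub> g) = mu f \<oplus>\<^bsub>A\<^esub> mu g"
  and mu_mult: "f \<in> carrier P \<Longrightarrow> g \<in> carrier P \<Longrightarrow> mu (f \<otimes>\<^bsub>P\<^esub> g) = mu f \<otimes>\<^bsub>A\<^esub> mu g"
  and mu_coset: "f \<in> carrier P \<Longrightarrow> g \<in> carrier P \<Longrightarrow> J +>\<^bsub>P\<^esub> f = J +>\<^bsub>P\<^esub> g \<Longrightarrow> mu f = mu g"
  and mu_finsum: "finite I \<Longrightarrow> h \<in> I \<rightarrow> carrier P \<Longrightarrow> mu (finsum P h I) = (\<Oplus>\<^bsub>A\<^esub>i\<in>I. mu (h i))"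
  unfolding mu_def
  by (rule lin_ext_closed[OF module_axioms product_closed] lin_ext_zero[OF module_axioms]
      lin_ext_add[OF module_axioms product_closed] lin_ext_mult[OF algebra_axioms product_bilinear]
      lin_ext_coset[OF algebra_axioms product_bilinear] lin_ext_finsum[OF module_axioms product_closed]; assumption)+

lemma mu_single: "k \<in> carrier K \<Longrightarrow> a \<in> carrier A \<Longrightarrow> b \<in> carrier A \<Longrightarrow> mu (single k (a, b)) = k \<odot>\<^bsub>A\<^esub> (a \<otimes>\<^bsub>A\<^esub> b)"
  unfolding mu_def using lin_ext_single[OF module_axioms product_closed, of k "(a, b)"] by simp

text \<open>The scalar operation extracts the only value taken on a coset. So all representatives
  must give the same value, which is \<open>mu_coset\<close>, and the coset must be
  nonempty.\<close>

lemma act_coset: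
  assumes "f \<in> carrier P" "t \<in> carrier A"
  shows "act (J +>\<^bsub>P\<^esub> f) t = mu f \<otimes>\<^bsub>A\<^esub> t"
proof -
  have eq: "(\<Oplus>\<^bsub>A\<^esub>q\<in>{q. g q \<noteq> \<zero>\<^bsub>K\<^esub>}. g q \<odot>\<^bsub>A\<^esub> (fst q \<otimes>\<^bsub>A\<^esub> snd q \<otimes>\<^bsub>A\<^esub> t)) = mu f \<otimes>\<^bsub>A\<^esub> t"
    if g: "g \<in> J +>\<^bsub>P\<^esub> f" for g
  proof -
    interpret J: ideal J P by (rule J_ideal)
    have gP: "g \<in> carrier P"
      using g assms(1) J.a_subset P.a_r_coset_subset_G by blast
    have "J +>\<^bsub>P\<^esub> g = J +>\<^bsub>P\<^esub> f"
      using P.a_repr_independence[OF g assms(1)] J.additive_subgroup_axioms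
      by (simp add: additive_subgroup_def)
    then have mu: "mu g = mu f"
      using mu_coset gP assms(1) by blast
    have fin: "finite (supp g)" "supp g \<subseteq> S"
      using gP by (simp_all add: P_carrier_iff)
    have c: "q \<in> supp g \<Longrightarrow> g q \<odot>\<^bsub>A\<^esub> (fst q \<otimes>\<^bsub>A\<^esub> snd q) \<in> carrier A" for q
      using P_coeff[OF gP, of q] fin(2) by (intro smult_closed) auto
    have "mu f \<otimes>\<^bsub>A\<^esub> t = (\<Oplus>\<^bsub>A\<^esub>q\<in>supp g. g q \<odot>\<^bsub>A\<^esub> (fst q \<otimes>\<^bsub>A\<^esub> snd q)) \<otimes>\<^bsub>A\<^esub> t"
      using arg_cong[OF mu, of "\<lambda>x. x \<otimes>\<^bsub>A\<^esub> t"] by (simp add: mu_def lin_ext_def)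
    also have "\<dots> = (\<Oplus>\<^bsub>A\<^esub>q\<in>supp g. g q \<odot>\<^bsub>A\<^esub> (fst q \<otimes>\<^bsub>A\<^esub> snd q) \<otimes>\<^bsub>A\<^esub> t)"
      using c fin(1) assms(2) by (intro finsum_ldistr) auto
    also have "\<dots> = (\<Oplus>\<^bsub>A\<^esub>q\<in>supp g. g q \<odot>\<^bsub>A\<^esub> (fst q \<otimes>\<^bsub>A\<^esub> snd q \<otimes>\<^bsub>A\<^esub> t))"
    proof (intro finsum_cong'[OF refl] Pi_I)
      fix q assume "q \<in> supp g"
      with fin(2) have "fst q \<in> carrier A" "snd q \<in> carrier A" by auto
      with P_coeff[OF gP, of q] assms(2)
      show "g q \<odot>\<^bsub>A\<^esub> (fst q \<otimes>\<^bsub>A\<^esub> snd q) \<otimes>\<^bsub>A\<^esub> t = g q \<odot>\<^bsub>A\<^esub> (fst q \<otimes>\<^bsub>A\<^esub> snd q \<otimes>\<^bsub>A\<^esub> t)"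
        "g q \<odot>\<^bsub>A\<^esub> (fst q \<otimes>\<^bsub>A\<^esub> snd q \<otimes>\<^bsub>A\<^esub> t) \<in> carrier A"
        by (simp_all add: smult_assoc2)
    qed
    finally show ?thesis
      by (simp add: supp_def)
  qed
  have "J +>\<^bsub>P\<^esub> f \<noteq> {}"
  proof -
    interpret J: ideal J P by (rule J_ideal)
    show ?thesis using J.a_rcos_self[OF assms(1)] by blast
  qed
  then show ?thesis
    unfolding mult_module_def by (simp add: eq the_elem_image_unique)
qed


text \<open>By \<open>dual\<close>, multiplication by \<open>t\<close> acts on the
  \<open>a i\<close> through a matrix over \<open>K\<close> and on the \<open>b i\<close> through
  its transpose. As scalars cross the tensor sign, the sum \<open>E\<close> of the
  \<open>a i \<otimes> b i\<close> satisfies (t \<otimes> 1) E = (1 \<otimes> t) E, and then t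
  \<mapsto> (t \<otimes> 1) E is a linear splitting of the multiplication map.\<close>

lemma separable_algebraI:
  assumes I: "finite I" and a: "a \<in> I \<rightarrow> carrier A" and b: "b \<in> I \<rightarrow> carrier A"
    and one: "(\<Oplus>\<^bsub>A\<^esub>i\<in>I. a i \<otimes>\<^bsub>A\<^esub> b i) = \<one>\<^bsub>A\<^esub>"
    and dual: "\<And>t. t \<in> carrier A \<Longrightarrow> \<exists>k. (\<forall>i\<in>I. \<forall>j\<in>I. k i j \<in> carrier K) \<and>
      (\<forall>i\<in>I. t \<otimes>\<^bsub>A\<^esub> a i = (\<Oplus>\<^bsub>A\<^esub>j\<in>I. k i j \<odot>\<^bsub>A\<^esub> a j)) \<and>
      (\<forall>j\<in>I. t \<otimes>\<^bsub>A\<^esub> b j = (\<Oplus>\<^bsub>A\<^esub>i\<in>I. k i j \<odot>\<^bsub>A\<^esub> b i))"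
  shows "separable_algebra K A"
proof -
  have ab: "i \<in> I \<Longrightarrow> a i \<in> carrier A" "i \<in> I \<Longrightarrow> b i \<in> carrier A" for i
    using a b by auto
  define e where "e = (\<Oplus>\<^bsub>P\<^esub>i\<in>I. single \<one>\<^bsub>K\<^esub> (a i, b i))"
  define E where "E = J +>\<^bsub>P\<^esub> e"
  have sP: "(\<lambda>i. single \<one>\<^bsub>K\<^esub> (a i, b i)) \<in> I \<rightarrow> carrier P"
    using ab by (auto intro!: single_closed)
  have eP: "e \<in> carrier P"
    unfolding e_def using sP by (rule P.finsum_closed)
  have EQ: "E \<in> carrier Q"
    unfolding E_def using eP by (rule coset_closed)
  have E_sum: "E = (\<Oplus>\<^bsub>Q\<^esub>i\<in>I. tens (a i) (b i))"
    unfolding E_def e_def coset_finsum[OF I sP] tens_def ..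
  have mu_e: "mu e = \<one>\<^bsub>A\<^esub>"
    unfolding e_def mu_finsum[OF I sP] one[symmetric]
    by (intro finsum_cong'[OF refl]) (auto simp: mu_single ab)
  have swap: "tens t \<one>\<^bsub>A\<^esub> \<otimes>\<^bsub>Q\<^esub> E = tens \<one>\<^bsub>A\<^esub> t \<otimes>\<^bsub>Q\<^esub> E" if t: "t \<in> carrier A" for t
  proof -
    obtain k where k: "\<And>i j. i \<in> I \<Longrightarrow> j \<in> I \<Longrightarrow> k i j \<in> carrier K"
      and ta: "\<And>i. i \<in> I \<Longrightarrow> t \<otimes>\<^bsub>A\<^esub> a i = (\<Oplus>\<^bsub>A\<^esub>j\<in>I. k i j \<odot>\<^bsub>A\<^esub> a j)"
      and tb: "\<And>j. j \<in> I \<Longrightarrow> t \<otimes>\<^bsub>A\<^esub> b j = (\<Oplus>\<^bsub>A\<^esub>i\<in>I. k i j \<odot>\<^bsub>A\<^esub> b i)"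
      using dual[OF t] by blast
    have left: "x \<in> carrier Q \<Longrightarrow> x \<otimes>\<^bsub>Q\<^esub> E = (\<Oplus>\<^bsub>Q\<^esub>i\<in>I. x \<otimes>\<^bsub>Q\<^esub> tens (a i) (b i))" for x
      unfolding E_sum using I ab by (intro Q.finsum_rdistr) auto
    have "tens t \<one>\<^bsub>A\<^esub> \<otimes>\<^bsub>Q\<^esub> E = (\<Oplus>\<^bsub>Q\<^esub>i\<in>I. tens (t \<otimes>\<^bsub>A\<^esub> a i) (b i))"
      unfolding left[OF tens_closed[OF t one_closed]] using t ab
      by (intro Q.finsum_cong'[OF refl]) (auto simp: tens_mult)
    also have "\<dots> = (\<Oplus>\<^bsub>Q\<^esub>i\<in>I. \<Oplus>\<^bsub>Q\<^esub>j\<in>I. tens (a j) (k i j \<odot>\<^bsub>A\<^esub> b i))"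
    proof (intro Q.finsum_cong'[OF refl] Pi_I Q.finsum_closed)
      fix i assume i: "i \<in> I"
      have "tens (t \<otimes>\<^bsub>A\<^esub> a i) (b i) = (\<Oplus>\<^bsub>Q\<^esub>j\<in>I. tens (k i j \<odot>\<^bsub>A\<^esub> a j) (b i))"
        unfolding ta[OF i] using I i k ab by (intro tens_finsum_left) auto
      also have "\<dots> = (\<Oplus>\<^bsub>Q\<^esub>j\<in>I. tens (a j) (k i j \<odot>\<^bsub>A\<^esub> b i))"
        using i k ab by (intro Q.finsum_cong'[OF refl]) (auto simp: tens_smult_swap)
      finally show "tens (t \<otimes>\<^bsub>A\<^esub> a i) (b i) = (\<Oplus>\<^bsub>Q\<^esub>j\<in>I. tens (a j) (k i j \<odot>\<^bsub>A\<^esub> b i))" .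
    qed (use k ab in auto)
    also have "\<dots> = (\<Oplus>\<^bsub>Q\<^esub>j\<in>I. \<Oplus>\<^bsub>Q\<^esub>i\<in>I. tens (a j) (k i j \<odot>\<^bsub>A\<^esub> b i))"
      using I k ab by (intro Q.finsum_swap) auto
    also have "\<dots> = (\<Oplus>\<^bsub>Q\<^esub>j\<in>I. tens (a j) (t \<otimes>\<^bsub>A\<^esub> b j))"
      using I t k ab by (intro Q.finsum_cong'[OF refl]) (auto simp: tb tens_finsum_right)
    also have "\<dots> = tens \<one>\<^bsub>A\<^esub> t \<otimes>\<^bsub>Q\<^esub> E"
      unfolding left[OF tens_closed[OF one_closed t]] using t ab
      by (intro Q.finsum_cong'[OF refl]) (auto simp: tens_mult)
    finally show ?thesis .
  qed
  \<comment> \<open>An arbitrary element of the tensor product acts on \<open>E\<close> through its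
    product in \<open>A\<close>: for x \<otimes> y, the factor y is moved to the left by
    \<open>swap\<close>. This gives linearity of the splitting.\<close>
  have absorb: "(J +>\<^bsub>P\<^esub> f) \<otimes>\<^bsub>Q\<^esub> E = tens (mu f) \<one>\<^bsub>A\<^esub> \<otimes>\<^bsub>Q\<^esub> E" if "f \<in> carrier P" for f
    using that
  proof (induction rule: P_induct)
    case zero
    show ?case by (simp add: coset_zero mu_zero tens_zero_left)
  next
    case (base k u)
    obtain x y where u: "u = (x, y)" by (cases u)
    with base have xy: "x \<in> carrier A" "y \<in> carrier A" by auto
    have kx: "k \<odot>\<^bsub>A\<^esub> x \<in> carrier A" using base xy by simp
    have "(J +>\<^bsub>P\<^esub> single k u) \<otimes>\<^bsub>Q\<^esub> E = tens (k \<odot>\<^bsub>A\<^esub> x) \<one>\<^bsub>A\<^esub> \<otimes>\<^bsub>Q\<^esub> (tens \<one>\<^bsub>A\<^esub> y \<otimes>\<^bsub>Q\<^esub> E)"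
      using xy kx base(1) EQ by (simp add: u coset_single(1) tens_mult Q.m_assoc[symmetric])
    also have "\<dots> = tens (mu (single k u)) \<one>\<^bsub>A\<^esub> \<otimes>\<^bsub>Q\<^esub> E"
      using xy kx base(1) EQ
      by (simp add: u swap[symmetric] mu_single tens_mult Q.m_assoc[symmetric] smult_assoc2)
    finally show ?case .
  next
    case (add f g)
    then show ?case
      using EQ by (simp add: coset_add mu_add tens_add_left Q.l_distr coset_closed mu_closed)
  qed
  \<comment> \<open>A free module of rank one is enough. Its index must have the type of the
    elements of \<open>A\<close>, and the unit is taken for it. The map \<open>p\<close> is
    multiplication, read at that index.\<close>
  define s where "s = (\<lambda>t j. if j = \<one>\<^bsub>A\<^esub> then tens t \<one>\<^bsub>A\<^esub> \<otimes>\<^bsub>Q\<^esub> E else \<zero>\<^bsub>Q\<^esub>)"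
  define p where "p = (\<lambda>h. act (h \<one>\<^bsub>A\<^esub>) \<one>\<^bsub>A\<^esub>)"
  let ?F = "free_module Q {\<one>\<^bsub>A\<^esub>}"
  let ?M = "mult_module K A"
  have M: "carrier ?M = carrier A" "x \<oplus>\<^bsub>?M\<^esub> y = x \<oplus>\<^bsub>A\<^esub> y" for x y
    by (simp_all add: mult_module_def)
  have F: "f \<in> carrier ?F \<Longrightarrow> f i \<in> carrier Q" for f i
    by (simp add: free_module_def)
  have "s \<in> module_homs Q ?M ?F"
    unfolding module_homs_def
  proof (intro CollectI conjI ballI Pi_I)
    fix t assume t: "t \<in> carrier ?M"
    then have "tens t \<one>\<^bsub>A\<^esub> \<otimes>\<^bsub>Q\<^esub> E \<in> carrier Q"
      using EQ by (simp add: M)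
    then show "s t \<in> carrier ?F"
      by (auto simp: s_def free_module_def intro: finite_subset[of _ "{\<one>\<^bsub>A\<^esub>}"])
  next
    fix x y assume "x \<in> carrier ?M" "y \<in> carrier ?M"
    then show "s (x \<oplus>\<^bsub>?M\<^esub> y) = s x \<oplus>\<^bsub>?F\<^esub> s y"
      using EQ by (intro ext) (simp add: M s_def free_module_def tens_add_left Q.l_distr)
  next
    fix x t assume x: "x \<in> carrier Q" and t: "t \<in> carrier ?M"
    obtain f where f: "f \<in> carrier P" "x = J +>\<^bsub>P\<^esub> f"
      using coset_cases[OF x] by blast
    have "tens (act x t) \<one>\<^bsub>A\<^esub> \<otimes>\<^bsub>Q\<^esub> E = tens t \<one>\<^bsub>A\<^esub> \<otimes>\<^bsub>Q\<^esub> (tens (mu f) \<one>\<^bsub>A\<^esub> \<otimes>\<^bsub>Q\<^esub> E)"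
      using t f EQ mu_closed[OF f(1)] by (simp add: M act_coset tens_mult Q.m_assoc[symmetric] m_comm)
    also have "\<dots> = tens (mu f) \<one>\<^bsub>A\<^esub> \<otimes>\<^bsub>Q\<^esub> (tens t \<one>\<^bsub>A\<^esub> \<otimes>\<^bsub>Q\<^esub> E)"
      using t EQ mu_closed[OF f(1)] by (simp add: M tens_mult Q.m_assoc[symmetric] m_comm)
    also have "\<dots> = x \<otimes>\<^bsub>Q\<^esub> (tens t \<one>\<^bsub>A\<^esub> \<otimes>\<^bsub>Q\<^esub> E)"
    proof -
      have st: "single \<one>\<^bsub>K\<^esub> (t, \<one>\<^bsub>A\<^esub>) \<in> carrier P"
        using t by (simp add: single_closed M)
      have "x \<otimes>\<^bsub>Q\<^esub> (tens t \<one>\<^bsub>A\<^esub> \<otimes>\<^bsub>Q\<^esub> E) = (J +>\<^bsub>P\<^esub> (f \<otimes>\<^bsub>P\<^esub> single \<one>\<^bsub>K\<^esub> (t, \<one>\<^bsub>A\<^esub>))) \<otimes>\<^bsub>Q\<^esub> E"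
        using t x EQ st f by (simp add: coset_mult tens_def[symmetric] Q.m_assoc M)
      also have "\<dots> = tens (mu f \<otimes>\<^bsub>A\<^esub> t) \<one>\<^bsub>A\<^esub> \<otimes>\<^bsub>Q\<^esub> E"
        using absorb[OF P.m_closed[OF f(1) st]] t f(1) st by (simp add: mu_mult mu_single M)
      finally show ?thesis
        using t EQ mu_closed[OF f(1)] by (simp add: M tens_mult Q.m_assoc[symmetric])
    qed
    finally show "s (x \<odot>\<^bsub>?M\<^esub> t) = x \<odot>\<^bsub>?F\<^esub> s t"
      using x by (intro ext) (simp add: s_def free_module_def mult_module_def)
  qed
  moreover have "p \<in> module_homs Q ?F ?M"
    unfolding module_homs_def
  proof (intro CollectI conjI ballI Pi_I)
    fix h assume "h \<in> carrier ?F"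
    then obtain f where "f \<in> carrier P" "h \<one>\<^bsub>A\<^esub> = J +>\<^bsub>P\<^esub> f"
      using coset_cases[OF F] by metis
    then show "p h \<in> carrier ?M"
      by (simp add: p_def act_coset mu_closed M)
  next
    fix h h' assume "h \<in> carrier ?F" "h' \<in> carrier ?F"
    then obtain f f' where f: "f \<in> carrier P" "h \<one>\<^bsub>A\<^esub> = J +>\<^bsub>P\<^esub> f" "f' \<in> carrier P" "h' \<one>\<^bsub>A\<^esub> = J +>\<^bsub>P\<^esub> f'"
      using coset_cases[OF F] by metis
    have "act (h \<one>\<^bsub>A\<^esub> \<oplus>\<^bsub>Q\<^esub> h' \<one>\<^bsub>A\<^esub>) \<one>\<^bsub>A\<^esub> = act (h \<one>\<^bsub>A\<^esub>) \<one>\<^bsub>A\<^esub> \<oplus>\<^bsub>A\<^esub> act (h' \<one>\<^bsub>A\<^esub>) \<one>\<^bsub>A\<^esub>"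
      using f(1,3) by (simp add: f(2,4) coset_add[symmetric] act_coset mu_add mu_closed)
    then show "p (h \<oplus>\<^bsub>?F\<^esub> h') = p h \<oplus>\<^bsub>?M\<^esub> p h'"
      by (simp add: p_def M free_module_def)
  next
    fix x h assume "x \<in> carrier Q" "h \<in> carrier ?F"
    then obtain f f' where f: "f \<in> carrier P" "x = J +>\<^bsub>P\<^esub> f" "f' \<in> carrier P" "h \<one>\<^bsub>A\<^esub> = J +>\<^bsub>P\<^esub> f'"
      using coset_cases F by metis
    have "act (x \<otimes>\<^bsub>Q\<^esub> h \<one>\<^bsub>A\<^esub>) \<one>\<^bsub>A\<^esub> = act x (act (h \<one>\<^bsub>A\<^esub>) \<one>\<^bsub>A\<^esub>)"
      using f(1,3) by (simp add: f(2,4) coset_mult[symmetric] act_coset mu_mult mu_closed)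
    then show "p (x \<odot>\<^bsub>?F\<^esub> h) = x \<odot>\<^bsub>?M\<^esub> p h"
      by (simp add: p_def free_module_def)
  qed
  moreover have "p (s t) = t" if "t \<in> carrier ?M" for t
  proof -
    have t: "t \<in> carrier A" and st: "single \<one>\<^bsub>K\<^esub> (t, \<one>\<^bsub>A\<^esub>) \<in> carrier P"
      using that by (simp_all add: M single_closed)
    have "tens t \<one>\<^bsub>A\<^esub> \<otimes>\<^bsub>Q\<^esub> E = J +>\<^bsub>P\<^esub> (single \<one>\<^bsub>K\<^esub> (t, \<one>\<^bsub>A\<^esub>) \<otimes>\<^bsub>P\<^esub> e)"
      unfolding tens_def E_def using coset_mult[OF st eP] by simp
    then show ?thesis
      using t st eP by (simp add: p_def s_def act_coset mu_mult mu_single mu_e)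
  qed
  ultimately show ?thesis
    unfolding separable_algebra_def projective_module_def by blast
qed

text \<open>Let \<open>f\<close> be the image of 1 under a splitting \<open>s\<close> of
  \<open>p\<close>. Its coordinates satisfy (t \<otimes> 1) \<open>f i\<close> = (1 \<otimes> t)
  \<open>f i\<close>, because both tensors send 1 to \<open>t\<close> and \<open>s\<close> is
  linear. With \<open>m i\<close> the value of \<open>p\<close> at the basis vector of
  \<open>i\<close>, the finite sum of \<open>f i\<close> times (\<open>m i\<close> \<otimes> 1)
  keeps this property, and its product is \<open>p (s 1) = 1\<close>.\<close>

lemma separable_algebraE:
  assumes "separable_algebra K A"
  obtains e where "e \<in> carrier P" "mu e = \<one>\<^bsub>A\<^esub>"
    "\<And>t. t \<in> carrier A \<Longrightarrow>
      J +>\<^bsub>P\<^esub> (single \<one>\<^bsub>K\<^esub> (t, \<one>\<^bsub>A\<^esub>) \<otimes>\<^bsub>P\<^esub> e) = J +>\<^bsub>P\<^esub> (single \<one>\<^bsub>K\<^esub> (\<one>\<^bsub>A\<^esub>, t) \<otimes>\<^bsub>P\<^esub> e)"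
proof -
  let ?M = "mult_module K A"
  have M: "carrier ?M = carrier A" "x \<oplus>\<^bsub>?M\<^esub> y = x \<oplus>\<^bsub>A\<^esub> y" "\<zero>\<^bsub>?M\<^esub> = \<zero>\<^bsub>A\<^esub>" for x y
    by (simp_all add: mult_module_def)
  have M_ab: "abelian_group ?M"
    by (rule abelian_groupI) (auto simp: M a_ac intro!: bexI[where P = "\<lambda>y. y \<oplus>\<^bsub>A\<^esub> _ = \<zero>\<^bsub>A\<^esub>", OF l_neg])
  \<comment> \<open>\<open>mult_module K A\<close> is another record with the addition of
    \<open>A\<close>, so sums have to be carried over.\<close>
  have finsum_M: "finsum ?M h U = finsum A h U" if "finite U" "h \<in> U \<rightarrow> carrier A" for h :: "'a \<Rightarrow> 'a" and U
    using finsum_additive[of A ?M "\<lambda>x. x" U h] that M_ab abelian_monoid_axioms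
    by (auto simp: M abelian_group_def)
  obtain I :: "'a set" and s p where s: "s \<in> module_homs Q ?M (free_module Q I)"
    and p: "p \<in> module_homs Q (free_module Q I) ?M"
    and ps: "\<And>x. x \<in> carrier A \<Longrightarrow> p (s x) = x"
    using assms unfolding separable_algebra_def projective_module_def by (auto simp: M)
  define f where "f = s \<one>\<^bsub>A\<^esub>"
  have f: "f \<in> carrier (free_module Q I)"
    using s unfolding f_def module_homs_def by (auto simp: M)
  define U where "U = {i. f i \<noteq> \<zero>\<^bsub>Q\<^esub>}"
  have U: "finite U" "U \<subseteq> I" and fQ: "f i \<in> carrier Q" for i
    using f by (auto simp: free_module_def U_def)
  define m where "m = (\<lambda>i. p (free_basis Q i))"
  have mA: "m i \<in> carrier A" if "i \<in> U" for i
    using module_hom_free_expansion(2)[OF ring_Q M_ab p f, of i] U that p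
    by (auto simp: m_def module_homs_def M)
  have "\<forall>i. \<exists>g. g \<in> carrier P \<and> f i = J +>\<^bsub>P\<^esub> g"
    using coset_cases[OF fQ] by metis
  then obtain g where g: "\<And>i. g i \<in> carrier P" "\<And>i. f i = J +>\<^bsub>P\<^esub> g i"
    by metis
  have mP: "single \<one>\<^bsub>K\<^esub> (m i, \<one>\<^bsub>A\<^esub>) \<in> carrier P" if "i \<in> U" for i
    using mA[OF that] by (simp add: single_closed)
  define e where "e = (\<Oplus>\<^bsub>P\<^esub>i\<in>U. g i \<otimes>\<^bsub>P\<^esub> single \<one>\<^bsub>K\<^esub> (m i, \<one>\<^bsub>A\<^esub>))"
  have eP: "e \<in> carrier P"
    unfolding e_def using g(1) mP by (auto intro: P.finsum_closed)
  have m: "p (free_basis Q i) = m i" for i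
    by (simp add: m_def)
  have "mu e = (\<Oplus>\<^bsub>A\<^esub>i\<in>U. mu (g i) \<otimes>\<^bsub>A\<^esub> m i)"
    unfolding e_def using g(1) mP U(1) mA
    by (subst mu_finsum) (auto simp: mu_mult mu_single mu_closed intro!: finsum_cong'[OF refl])
  also have "\<dots> = (\<Oplus>\<^bsub>A\<^esub>i\<in>U. act (f i) (m i))"
    using g mA by (intro finsum_cong'[OF refl]) (auto simp: act_coset mu_closed)
  also have "\<dots> = p f"
    unfolding module_hom_free_expansion(1)[OF ring_Q M_ab p f] m U_def[symmetric]
    using U(1) g mA by (intro finsum_M[symmetric]) (auto simp: act_coset mu_closed)
  also have "\<dots> = \<one>\<^bsub>A\<^esub>"
    by (simp add: f_def ps)
  finally have "mu e = \<one>\<^bsub>A\<^esub>" .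
  moreover have "J +>\<^bsub>P\<^esub> (single \<one>\<^bsub>K\<^esub> (t, \<one>\<^bsub>A\<^esub>) \<otimes>\<^bsub>P\<^esub> e) = J +>\<^bsub>P\<^esub> (single \<one>\<^bsub>K\<^esub> (\<one>\<^bsub>A\<^esub>, t) \<otimes>\<^bsub>P\<^esub> e)"
    if t: "t \<in> carrier A" for t
  proof -
    have s_eq: "x \<otimes>\<^bsub>Q\<^esub> f i = s (act x \<one>\<^bsub>A\<^esub>) i" if "x \<in> carrier Q" for x i
    proof -
      have "s (act x \<one>\<^bsub>A\<^esub>) = x \<odot>\<^bsub>free_module Q I\<^esub> f"
        using s that unfolding module_homs_def f_def by (auto simp: M)
      then show ?thesis by (simp add: free_module_def)
    qed
    have tP: "single \<one>\<^bsub>K\<^esub> (t, \<one>\<^bsub>A\<^esub>) \<in> carrier P" "single \<one>\<^bsub>K\<^esub> (\<one>\<^bsub>A\<^esub>, t) \<in> carrier P"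
      using t by (simp_all add: single_closed)
    have "act (tens t \<one>\<^bsub>A\<^esub>) \<one>\<^bsub>A\<^esub> = act (tens \<one>\<^bsub>A\<^esub> t) \<one>\<^bsub>A\<^esub>"
      unfolding tens_def using t tP by (simp add: act_coset mu_single)
    then have ft: "tens t \<one>\<^bsub>A\<^esub> \<otimes>\<^bsub>Q\<^esub> f i = tens \<one>\<^bsub>A\<^esub> t \<otimes>\<^bsub>Q\<^esub> f i" for i
      using t by (simp add: s_eq)
    have expand: "J +>\<^bsub>P\<^esub> (h \<otimes>\<^bsub>P\<^esub> e) = (\<Oplus>\<^bsub>Q\<^esub>i\<in>U. (J +>\<^bsub>P\<^esub> h) \<otimes>\<^bsub>Q\<^esub> f i \<otimes>\<^bsub>Q\<^esub> tens (m i) \<one>\<^bsub>A\<^esub>)"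
      if h: "h \<in> carrier P" for h
    proof -
      have "J +>\<^bsub>P\<^esub> e = (\<Oplus>\<^bsub>Q\<^esub>i\<in>U. f i \<otimes>\<^bsub>Q\<^esub> tens (m i) \<one>\<^bsub>A\<^esub>)"
      proof -
        have "J +>\<^bsub>P\<^esub> e = (\<Oplus>\<^bsub>Q\<^esub>i\<in>U. J +>\<^bsub>P\<^esub> (g i \<otimes>\<^bsub>P\<^esub> single \<one>\<^bsub>K\<^esub> (m i, \<one>\<^bsub>A\<^esub>)))"
          unfolding e_def using U(1) g(1) mP by (intro coset_finsum) auto
        also have "\<dots> = (\<Oplus>\<^bsub>Q\<^esub>i\<in>U. f i \<otimes>\<^bsub>Q\<^esub> tens (m i) \<one>\<^bsub>A\<^esub>)"
        proof (intro Q.finsum_cong'[OF refl] Pi_I)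
          fix i assume i: "i \<in> U"
          show "f i \<otimes>\<^bsub>Q\<^esub> tens (m i) \<one>\<^bsub>A\<^esub> \<in> carrier Q"
            using fQ mA[OF i] by simp
          show "J +>\<^bsub>P\<^esub> (g i \<otimes>\<^bsub>P\<^esub> single \<one>\<^bsub>K\<^esub> (m i, \<one>\<^bsub>A\<^esub>)) = f i \<otimes>\<^bsub>Q\<^esub> tens (m i) \<one>\<^bsub>A\<^esub>"
            unfolding coset_mult[OF g(1) mP[OF i]] g(2) tens_def ..
        qed
        finally show ?thesis .
      qed
      then show ?thesis
        unfolding coset_mult[OF h eP] using U(1) mA fQ coset_closed[OF h]
        by (auto simp: Q.finsum_rdistr Q.m_assoc Pi_def intro!: Q.finsum_cong'[OF refl])
    qed
    show ?thesis
      unfolding expand[OF tP(1)] expand[OF tP(2)] tens_def[symmetric] ft ..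
  qed
  ultimately show ?thesis
    using that eP by blast
qed

end

section \<open>Groupoids and unital actions\<close>

context groupoid
begin

lemma identity_closed: "e \<in> identities G \<Longrightarrow> e \<in> carrier G"
  unfolding identities_def gdom_def using gmult_closed ginv_closed gdom_ginv by auto

lemma gdom_identities: "g \<in> carrier G \<Longrightarrow> gdom G g \<in> identities G"
  by (simp add: identities_def)

lemma gcod_identities: "g \<in> carrier G \<Longrightarrow> gcod G g \<in> identities G"
  using gdom_identities[OF ginv_closed] by (simp add: gdom_ginv)

lemma gdom_identity: "e \<in> identities G \<Longrightarrow> gdom G e = e"
  unfolding identities_def
  by (auto simp: gdom_def[of G "_::'g"])
     (metis gdom_def gdom_ginv gdom_gmult ginv_closed)

lemma gcod_identity: "e \<in> identities G \<Longrightarrow> gcod G e = e"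
  unfolding identities_def
  by auto (metis gdom_def gdom_ginv gcod_ginv gcod_gmult ginv_closed)

lemma ginv_identity:
  assumes "e \<in> identities G"
  shows "ginv G e = e"
proof -
  have e: "e \<in> carrier G" by (rule identity_closed[OF assms])
  have "gmult G (ginv G e) (gdom G (ginv G e)) = ginv G e"
    by (rule gmult_gdom[OF ginv_closed[OF e]])
  then have "gmult G (ginv G e) e = ginv G e"
    by (simp add: gdom_ginv[OF e] gcod_identity[OF assms])
  then show ?thesis
    using gdom_identity[OF assms] by (simp add: gdom_def)
qed

lemma gmult_left_cancel:
  assumes "g \<in> carrier G" "h \<in> carrier G" "gdom G g = gcod G h"
  shows "gmult G (ginv G g) (gmult G g h) = h"
proof -
  have "gmult G (ginv G g) (gmult G g h) = gmult G (gmult G (ginv G g) g) h"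
    by (rule gmult_assoc[symmetric]) (simp_all add: assms ginv_closed gdom_ginv)
  also have "\<dots> = gmult G (gcod G h) h"
    using assms(3) by (simp add: gdom_def)
  finally show ?thesis
    using gmult_gcod[OF assms(2)] by simp
qed

lemma gmult_right_cancel:
  assumes "g \<in> carrier G" "h \<in> carrier G" "gdom G g = gcod G h"
  shows "gmult G (gmult G g h) (ginv G h) = g"
proof -
  have "gmult G (gmult G g h) (ginv G h) = gmult G g (gmult G h (ginv G h))"
    by (rule gmult_assoc) (simp_all add: assms ginv_closed gcod_ginv)
  also have "\<dots> = gmult G g (gdom G g)"
    using assms(3) by (simp add: gcod_def)
  finally show ?thesis
    using gmult_gdom[OF assms(1)] by simp
qed

text \<open>Multiply the inverse of the inverse by \<open>gdom G g\<close>, the product of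
  \<open>ginv G g\<close> and \<open>g\<close>. Cancellation gives \<open>g\<close>; on the other
  hand \<open>gdom G g\<close> is its right identity.\<close>

lemma ginv_ginv:
  assumes "g \<in> carrier G"
  shows "ginv G (ginv G g) = g"
proof -
  have "gmult G (ginv G (ginv G g)) (gmult G (ginv G g) g) = g"
    by (rule gmult_left_cancel) (simp_all add: assms ginv_closed gdom_ginv)
  moreover have "gmult G (ginv G (ginv G g)) (gdom G (ginv G (ginv G g))) = ginv G (ginv G g)"
    by (rule gmult_gdom) (simp add: assms ginv_closed)
  ultimately show ?thesis
    by (simp add: gdom_ginv gcod_ginv assms ginv_closed gdom_def[of G g])
qed

text \<open>Decides which composite arrows survive in the Galois relation.\<close>

lemma gmult_identity_iff:
  assumes "g \<in> carrier G" "h \<in> carrier G" "gdom G g = gcod G h"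
  shows "gmult G g h \<in> identities G \<longleftrightarrow> g = ginv G h"
proof
  assume *: "gmult G g h \<in> identities G"
  have "gmult G g h = gdom G h"
    using gdom_identity[OF *] gdom_gmult[OF assms] by simp
  then have "g = gmult G (gdom G h) (ginv G h)"
    using gmult_right_cancel[OF assms] by simp
  also have "\<dots> = ginv G h"
    using gmult_gcod[OF ginv_closed[OF assms(2)]] by (simp add: gcod_ginv assms)
  finally show "g = ginv G h" .
next
  assume "g = ginv G h"
  then show "gmult G g h \<in> identities G"
    using gdom_identities[OF assms(2)] by (simp add: gdom_def)
qed

lemma ginv_identity_iff: "g \<in> carrier G \<Longrightarrow> ginv G g \<in> identities G \<longleftrightarrow> g \<in> identities G"
  using ginv_identity ginv_ginv by metis

end

section \<open>Translates, orthogonal ideals and the decomposition of one\<close>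

locale unital_groupoid_action = groupoid_action G K R E \<beta>
  for G :: "('g, 'z) groupoid_scheme"
    and K :: "('k, 'x) ring_scheme"
    and R :: "('k, 'r, 'y) module_scheme" (structure)
    and E :: "'g \<Rightarrow> 'r set" and \<beta> :: "'g \<Rightarrow> 'r \<Rightarrow> 'r" +
  assumes finite_G: "finite (carrier G)"
    and unital: "e \<in> identities G \<Longrightarrow> \<exists>u. is_ideal_one R (E e) u"
    and direct_sum: "internal_direct_sum R (identities G) E"
begin

abbreviation "u g \<equiv> ideal_one R (E g)"

abbreviation "trl \<equiv> translate G R E \<beta>"

lemma finite_identities: "finite (identities G)"
  unfolding identities_def using finite_G by simp

lemma E_carrier: "g \<in> carrier G \<Longrightarrow> z \<in> E g \<Longrightarrow> z \<in> carrier R"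
  using E_ideal[of g] ideal.Icarr by metis

lemma E_mult: "g \<in> carrier G \<Longrightarrow> z \<in> E g \<Longrightarrow> w \<in> carrier R \<Longrightarrow> z \<otimes> w \<in> E g"
    "g \<in> carrier G \<Longrightarrow> z \<in> E g \<Longrightarrow> w \<in> carrier R \<Longrightarrow> w \<otimes> z \<in> E g"
  using E_ideal[of g] ideal.I_r_closed ideal.I_l_closed by metis+

lemma E_zero: "g \<in> carrier G \<Longrightarrow> \<zero> \<in> E g"
  using E_ideal[of g] additive_subgroup.zero_closed ideal.axioms(1) by metis

lemma E_ginv: "g \<in> carrier G \<Longrightarrow> E (ginv G g) = E (gdom G g)"
  using E_gcod[OF ginv_closed] by (simp add: gcod_ginv)

lemma ideal_one_eqI:
  assumes "g \<in> carrier G" "is_ideal_one R (E g) v"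
  shows "u g = v"
  unfolding ideal_one_def using assms(2)
  by (rule the_equality) (metis assms(2) is_ideal_one_def)

text \<open>Units are assumed at the identities; \<open>E g = E (gcod G g)\<close> supplies them at
  every arrow.\<close>

lemma u_is_one: "g \<in> carrier G \<Longrightarrow> is_ideal_one R (E g) (u g)"
  using unital[OF gcod_identities] E_gcod ideal_one_eqI by metis

lemma u_E: "g \<in> carrier G \<Longrightarrow> u g \<in> E g"
  and u_mult: "g \<in> carrier G \<Longrightarrow> z \<in> E g \<Longrightarrow> u g \<otimes> z = z"
  and mult_u: "g \<in> carrier G \<Longrightarrow> z \<in> E g \<Longrightarrow> z \<otimes> u g = z"
  using u_is_one unfolding is_ideal_one_def by blast+

lemma u_closed [simp]: "g \<in> carrier G \<Longrightarrow> u g \<in> carrier R"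
  using u_E E_carrier by blast

lemma u_gcod: "g \<in> carrier G \<Longrightarrow> u g = u (gcod G g)"
  using E_gcod by metis

lemma u_ginv: "g \<in> carrier G \<Longrightarrow> u (ginv G g) = u (gdom G g)"
  by (simp add: E_ginv)

lemma u_idem: "g \<in> carrier G \<Longrightarrow> u g \<otimes> u g = u g"
  by (simp add: u_mult u_E)

lemma beta_E: "g \<in> carrier G \<Longrightarrow> z \<in> E (ginv G g) \<Longrightarrow> \<beta> g z \<in> E g"
  using \<beta>_bij bij_betwE by metis

lemma mult_u_ginv: "g \<in> carrier G \<Longrightarrow> z \<in> carrier R \<Longrightarrow> z \<otimes> u (ginv G g) \<in> E (ginv G g)"
  by (rule E_mult(2)) (simp_all add: ginv_closed u_E)

lemma trl_E: "g \<in> carrier G \<Longrightarrow> z \<in> carrier R \<Longrightarrow> trl g z \<in> E g"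
  unfolding translate_def by (intro beta_E mult_u_ginv)

lemma trl_closed [simp]: "g \<in> carrier G \<Longrightarrow> z \<in> carrier R \<Longrightarrow> trl g z \<in> carrier R"
  using trl_E E_carrier by blast

lemma trl_add: "g \<in> carrier G \<Longrightarrow> z \<in> carrier R \<Longrightarrow> w \<in> carrier R \<Longrightarrow> trl g (z \<oplus> w) = trl g z \<oplus> trl g w"
  unfolding translate_def by (simp add: \<beta>_add mult_u_ginv l_distr ginv_closed)

lemma trl_mult:
  assumes "g \<in> carrier G" "z \<in> carrier R" "w \<in> carrier R"
  shows "trl g (z \<otimes> w) = trl g z \<otimes> trl g w"
proof -
  let ?v = "u (ginv G g)"
  have v: "?v \<in> carrier R" "?v \<otimes> ?v = ?v"
    using assms(1) by (simp_all add: ginv_closed u_idem)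
  have "z \<otimes> w \<otimes> ?v = z \<otimes> w \<otimes> (?v \<otimes> ?v)"
    by (simp add: v)
  also have "\<dots> = (z \<otimes> ?v) \<otimes> (w \<otimes> ?v)"
    using assms v(1) by (simp add: m_ac)
  finally show ?thesis
    unfolding translate_def using assms by (simp add: \<beta>_mult mult_u_ginv)
qed

lemma trl_smult:
  "g \<in> carrier G \<Longrightarrow> k \<in> carrier K \<Longrightarrow> z \<in> carrier R \<Longrightarrow> trl g (k \<odot> z) = k \<odot> trl g z"
  unfolding translate_def by (simp add: \<beta>_smult mult_u_ginv smult_assoc2 ginv_closed)

lemma trl_zero [simp]:
  assumes "g \<in> carrier G"
  shows "trl g \<zero> = \<zero>"
  using trl_add[OF assms zero_closed zero_closed] trl_closed[OF assms zero_closed] by simp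

text \<open>A multiplicative bijection onto \<open>E g\<close> carries a unit to a unit;
  surjectivity makes the image neutral on all of \<open>E g\<close>. Thus \<open>trl g\<close> is a
  homomorphism of \<open>R\<close> into itself that need not preserve 1.\<close>

lemma trl_one:
  assumes g: "g \<in> carrier G"
  shows "trl g \<one> = u g"
proof -
  let ?v = "u (ginv G g)"
  have v: "?v \<in> E (ginv G g)" and vc: "?v \<in> carrier R"
    using g by (simp_all add: ginv_closed u_E)
  have "is_ideal_one R (E g) (\<beta> g ?v)"
    unfolding is_ideal_one_def
  proof (intro conjI ballI)
    show "\<beta> g ?v \<in> E g"
      by (rule beta_E[OF g v])
    fix z assume z: "z \<in> E g"
    then obtain w where w: "w \<in> E (ginv G g)" "z = \<beta> g w"
      using \<beta>_bij[OF g] unfolding bij_betw_def by blast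
    show "\<beta> g ?v \<otimes> z = z" "z \<otimes> \<beta> g ?v = z"
      unfolding w(2) \<beta>_mult[OF g v w(1), symmetric] \<beta>_mult[OF g w(1) v, symmetric]
      using u_mult[OF ginv_closed[OF g] w(1)] mult_u[OF ginv_closed[OF g] w(1)] by simp_all
  qed
  then have "u g = \<beta> g ?v"
    by (rule ideal_one_eqI[OF g])
  then show ?thesis
    unfolding translate_def using vc by simp
qed

lemma u_trl: "g \<in> carrier G \<Longrightarrow> z \<in> carrier R \<Longrightarrow> u g \<otimes> trl g z = trl g z"
  by (simp add: u_mult trl_E)

lemma trl_u: "g \<in> carrier G \<Longrightarrow> z \<in> carrier R \<Longrightarrow> trl g z \<otimes> u g = trl g z"
  by (simp add: mult_u trl_E)

lemma trl_identity:
  assumes "e \<in> identities G" "z \<in> carrier R"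
  shows "trl e z = z \<otimes> u e"
  unfolding translate_def ginv_identity[OF assms(1)] using assms identity_closed[OF assms(1)]
  by (intro \<beta>_identity E_mult(2)) (auto intro: u_E)

text \<open>The cut-off inside \<open>trl g\<close> does not change \<open>trl h z\<close>, which
  already lies in \<open>E h = E (ginv G g)\<close>. The cut-off for the product is the one for
  \<open>h\<close>, as both arrows have the same source.\<close>

lemma trl_comp:
  assumes "g \<in> carrier G" "h \<in> carrier G" "gdom G g = gcod G h" "z \<in> carrier R"
  shows "trl g (trl h z) = trl (gmult G g h) z"
proof -
  have gh: "gmult G g h \<in> carrier G"
    using assms by (simp add: gmult_closed)
  have "E (ginv G g) = E h"
    using assms E_ginv[of g] E_gcod[of h] by simp
  then have "trl h z \<otimes> u (ginv G g) = trl h z"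
    using mult_u[OF assms(2) trl_E[OF assms(2,4)]] by simp
  then have "trl g (trl h z) = \<beta> g (\<beta> h (z \<otimes> u (ginv G h)))"
    unfolding translate_def by simp
  also have "\<dots> = \<beta> (gmult G g h) (z \<otimes> u (ginv G h))"
    by (rule \<beta>_comp[OF assms(1-3)]) (rule mult_u_ginv[OF assms(2,4)])
  also have "u (ginv G h) = u (ginv G (gmult G g h))"
    using assms gh by (simp add: E_ginv gdom_gmult)
  finally show ?thesis
    unfolding translate_def .
qed

text \<open>The family with entry \<open>z\<close> at \<open>e\<close> and the one with entry
  \<open>z\<close> at \<open>f\<close>, both zero elsewhere, have the same sum, so uniqueness of
  decompositions identifies them.\<close>

lemma E_disjoint:
  assumes e: "e \<in> identities G" and f: "f \<in> identities G" and ne: "e \<noteq> f" and z: "z \<in> E e" "z \<in> E f"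
  shows "z = \<zero>"
proof -
  have zR: "z \<in> carrier R"
    using E_carrier[OF identity_closed[OF e] z(1)] .
  have sum: "finsum R (\<lambda>j\<in>identities G. if j = i then z else \<zero>) (identities G) = z"
    if "i \<in> identities G" for i
  proof -
    have "finsum R (\<lambda>j\<in>identities G. if j = i then z else \<zero>) (identities G)
        = (\<Oplus>j\<in>identities G. if j = i then (\<lambda>_. z) j else \<zero>)"
      using zR by (intro finsum_cong'[OF refl]) auto
    also have "\<dots> = z"
      using add.finprod_singleton_swap[OF that finite_identities, of "\<lambda>_. z"] zR by simp
    finally show ?thesis .
  qed
  have mem: "(\<lambda>j\<in>identities G. if j = i then z else \<zero>) \<in> Pi\<^sub>E (identities G) E"
    if "z \<in> E i" for i
    using that E_zero[OF identity_closed] by auto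
  have "inj_on (\<lambda>f. finsum R f (identities G)) (Pi\<^sub>E (identities G) E)"
    using direct_sum unfolding internal_direct_sum_def by (rule bij_betw_imp_inj_on)
  from inj_onD[OF this _ mem[OF z(1)] mem[OF z(2)]] sum[OF e] sum[OF f]
  have "(\<lambda>j\<in>identities G. if j = e then z else \<zero>) = (\<lambda>j\<in>identities G. if j = f then z else \<zero>)"
    by simp
  from fun_cong[OF this, of e] show ?thesis
    using e ne by simp
qed

text \<open>The product lies in both ideals, hence in their zero intersection.\<close>

lemma u_orthogonal:
  assumes "e \<in> identities G" "f \<in> identities G" "e \<noteq> f" "z \<in> E e" "w \<in> E f"
  shows "z \<otimes> w = \<zero>"
  using assms identity_closed E_carrier
  by (intro E_disjoint[OF assms(1-3)] E_mult(1)[of e] E_mult(2)[of f]) auto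

text \<open>Multiplying the decomposition of 1 by \<open>u e\<close> leaves its component at
  \<open>e\<close>, so this component is \<open>u e\<close>.\<close>

lemma sum_u: "(\<Oplus>e\<in>identities G. u e) = \<one>"
proof -
  obtain F where F: "F \<in> Pi\<^sub>E (identities G) E" "finsum R F (identities G) = \<one>"
    using direct_sum one_closed unfolding internal_direct_sum_def bij_betw_def
    by (metis (no_types, lifting) imageE)
  have FE: "e \<in> identities G \<Longrightarrow> F e \<in> E e" for e
    using F(1) by auto
  have FR: "e \<in> identities G \<Longrightarrow> F e \<in> carrier R" for e
    using FE E_carrier identity_closed by blast
  have "u e = F e" if e: "e \<in> identities G" for e
  proof -
    have eG: "e \<in> carrier G" by (rule identity_closed[OF e])
    have "u e = u e \<otimes> finsum R F (identities G)"
      using F(2) eG by simp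
    also have "\<dots> = (\<Oplus>j\<in>identities G. u e \<otimes> F j)"
      using FR eG by (intro finsum_rdistr[OF finite_identities]) auto
    also have "\<dots> = (\<Oplus>j\<in>identities G. if j = e then F j else \<zero>)"
      using e eG FR by (intro finsum_cong'[OF refl]) (auto simp: u_mult FE u_orthogonal u_E)
    also have "\<dots> = F e"
      using FR by (intro add.finprod_singleton_swap[OF e finite_identities]) auto
    finally show ?thesis .
  qed
  then have "(\<Oplus>e\<in>identities G. u e) = finsum R F (identities G)"
    using FR by (intro finsum_cong'[OF refl]) auto
  with F(2) show ?thesis by simp
qed

lemma trl_u_gdom:
  assumes "g \<in> carrier G" "z \<in> carrier R"
  shows "trl g (z \<otimes> u (gdom G g)) = trl g z"
  using assms u_idem[OF ginv_closed[OF assms(1)]] u_closed[OF ginv_closed[OF assms(1)]]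
  by (simp add: translate_def u_ginv[symmetric] m_assoc)

text \<open>\<open>trl g\<close> cuts down to the component of \<open>gdom G g\<close>, which is
  orthogonal to the component containing \<open>trl h z\<close>.\<close>

lemma trl_trl_zero:
  assumes "g \<in> carrier G" "h \<in> carrier G" "gdom G g \<noteq> gcod G h" "z \<in> carrier R"
  shows "trl g (trl h z) = \<zero>"
proof -
  have d: "gdom G g \<in> carrier G"
    by (rule identity_closed[OF gdom_identities[OF assms(1)]])
  have "trl h z \<otimes> u (gdom G g) = \<zero>"
    using assms trl_E[OF assms(2,4)] E_gcod[OF assms(2)] d
    by (intro u_orthogonal[of "gcod G h" "gdom G g"]) (auto simp: gcod_identities gdom_identities u_E)
  then show ?thesis
    using trl_u_gdom[OF assms(1), of "trl h z"] assms by simp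
qed

lemma trl_finsum:
  assumes "g \<in> carrier G" "finite I" "f \<in> I \<rightarrow> carrier R"
  shows "trl g (finsum R f I) = (\<Oplus>i\<in>I. trl g (f i))"
  using assms
  by (intro finsum_additive[where h = "trl g", OF abelian_monoid_axioms abelian_monoid_axioms]) (auto simp: trl_add)

lemma invariant_iff:
  "z \<in> invariant_subring G R E \<beta> H \<longleftrightarrow> z \<in> carrier R \<and> (\<forall>h\<in>H. trl h z = z \<otimes> u h)"
  by (simp add: invariant_subring_def)

lemma invariant_subalgebra:
  assumes H: "H \<subseteq> carrier G"
  shows "unital_subalgebra (invariant_subring G R E \<beta> H) K R"
proof -
  have HG: "h \<in> H \<Longrightarrow> h \<in> carrier G" for h using H by auto
  have "subring (invariant_subring G R E \<beta> H) R"
  proof (rule subringI)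
    fix z assume "z \<in> invariant_subring G R E \<beta> H"
    then have z: "z \<in> carrier R" "\<And>h. h \<in> H \<Longrightarrow> trl h z = z \<otimes> u h"
      by (auto simp: invariant_iff)
    have "trl h (\<ominus> z) = \<ominus> z \<otimes> u h" if h: "h \<in> H" for h
    proof -
      have "trl h (\<ominus> z) \<oplus> trl h z = \<zero>"
        using z(1) HG[OF h] by (simp add: trl_add[symmetric] l_neg)
      then have "trl h (\<ominus> z) = \<ominus> (trl h z)"
        using z(1) HG[OF h] by (simp add: minus_equality)
      then show ?thesis
        using z HG[OF h] h by (simp add: l_minus)
    qed
    with z show "\<ominus> z \<in> invariant_subring G R E \<beta> H"
      by (simp add: invariant_iff)
  next
    fix z w assume "z \<in> invariant_subring G R E \<beta> H" "w \<in> invariant_subring G R E \<beta> H"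
    then have zw: "z \<in> carrier R" "w \<in> carrier R"
      "\<And>h. h \<in> H \<Longrightarrow> trl h z = z \<otimes> u h" "\<And>h. h \<in> H \<Longrightarrow> trl h w = w \<otimes> u h"
      by (auto simp: invariant_iff)
    show "z \<oplus> w \<in> invariant_subring G R E \<beta> H"
      using zw HG by (simp add: invariant_iff trl_add l_distr)
    have "trl h (z \<otimes> w) = z \<otimes> w \<otimes> u h" if h: "h \<in> H" for h
    proof -
      have "trl h (z \<otimes> w) = z \<otimes> (u h \<otimes> trl h w)"
        using zw HG[OF h] h by (simp add: trl_mult m_assoc)
      also have "\<dots> = z \<otimes> w \<otimes> u h"
        unfolding u_trl[OF HG[OF h] zw(2)] using zw HG[OF h] h by (simp add: m_assoc)
      finally show ?thesis .
    qed
    with zw show "z \<otimes> w \<in> invariant_subring G R E \<beta> H"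
      by (simp add: invariant_iff)
  qed (auto simp: invariant_iff trl_one HG)
  moreover have "k \<odot> z \<in> invariant_subring G R E \<beta> H"
    if "k \<in> carrier K" "z \<in> invariant_subring G R E \<beta> H" for k z
    using that HG by (simp add: invariant_iff trl_smult smult_assoc2)
  ultimately show ?thesis
    by (simp add: unital_subalgebra_def)
qed

section \<open>Traces over subsets of the groupoid\<close>

definition "tr H z = (\<Oplus>h\<in>H. trl h z)"

lemma tr_closed [simp]:
  assumes "H \<subseteq> carrier G" "z \<in> carrier R"
  shows "tr H z \<in> carrier R"
  unfolding tr_def using assms by (intro finsum_closed) auto

lemma tr_additive:
  assumes "H \<subseteq> carrier G" "z \<in> carrier R" "w \<in> carrier R"
  shows "tr H (z \<oplus> w) = tr H z \<oplus> tr H w"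
proof -
  have "tr H (z \<oplus> w) = (\<Oplus>h\<in>H. trl h z \<oplus> trl h w)"
    unfolding tr_def using assms by (intro finsum_cong'[OF refl]) (auto simp: trl_add subset_iff)
  also have "\<dots> = tr H z \<oplus> tr H w"
    unfolding tr_def using assms by (intro finsum_addf) auto
  finally show ?thesis .
qed

lemma tr_zero:
  assumes "H \<subseteq> carrier G"
  shows "tr H \<zero> = \<zero>"
proof -
  have "tr H \<zero> = (\<Oplus>h\<in>H. \<zero>)"
    unfolding tr_def using assms by (intro finsum_cong'[OF refl]) auto
  then show ?thesis by (simp add: finsum_zero)
qed

lemma tr_finsum:
  assumes "H \<subseteq> carrier G" "finite I" "f \<in> I \<rightarrow> carrier R"
  shows "tr H (finsum R f I) = (\<Oplus>i\<in>I. tr H (f i))"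
  by (rule finsum_additive[where h = "tr H", OF abelian_monoid_axioms abelian_monoid_axioms])
     (use assms in \<open>auto simp: tr_additive tr_zero\<close>)

lemma finite_subset_G: "H \<subseteq> carrier G \<Longrightarrow> finite H"
  using finite_G finite_subset by blast

lemma tr_smult:
  assumes H: "H \<subseteq> carrier G" and k: "k \<in> carrier K" and z: "z \<in> carrier R"
  shows "tr H (k \<odot> z) = k \<odot> tr H z"
proof -
  have "tr H (k \<odot> z) = (\<Oplus>h\<in>H. k \<odot> trl h z)"
    unfolding tr_def using assms by (intro finsum_cong'[OF refl]) (auto simp: trl_smult subset_iff)
  also have "\<dots> = k \<odot> tr H z"
    unfolding tr_def using assms finite_subset_G[OF H]
    by (intro finsum_smult_ldistr[symmetric]) auto
  finally show ?thesis .
qed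

lemma trl_tr:
  assumes "H \<subseteq> carrier G" "g \<in> carrier G" "z \<in> carrier R"
  shows "trl g (tr H z) = (\<Oplus>k\<in>{k \<in> H. gcod G k = gdom G g}. trl (gmult G g k) z)"
proof -
  have HG: "h \<in> H \<Longrightarrow> h \<in> carrier G" for h using assms by auto
  have "trl g (tr H z) = (\<Oplus>k\<in>H. trl g (trl k z))"
    unfolding tr_def using assms finite_subset_G by (intro trl_finsum) auto
  also have "\<dots> = (\<Oplus>k\<in>{k \<in> H. gcod G k = gdom G g}. trl (gmult G g k) z)"
  proof (rule add.finprod_mono_neutral_cong_right)
    show "finite H" using assms(1) by (rule finite_subset_G)
  qed (use assms(2,3) HG in \<open>auto simp: trl_trl_zero trl_comp\<close>)
  finally show ?thesis .
qed

text \<open>Left multiplication by \<open>g\<close> carries the arrows of \<open>H\<close> ending at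
  the source of \<open>g\<close> bijectively onto those ending at its target. Multiplying the trace
  by \<open>u g\<close> selects exactly the latter terms.\<close>

lemma tr_invariant:
  assumes H: "wide_subgroupoid H G" and z: "z \<in> carrier R"
  shows "tr H z \<in> invariant_subring G R E \<beta> H"
proof -
  have HG: "H \<subseteq> carrier G" and inv: "\<And>h. h \<in> H \<Longrightarrow> ginv G h \<in> H"
    and mul: "\<And>g h. g \<in> H \<Longrightarrow> h \<in> H \<Longrightarrow> gdom G g = gcod G h \<Longrightarrow> gmult G g h \<in> H"
    using H by (auto simp: wide_subgroupoid_def subgroupoid_def)
  have "trl g (tr H z) = tr H z \<otimes> u g" if g: "g \<in> H" for g
  proof -
    have gG: "g \<in> carrier G" using g HG by auto
    let ?A = "{k \<in> H. gcod G k = gdom G g}" and ?B = "{k \<in> H. gcod G k = gcod G g}"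
    have im: "gmult G g ` ?A = ?B"
    proof (intro equalityI subsetI)
      fix k assume "k \<in> gmult G g ` ?A"
      with HG gG g mul show "k \<in> ?B" by (auto simp: gcod_gmult)
    next
      fix k assume k: "k \<in> ?B"
      then have kG: "k \<in> carrier G" using HG by auto
      have "gmult G (ginv G g) k \<in> ?A"
        using k kG gG inv[OF g] mul[OF inv[OF g], of k]
        by (simp add: gdom_ginv gcod_gmult ginv_closed gcod_ginv)
      moreover have "gmult G g (gmult G (ginv G g) k) = k"
        using gmult_left_cancel[of "ginv G g" k] k kG gG by (simp add: ginv_closed gdom_ginv ginv_ginv)
      ultimately show "k \<in> gmult G g ` ?A" by force
    qed
    have inj: "inj_on (gmult G g) ?A"
    proof (rule inj_onI)
      fix k l assume "k \<in> ?A" "l \<in> ?A" "gmult G g k = gmult G g l"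
      then show "k = l"
        using gmult_left_cancel[OF gG, of k] gmult_left_cancel[OF gG, of l] HG by auto
    qed
    have "trl g (tr H z) = (\<Oplus>k\<in>?A. trl (gmult G g k) z)"
      by (rule trl_tr[OF HG gG z])
    also have "\<dots> = (\<Oplus>k\<in>?B. trl k z)"
      unfolding im[symmetric] using HG gG z
      by (intro finsum_reindex[symmetric, OF _ inj]) (auto simp: im subset_iff gmult_closed)
    also have "\<dots> = (\<Oplus>k\<in>H. trl k z \<otimes> u g)"
    proof (rule add.finprod_mono_neutral_cong_left[OF finite_subset_G[OF HG]])
      fix k assume k: "k \<in> H - ?B"
      then have kG: "k \<in> carrier G" using HG by auto
      have "trl k z \<in> E (gcod G k)" "u g \<in> E (gcod G g)"
        using trl_E[OF kG z] E_gcod[OF kG] u_E[OF gG] E_gcod[OF gG] by auto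
      with k show "trl k z \<otimes> u g = \<zero>"
        by (intro u_orthogonal[of "gcod G k" "gcod G g"]) (auto simp: gcod_identities kG gG)
    next
      fix k assume k: "k \<in> ?B"
      then have "u g = u k"
        using u_gcod[OF gG] u_gcod[of k] HG by auto
      with k show "trl k z = trl k z \<otimes> u g"
        using HG z by (auto simp: trl_u)
    qed (use HG gG z in auto)
    also have "\<dots> = tr H z \<otimes> u g"
      unfolding tr_def using HG gG z finite_subset_G[OF HG] by (intro finsum_ldistr[symmetric]) auto
    finally show ?thesis .
  qed
  with HG z show ?thesis
    by (simp add: invariant_iff)
qed

text \<open>An invariant \<open>s\<close> is translated to \<open>s \<otimes> u h\<close>, and
  \<open>trl h z\<close> absorbs the factor \<open>u h\<close>. So the trace is linear over the
  invariants.\<close>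

lemma tr_mult_invariant:
  assumes H: "H \<subseteq> carrier G" and s: "s \<in> invariant_subring G R E \<beta> H" and z: "z \<in> carrier R"
  shows "tr H (s \<otimes> z) = s \<otimes> tr H z"
proof -
  have sR: "s \<in> carrier R" and s: "\<And>h. h \<in> H \<Longrightarrow> trl h s = s \<otimes> u h"
    using s by (auto simp: invariant_iff)
  have "tr H (s \<otimes> z) = (\<Oplus>h\<in>H. s \<otimes> trl h z)"
    unfolding tr_def
  proof (intro finsum_cong'[OF refl] Pi_I)
    fix h assume h: "h \<in> H"
    then have hG: "h \<in> carrier G" using H by auto
    show "s \<otimes> trl h z \<in> carrier R" using sR hG z by simp
    show "trl h (s \<otimes> z) = s \<otimes> trl h z"
      using sR z hG by (simp add: trl_mult s[OF h] m_assoc u_trl)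
  qed
  also have "\<dots> = s \<otimes> tr H z"
    unfolding tr_def using H sR z finite_subset_G[OF H] by (intro finsum_rdistr[symmetric]) auto
  finally show ?thesis .
qed

end

section \<open>Galois coordinates\<close>

lemma (in cring) diff_mult_eqI:
  assumes "s \<in> carrier R" "b \<in> carrier R" "z \<in> carrier R" "w \<in> carrier R" "s \<otimes> z = b \<otimes> z \<oplus> w"
  shows "(s \<ominus> b) \<otimes> z = w"
proof -
  have "(s \<ominus> b) \<otimes> z = s \<otimes> z \<ominus> b \<otimes> z"
    using assms(1-4) by algebra
  also have "\<dots> = (b \<otimes> z \<oplus> w) \<ominus> b \<otimes> z"
    by (simp only: assms(5))
  also have "\<dots> = w"
    using assms(1-4) by algebra
  finally show ?thesis .
qed

text \<open>If \<open>1 - s\<close> and \<open>b\<close> lie in an ideal of a ring containing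
  \<open>s\<close>, the right side shows that \<open>1 - (s - b) s\<close> does too.\<close>

lemma (in cring) one_minus_diff_mult:
  assumes "s \<in> carrier R" "b \<in> carrier R"
  shows "\<one> \<ominus> (s \<ominus> b) \<otimes> s = (\<one> \<oplus> s) \<otimes> (\<one> \<ominus> s) \<oplus> s \<otimes> b"
  using assms by algebra

text \<open>
  The generators \<open>x i\<close> are removed one at a time, keeping an \<open>s \<in> 1 + I\<close> that multiplies the whole ring
  into the span of the remaining ones; no determinant is needed.
\<close>

lemma (in cring) nakayama_one_mem:
  assumes T: "subring T R" and I: "I \<subseteq> T"
    and add: "\<And>a b. \<lbrakk>a \<in> I; b \<in> I\<rbrakk> \<Longrightarrow> a \<oplus> b \<in> I"
    and mult: "\<And>t a. \<lbrakk>t \<in> T; a \<in> I\<rbrakk> \<Longrightarrow> t \<otimes> a \<in> I"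
    and "finite S" "x \<in> S \<rightarrow> carrier R" "s \<in> T" "\<one> \<ominus> s \<in> I"
    and "\<And>z. z \<in> carrier R \<Longrightarrow> \<exists>b\<in>S \<rightarrow> I. s \<otimes> z = (\<Oplus>i\<in>S. b i \<otimes> x i)"
  shows "\<one> \<in> I"
  using assms(5-)
proof (induction S arbitrary: s rule: finite_induct)
  case empty
  have sR: "s \<in> carrier R" using empty(2) subringE(1)[OF T] by auto
  \<comment> \<open>With no generators left, \<open>s\<close> annihilates 1; then
    \<open>1 - s\<close>, an element of \<open>I\<close>, is 1 itself.\<close>
  have "s = \<zero>"
    using empty(4)[OF one_closed] sR by simp
  then show ?case
    using empty(3) by (simp add: minus_eq)
next
  case (insert j S)
  have TR: "t \<in> T \<Longrightarrow> t \<in> carrier R" for t using subringE(1)[OF T] by auto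
  have IT: "a \<in> I \<Longrightarrow> a \<in> T" for a using I by auto
  have IR: "a \<in> I \<Longrightarrow> a \<in> carrier R" for a using IT TR by auto
  have xj: "x j \<in> carrier R" and xS: "x \<in> S \<rightarrow> carrier R" and xi: "i \<in> S \<Longrightarrow> x i \<in> carrier R" for i
    using insert.prems(1) by auto
  note sT = insert.prems(2) and sR = TR[OF insert.prems(2)]
  have split: "(\<Oplus>i\<in>insert j S. c i \<otimes> x i) = c j \<otimes> x j \<oplus> (\<Oplus>i\<in>S. c i \<otimes> x i)"
    if "c \<in> insert j S \<rightarrow> I" for c
    using that insert.hyps xj xS IR by (intro finsum_insert) auto
  have sum_closed: "(\<Oplus>i\<in>S. c i \<otimes> x i) \<in> carrier R" if "c \<in> insert j S \<rightarrow> I" for c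
    using that xS IR by (intro finsum_closed) auto
  obtain b where b: "b \<in> insert j S \<rightarrow> I" "s \<otimes> x j = (\<Oplus>i\<in>insert j S. b i \<otimes> x i)"
    using insert.prems(4)[OF xj] by blast
  have bj: "b j \<in> I" "b j \<in> carrier R" using b(1) IR by auto
  \<comment> \<open>Solving the relation for \<open>x j\<close> shows that
    \<open>t = s - b j\<close> sends \<open>x j\<close> into the span of the remaining generators.
    Hence \<open>t \<otimes> s\<close> sends every element there: \<open>s\<close> expands it, and
    \<open>t\<close> eliminates the term at \<open>x j\<close>.\<close>
  define t where "t = s \<ominus> b j"
  have tT: "t \<in> T"
    unfolding t_def minus_eq using subringE(5,7)[OF T] sT IT[OF bj(1)] by blast
  have tR: "t \<in> carrier R" by (rule TR[OF tT])
  have "s \<otimes> x j = b j \<otimes> x j \<oplus> (\<Oplus>i\<in>S. b i \<otimes> x i)"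
    using b split by simp
  then have txj: "t \<otimes> x j = (\<Oplus>i\<in>S. b i \<otimes> x i)"
    unfolding t_def by (rule diff_mult_eqI[OF sR bj(2) xj sum_closed[OF b(1)]])
  show ?case
  proof (rule insert.IH[OF xS, of "t \<otimes> s"])
    show "t \<otimes> s \<in> T"
      using subringE(6)[OF T tT sT] .
    have "\<one> \<ominus> t \<otimes> s = (\<one> \<oplus> s) \<otimes> (\<one> \<ominus> s) \<oplus> s \<otimes> b j"
      unfolding t_def using one_minus_diff_mult[OF sR bj(2)] .
    moreover have "\<one> \<oplus> s \<in> T"
      using subringE(3,7)[OF T] sT by blast
    ultimately show "\<one> \<ominus> t \<otimes> s \<in> I"
      using insert.prems(3) sT bj(1) add mult by simp
    fix z assume z: "z \<in> carrier R"
    obtain c where c: "c \<in> insert j S \<rightarrow> I" "s \<otimes> z = (\<Oplus>i\<in>insert j S. c i \<otimes> x i)"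
      using insert.prems(4)[OF z] by blast
    have cj: "c j \<in> I" "c j \<in> carrier R" using c(1) IR by auto
    have bc: "i \<in> S \<Longrightarrow> b i \<in> I" "i \<in> S \<Longrightarrow> c i \<in> I" for i using b(1) c(1) by auto
    have "t \<otimes> s \<otimes> z = t \<otimes> (c j \<otimes> x j \<oplus> (\<Oplus>i\<in>S. c i \<otimes> x i))"
      using c split z sR tR by (simp add: m_assoc)
    also have "\<dots> = c j \<otimes> (t \<otimes> x j) \<oplus> t \<otimes> (\<Oplus>i\<in>S. c i \<otimes> x i)"
      using tR cj xj sum_closed[OF c(1)] by (simp add: r_distr m_lcomm)
    also have "\<dots> = (\<Oplus>i\<in>S. c j \<otimes> (b i \<otimes> x i)) \<oplus> (\<Oplus>i\<in>S. t \<otimes> (c i \<otimes> x i))"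
      unfolding txj using insert.hyps(1) cj tR bc xi IR by (subst (1 2) finsum_rdistr) auto
    also have "\<dots> = (\<Oplus>i\<in>S. c j \<otimes> (b i \<otimes> x i) \<oplus> t \<otimes> (c i \<otimes> x i))"
      using cj tR bc xi IR by (intro finsum_addf[symmetric]) auto
    also have "\<dots> = (\<Oplus>i\<in>S. (c j \<otimes> b i \<oplus> t \<otimes> c i) \<otimes> x i)"
      using cj tR bc xi IR by (intro finsum_cong'[OF refl]) (auto simp: l_distr m_assoc)
    finally show "\<exists>b\<in>S \<rightarrow> I. t \<otimes> s \<otimes> z = (\<Oplus>i\<in>S. b i \<otimes> x i)"
      using bc tT IT cj(1) add mult by (intro bexI[of _ "\<lambda>i. c j \<otimes> b i \<oplus> t \<otimes> c i"]) auto
  qed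
qed

section \<open>Galois coordinates as dual bases\<close>

locale galois_groupoid_action = unital_groupoid_action G K R E \<beta>
  for G :: "('g, 'z) groupoid_scheme"
    and K :: "('k, 'x) ring_scheme"
    and R :: "('k, 'r, 'y) module_scheme" (structure)
    and E :: "'g \<Rightarrow> 'r set" and \<beta> :: "'g \<Rightarrow> 'r \<Rightarrow> 'r" +
  fixes N :: "'i set" and x y :: "'i \<Rightarrow> 'r"
  assumes finite_N: "finite N"
    and x: "x \<in> N \<rightarrow> carrier R" and y: "y \<in> N \<rightarrow> carrier R"
    and galois: "g \<in> carrier G \<Longrightarrow>
      (\<Oplus>i\<in>N. x i \<otimes> translate G R E \<beta> g (y i)) = (if g \<in> identities G then ideal_one R (E g) else \<zero>)"
    and fixed_ring: "invariant_subring G R E \<beta> (carrier G) = (\<lambda>k. k \<odot> \<one>) ` carrier K"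
    and u_nonzero: "g \<in> carrier G \<Longrightarrow> ideal_one R (E g) \<noteq> \<zero>"
begin

lemma x_closed [simp]: "i \<in> N \<Longrightarrow> x i \<in> carrier R"
  and y_closed [simp]: "i \<in> N \<Longrightarrow> y i \<in> carrier R"
  using x y by auto

lemma wide_G: "wide_subgroupoid (carrier G) G"
  using nonempty identity_closed by (auto simp: wide_subgroupoid_def subgroupoid_def ginv_closed gmult_closed)

text \<open>After interchanging the sums, the Galois relation for each \<open>h k\<close> keeps the
  weight \<open>w k\<close>, cut down by the unit, if \<open>h k\<close> is an identity and kills it
  otherwise. The arrows form an indexed family because later they are composites of the index with
  fixed arrows.\<close>

lemma sum_galois_coefficient:
  assumes a: "finite A" "h ` A \<subseteq> carrier G" "w \<in> A \<rightarrow> carrier R"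
  shows "(\<Oplus>i\<in>N. x i \<otimes> (\<Oplus>k\<in>A. trl (h k) (y i) \<otimes> w k))
    = (\<Oplus>k\<in>A. (if h k \<in> identities G then u (h k) else \<zero>) \<otimes> w k)"
proof -
  have hk: "k \<in> A \<Longrightarrow> h k \<in> carrier G" and wk: "k \<in> A \<Longrightarrow> w k \<in> carrier R" for k
    using a by auto
  have "(\<Oplus>i\<in>N. x i \<otimes> (\<Oplus>k\<in>A. trl (h k) (y i) \<otimes> w k)) = (\<Oplus>i\<in>N. \<Oplus>k\<in>A. x i \<otimes> (trl (h k) (y i) \<otimes> w k))"
    using a(1) hk wk by (intro finsum_cong'[OF refl]) (auto simp: finsum_rdistr)
  also have "\<dots> = (\<Oplus>k\<in>A. \<Oplus>i\<in>N. x i \<otimes> (trl (h k) (y i) \<otimes> w k))"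
    using a(1) finite_N hk wk by (intro finsum_swap) auto
  also have "\<dots> = (\<Oplus>k\<in>A. (if h k \<in> identities G then u (h k) else \<zero>) \<otimes> w k)"
  proof (intro finsum_cong'[OF refl] Pi_I)
    fix k assume k: "k \<in> A"
    have "(\<Oplus>i\<in>N. x i \<otimes> (trl (h k) (y i) \<otimes> w k)) = (\<Oplus>i\<in>N. x i \<otimes> trl (h k) (y i)) \<otimes> w k"
      using finite_N hk[OF k] wk[OF k] by (subst finsum_ldistr) (auto simp: m_assoc intro!: finsum_cong'[OF refl])
    then show "(\<Oplus>i\<in>N. x i \<otimes> (trl (h k) (y i) \<otimes> w k)) = (if h k \<in> identities G then u (h k) else \<zero>) \<otimes> w k"
      using galois[OF hk[OF k]] by simp
    show "(if h k \<in> identities G then u (h k) else \<zero>) \<otimes> w k \<in> carrier R"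
      using hk[OF k] wk[OF k] by auto
  qed
  finally show ?thesis .
qed

text \<open>The Galois relation retains the identities from the trace. All of them lie in
  \<open>H\<close> because \<open>H\<close> is wide, and their units add up to 1.\<close>

lemma sum_x_tr_y:
  assumes H: "wide_subgroupoid H G" and z: "z \<in> carrier R"
  shows "(\<Oplus>i\<in>N. x i \<otimes> tr H (y i \<otimes> z)) = z"
proof -
  have HG: "H \<subseteq> carrier G" and ident: "identities G \<subseteq> H"
    using H by (auto simp: wide_subgroupoid_def subgroupoid_def)
  have "(\<Oplus>i\<in>N. x i \<otimes> tr H (y i \<otimes> z)) = (\<Oplus>i\<in>N. x i \<otimes> (\<Oplus>h\<in>H. trl h (y i) \<otimes> trl h z))"
  proof (intro finsum_cong'[OF refl] Pi_I)
    fix i assume i: "i \<in> N"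
    have "tr H (y i \<otimes> z) = (\<Oplus>h\<in>H. trl h (y i) \<otimes> trl h z)"
      unfolding tr_def using HG i z by (intro finsum_cong'[OF refl]) (auto simp: trl_mult)
    then show "x i \<otimes> tr H (y i \<otimes> z) = x i \<otimes> (\<Oplus>h\<in>H. trl h (y i) \<otimes> trl h z)" by simp
    show "x i \<otimes> (\<Oplus>h\<in>H. trl h (y i) \<otimes> trl h z) \<in> carrier R"
      using HG i z by (intro m_closed finsum_closed Pi_I) auto
  qed
  also have "\<dots> = (\<Oplus>h\<in>H. (if h \<in> identities G then u h else \<zero>) \<otimes> trl h z)"
    using HG z finite_subset_G[OF HG]
    by (intro sum_galois_coefficient[of H "\<lambda>h. h" "\<lambda>h. trl h z"]) auto
  also have "\<dots> = (\<Oplus>h\<in>identities G. u h \<otimes> z)"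
  proof (rule add.finprod_mono_neutral_cong_right[OF finite_subset_G[OF HG] ident])
    fix h assume h: "h \<in> identities G"
    then show "(if h \<in> identities G then u h else \<zero>) \<otimes> trl h z = u h \<otimes> z"
      using identity_closed[OF h] z trl_identity[OF h z] u_idem[of h]
      by (simp add: m_comm[of z] m_assoc[symmetric])
  qed (use HG z in auto)
  also have "\<dots> = (\<Oplus>h\<in>identities G. u h) \<otimes> z"
    using z identity_closed by (intro finsum_ldistr[symmetric, OF finite_identities]) auto
  finally show ?thesis
    using z by (simp add: sum_u)
qed

text \<open>Apply \<open>trl g\<close> to the Galois relation for the inverse arrow: the translate
  of \<open>y i\<close> is carried back to \<open>y i\<close> cut down to \<open>E g\<close>, and
  the action now sits on the \<open>x i\<close>.\<close>

lemma sum_trl_x_y: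
  assumes g: "g \<in> carrier G"
  shows "(\<Oplus>i\<in>N. trl g (x i) \<otimes> y i) = (if g \<in> identities G then u g else \<zero>)"
proof -
  let ?h = "ginv G g"
  have h: "?h \<in> carrier G" using g by (rule ginv_closed)
  have "(\<Oplus>i\<in>N. trl g (x i) \<otimes> y i) = (\<Oplus>i\<in>N. trl g (x i \<otimes> trl ?h (y i)))"
  proof (intro finsum_cong'[OF refl] Pi_I)
    fix i assume i: "i \<in> N"
    have "trl g (trl ?h (y i)) = trl (gcod G g) (y i)"
      using trl_comp[OF g h] i g by (simp add: gcod_ginv gcod_def[of G g])
    also have "\<dots> = y i \<otimes> u g"
      using trl_identity[OF gcod_identities[OF g], of "y i"] i u_gcod[OF g] by simp
    finally have *: "trl g (trl ?h (y i)) = y i \<otimes> u g" .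
    have "trl g (x i \<otimes> trl ?h (y i)) = trl g (x i) \<otimes> (y i \<otimes> u g)"
      using i g h by (simp add: trl_mult *)
    also have "\<dots> = (trl g (x i) \<otimes> u g) \<otimes> y i"
      using i g by (simp add: m_ac)
    finally show "trl g (x i) \<otimes> y i = trl g (x i \<otimes> trl ?h (y i))"
      using i g by (simp add: trl_u)
  qed (use g h in auto)
  also have "\<dots> = trl g (\<Oplus>i\<in>N. x i \<otimes> trl ?h (y i))"
    using g h finite_N by (intro trl_finsum[symmetric]) auto
  also have "\<dots> = trl g (if ?h \<in> identities G then u ?h else \<zero>)"
    by (simp only: galois[OF h])
  also have "\<dots> = (if g \<in> identities G then u g else \<zero>)"
    using g ginv_identity_iff[OF g] trl_identity[of g "u g"] ginv_identity[of g] u_idem[OF g] by simp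
  finally show ?thesis .
qed

text \<open>The counterpart of \<open>sum_x_tr_y\<close> with the coordinates exchanged. It expands
  \<open>t \<otimes> y j\<close> with the same traces that occur in the expansion of
  \<open>t \<otimes> x i\<close>.\<close>

lemma sum_tr_x_y:
  assumes z: "z \<in> carrier R"
  shows "(\<Oplus>i\<in>N. tr (carrier G) (z \<otimes> x i) \<otimes> y i) = z"
proof -
  have "(\<Oplus>i\<in>N. tr (carrier G) (z \<otimes> x i) \<otimes> y i) = (\<Oplus>i\<in>N. \<Oplus>g\<in>carrier G. trl g z \<otimes> (trl g (x i) \<otimes> y i))"
  proof (intro finsum_cong'[OF refl] Pi_I finsum_closed)
    fix i assume i: "i \<in> N"
    have "tr (carrier G) (z \<otimes> x i) = (\<Oplus>g\<in>carrier G. trl g z \<otimes> trl g (x i))"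
      unfolding tr_def using i z by (intro finsum_cong'[OF refl]) (auto simp: trl_mult)
    also have "\<dots> \<otimes> y i = (\<Oplus>g\<in>carrier G. trl g z \<otimes> trl g (x i) \<otimes> y i)"
      using i z finite_G by (intro finsum_ldistr) auto
    also have "\<dots> = (\<Oplus>g\<in>carrier G. trl g z \<otimes> (trl g (x i) \<otimes> y i))"
      using i z by (intro finsum_cong'[OF refl]) (auto simp: m_assoc)
    finally show "tr (carrier G) (z \<otimes> x i) \<otimes> y i = (\<Oplus>g\<in>carrier G. trl g z \<otimes> (trl g (x i) \<otimes> y i))" .
  qed (use z in auto)
  also have "\<dots> = (\<Oplus>g\<in>carrier G. \<Oplus>i\<in>N. trl g z \<otimes> (trl g (x i) \<otimes> y i))"
    using z finite_G finite_N by (intro finsum_swap) auto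
  also have "\<dots> = (\<Oplus>g\<in>carrier G. trl g z \<otimes> (if g \<in> identities G then u g else \<zero>))"
  proof (intro finsum_cong'[OF refl] Pi_I)
    fix g assume g: "g \<in> carrier G"
    have "(\<Oplus>i\<in>N. trl g z \<otimes> (trl g (x i) \<otimes> y i)) = trl g z \<otimes> (\<Oplus>i\<in>N. trl g (x i) \<otimes> y i)"
      using z g finite_N by (intro finsum_rdistr[symmetric]) auto
    then show "(\<Oplus>i\<in>N. trl g z \<otimes> (trl g (x i) \<otimes> y i)) = trl g z \<otimes> (if g \<in> identities G then u g else \<zero>)"
      by (simp only: sum_trl_x_y[OF g])
  qed (use z in auto)
  also have "\<dots> = (\<Oplus>g\<in>identities G. z \<otimes> u g)"
  proof (rule add.finprod_mono_neutral_cong_right[OF finite_G])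
    fix g assume g: "g \<in> identities G"
    then show "trl g z \<otimes> (if g \<in> identities G then u g else \<zero>) = z \<otimes> u g"
      using identity_closed[OF g] z trl_identity[OF g z] u_idem[of g] by (simp add: m_assoc)
  qed (use z identity_closed in auto)
  also have "\<dots> = z \<otimes> (\<Oplus>g\<in>identities G. u g)"
    using z identity_closed by (intro finsum_rdistr[symmetric, OF finite_identities]) auto
  finally show ?thesis
    using z by (simp add: sum_u)
qed

lemma tr_G_scalar:
  assumes "z \<in> carrier R"
  obtains k where "k \<in> carrier K" "tr (carrier G) z = k \<odot> \<one>"
  using tr_invariant[OF wide_G assms] unfolding fixed_ring by auto

text \<open>Traces form an ideal of the invariants, by linearity, and \<open>sum_x_tr_y\<close>
  writes every element of \<open>R\<close> as a combination of the \<open>x i\<close> with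
  coefficients in that ideal. Nakayama, started at \<open>s = 1\<close>, puts 1 into it.\<close>

lemma tr_surjective:
  assumes H: "wide_subgroupoid H G"
  obtains c where "c \<in> carrier R" "tr H c = \<one>"
proof -
  have HG: "H \<subseteq> carrier G"
    using H by (auto simp: wide_subgroupoid_def subgroupoid_def)
  let ?T = "invariant_subring G R E \<beta> H"
  let ?I = "tr H ` carrier R"
  have T: "subring ?T R"
    using invariant_subalgebra[OF HG] by (simp add: unital_subalgebra_def)
  have "\<one> \<in> ?I"
  proof (rule nakayama_one_mem[OF T _ _ _ finite_N x])
    show "?I \<subseteq> ?T"
      using tr_invariant[OF H] by auto
    show "\<one> \<in> ?T"
      using subringE(3)[OF T] .
    show "\<one> \<ominus> \<one> \<in> ?I"
      using tr_zero[OF HG] by (auto simp: minus_eq r_neg intro!: image_eqI[of _ _ \<zero>])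
    fix a b assume "a \<in> ?I" "b \<in> ?I"
    then show "a \<oplus> b \<in> ?I"
      using tr_additive[OF HG, symmetric] by auto
  next
    fix t a assume t: "t \<in> ?T" "a \<in> ?I"
    then obtain w where w: "w \<in> carrier R" "a = tr H w" by auto
    have "t \<in> carrier R" using t(1) by (simp add: invariant_iff)
    with w t(1) show "t \<otimes> a \<in> ?I"
      using tr_mult_invariant[OF HG t(1) w(1)] by (auto intro!: image_eqI[of _ _ "t \<otimes> w"])
  next
    fix z assume z: "z \<in> carrier R"
    have "\<one> \<otimes> z = (\<Oplus>i\<in>N. x i \<otimes> tr H (y i \<otimes> z))"
      using z sum_x_tr_y[OF H z] by simp
    also have "\<dots> = (\<Oplus>i\<in>N. tr H (y i \<otimes> z) \<otimes> x i)"
      using z HG by (intro finsum_cong'[OF refl]) (auto simp: m_comm)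
    finally show "\<exists>b\<in>N \<rightarrow> ?I. \<one> \<otimes> z = (\<Oplus>i\<in>N. b i \<otimes> x i)"
      using z by (intro bexI[of _ "\<lambda>i. tr H (y i \<otimes> z)"]) auto
  qed
  then show ?thesis
    using that by auto
qed

text \<open>The composite translates belong to the arrows h k g\<inverse> with k in
  \<open>H\<close>. The Galois relation keeps the one that is an identity, namely k = h\<inverse> g,
  so the sum detects whether this arrow lies in \<open>H\<close>.\<close>

lemma sum_x_trl_tr:
  assumes HG: "H \<subseteq> carrier G" and g: "g \<in> carrier G" and h: "h \<in> carrier G" and gh: "gcod G g = gcod G h"
  shows "(\<Oplus>i\<in>N. x i \<otimes> trl h (tr H (trl (ginv G g) (y i)))) = (if gmult G (ginv G h) g \<in> H then u g else \<zero>)"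
proof -
  let ?A = "{k \<in> H. gcod G k = gdom G h}" and ?B = "{k \<in> H. gcod G k = gdom G h \<and> gdom G k = gdom G g}"
  let ?c = "\<lambda>k. gmult G (gmult G h k) (ginv G g)"
  have HGk: "k \<in> H \<Longrightarrow> k \<in> carrier G" for k using HG by auto
  have g': "ginv G g \<in> carrier G" by (rule ginv_closed[OF g])
  have hk: "gmult G h k \<in> carrier G" "gdom G (gmult G h k) = gdom G k" "gcod G (gmult G h k) = gcod G h"
    if "k \<in> ?A" for k
    using that h HGk by (auto simp: gmult_closed gdom_gmult gcod_gmult)
  have c: "?c k \<in> carrier G" "gcod G (?c k) = gcod G h" if "k \<in> ?B" for k
    using that hk[of k] g' g by (auto simp: gmult_closed gcod_gmult gcod_ginv)
  \<comment> \<open>The factor 1 is the weight expected by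
    \<open>sum_galois_coefficient\<close>.\<close>
  have expand: "trl h (tr H (trl (ginv G g) z)) = (\<Oplus>k\<in>?B. trl (?c k) z \<otimes> \<one>)" if z: "z \<in> carrier R" for z
  proof -
    have "trl h (tr H (trl (ginv G g) z)) = (\<Oplus>k\<in>?A. trl (gmult G h k) (trl (ginv G g) z))"
      using trl_tr[OF HG h] z g' by simp
    also have "\<dots> = (\<Oplus>k\<in>?B. trl (?c k) z \<otimes> \<one>)"
    proof (rule add.finprod_mono_neutral_cong_right)
      show "finite ?A" using finite_subset_G[OF HG] by simp
      show "trl (gmult G h k) (trl (ginv G g) z) = \<zero>" if "k \<in> ?A - ?B" for k
        using that hk[of k] g g' z by (intro trl_trl_zero) (auto simp: gcod_ginv)
      show "trl (gmult G h k) (trl (ginv G g) z) = trl (?c k) z \<otimes> \<one>" if k: "k \<in> ?B" for k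
        using hk[of k] k g g' z c(1)[OF k] by (simp add: trl_comp gcod_ginv)
    qed (use hk g' z in auto)
    finally show ?thesis .
  qed
  have key: "?c k \<in> identities G \<longleftrightarrow> k = gmult G (ginv G h) g" if k: "k \<in> ?B" for k
  proof -
    have kA: "k \<in> ?A" and kG: "k \<in> carrier G" and dk: "gdom G k = gdom G g" and ck: "gdom G h = gcod G k"
      using k HGk by auto
    have "?c k \<in> identities G \<longleftrightarrow> gmult G h k = ginv G (ginv G g)"
      by (rule gmult_identity_iff) (use hk[OF kA] g' g dk in \<open>auto simp: gcod_ginv\<close>)
    also have "\<dots> \<longleftrightarrow> gmult G h k = g"
      by (simp add: ginv_ginv[OF g])
    also have "\<dots> \<longleftrightarrow> k = gmult G (ginv G h) g"
      using gmult_left_cancel[OF h kG ck] gmult_left_cancel[of "ginv G h" g] g h gh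
      by (auto simp: ginv_closed gdom_ginv ginv_ginv)
    finally show ?thesis .
  qed
  have "(\<Oplus>i\<in>N. x i \<otimes> trl h (tr H (trl (ginv G g) (y i)))) = (\<Oplus>i\<in>N. x i \<otimes> (\<Oplus>k\<in>?B. trl (?c k) (y i) \<otimes> \<one>))"
    using c(1) by (intro finsum_cong'[OF refl]) (auto simp: expand intro!: finsum_closed)
  also have "\<dots> = (\<Oplus>k\<in>?B. (if ?c k \<in> identities G then u (?c k) else \<zero>) \<otimes> \<one>)"
    using finite_subset_G[OF HG] c(1) by (intro sum_galois_coefficient) auto
  also have "\<dots> = (\<Oplus>k\<in>?B. if k = gmult G (ginv G h) g then (\<lambda>_. u g) k else \<zero>)"
  proof (intro finsum_cong'[OF refl] Pi_I)
    fix k assume k: "k \<in> ?B"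
    have uc: "u (?c k) = u g"
      using u_gcod[OF c(1)[OF k]] c(2)[OF k] u_gcod[OF g] gh by simp
    show "(if ?c k \<in> identities G then u (?c k) else \<zero>) \<otimes> \<one>
        = (if k = gmult G (ginv G h) g then (\<lambda>_. u g) k else \<zero>)"
      unfolding uc key[OF k] using g by simp
  qed (use g in auto)
  also have "\<dots> = (if gmult G (ginv G h) g \<in> H then u g else \<zero>)"
  proof (cases "gmult G (ginv G h) g \<in> H")
    case True
    then have "gmult G (ginv G h) g \<in> ?B"
      using g h gh by (simp add: ginv_closed gcod_gmult gdom_gmult gdom_ginv gcod_ginv)
    then show ?thesis
      using True add.finprod_singleton_swap[of "gmult G (ginv G h) g" ?B "\<lambda>_. u g"] finite_subset_G[OF HG] g
      by simp
  next
    case False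
    then have "(\<Oplus>k\<in>?B. if k = gmult G (ginv G h) g then (\<lambda>_. u g) k else \<zero>) = (\<Oplus>k\<in>?B. \<zero>)"
      by (intro finsum_cong'[OF refl]) auto
    with False show ?thesis by (simp add: finsum_zero)
  qed
  finally show ?thesis .
qed

text \<open>The test elements are \<open>tr H (trl (ginv G g) (y i))\<close>. Paired with the
  \<open>x i\<close>, their translates under \<open>g\<close> sum to \<open>u g\<close> and those
  under \<open>h\<close> to zero; agreement after multiplication by \<epsilon> therefore leaves
  \<epsilon> = 0.\<close>

lemma invariants_separate:
  assumes H: "wide_subgroupoid H G" and g: "g \<in> carrier G" and h: "h \<in> carrier G" and gh: "gcod G g = gcod G h"
    and notin: "gmult G (ginv G g) h \<notin> H" and \<epsilon>: "\<epsilon> \<in> E g"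
    and eq: "\<And>t. t \<in> invariant_subring G R E \<beta> H \<Longrightarrow> trl g t \<otimes> \<epsilon> = trl h t \<otimes> \<epsilon>"
  shows "\<epsilon> = \<zero>"
proof -
  have HG: "H \<subseteq> carrier G" and inv: "\<And>h. h \<in> H \<Longrightarrow> ginv G h \<in> H" and ident: "identities G \<subseteq> H"
    using H by (auto simp: wide_subgroupoid_def subgroupoid_def)
  have g': "ginv G g \<in> carrier G" by (rule ginv_closed[OF g])
  have \<epsilon>R: "\<epsilon> \<in> carrier R" by (rule E_carrier[OF g \<epsilon>])
  have mul: "(\<Oplus>i\<in>N. x i \<otimes> trl k (tr H (trl (ginv G g) (y i)))) \<otimes> \<epsilon>
      = (\<Oplus>i\<in>N. x i \<otimes> (trl k (tr H (trl (ginv G g) (y i))) \<otimes> \<epsilon>))" if "k \<in> carrier G" for k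
    using that HG g' \<epsilon>R finite_N
    by (subst finsum_ldistr) (auto simp: m_assoc intro!: finsum_cong'[OF refl])
  have "(\<Oplus>i\<in>N. x i \<otimes> (trl g (tr H (trl (ginv G g) (y i))) \<otimes> \<epsilon>))
      = (\<Oplus>i\<in>N. x i \<otimes> (trl h (tr H (trl (ginv G g) (y i))) \<otimes> \<epsilon>))"
    using HG g' \<epsilon>R h by (intro finsum_cong'[OF refl]) (auto simp: eq tr_invariant[OF H])
  then have sums: "(if gmult G (ginv G g) g \<in> H then u g else \<zero>) \<otimes> \<epsilon> = (if gmult G (ginv G h) g \<in> H then u g else \<zero>) \<otimes> \<epsilon>"
    unfolding mul[OF g, symmetric] mul[OF h, symmetric] sum_x_trl_tr[OF HG g g refl] sum_x_trl_tr[OF HG g h gh] .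
  have "gmult G (ginv G g) g \<in> H"
    using gdom_identities[OF g] ident by (auto simp: gdom_def)
  \<comment> \<open>The hypothesis excludes g\<inverse> h, while the sum tests h\<inverse> g. The
    two are inverse to each other and \<open>H\<close> is closed under inverses.\<close>
  moreover have "gmult G (ginv G h) g \<notin> H"
  proof
    assume *: "gmult G (ginv G h) g \<in> H"
    have "gmult G (gmult G (ginv G g) h) (gmult G (ginv G h) g) \<in> identities G"
    proof -
      have "gmult G (gmult G (ginv G g) h) (gmult G (ginv G h) g) = gmult G (ginv G g) (gmult G h (gmult G (ginv G h) g))"
        using g h gh by (intro gmult_assoc) (simp_all add: ginv_closed gmult_closed gdom_ginv gcod_gmult gcod_ginv)
      also have "gmult G h (gmult G (ginv G h) g) = g"
        using gmult_left_cancel[of "ginv G h" g] g h gh by (simp add: ginv_closed gdom_ginv ginv_ginv)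
      finally show ?thesis
        using gdom_identities[OF g] by (simp add: gdom_def)
    qed
    moreover have "gdom G (gmult G (ginv G g) h) = gcod G (gmult G (ginv G h) g)"
      using g h gh by (simp add: ginv_closed gdom_gmult gcod_gmult gdom_ginv gcod_ginv)
    moreover have "gmult G (ginv G g) h \<in> carrier G" "gmult G (ginv G h) g \<in> carrier G"
      using g h gh by (simp_all add: ginv_closed gmult_closed gdom_ginv)
    ultimately have "gmult G (ginv G g) h = ginv G (gmult G (ginv G h) g)"
      using gmult_identity_iff by blast
    with inv[OF *] notin show False by simp
  qed
  ultimately show ?thesis
    using sums \<epsilon>R u_mult[OF g \<epsilon>] by simp
qed

text \<open>An arrow \<open>g\<close> fixing the invariants acts on them like the identity
  \<open>gcod G g\<close>. If it were outside \<open>H\<close>, separation of these two arrows with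
  \<epsilon> = \<open>u g\<close> would give \<open>u g = 0\<close>.\<close>

lemma fixing_set_invariant_subring:
  assumes H: "wide_subgroupoid H G"
  shows "fixing_set G R E \<beta> (invariant_subring G R E \<beta> H) = H"
proof (intro equalityI subsetI)
  fix h assume "h \<in> H"
  then show "h \<in> fixing_set G R E \<beta> (invariant_subring G R E \<beta> H)"
    using H by (auto simp: fixing_set_def invariant_iff wide_subgroupoid_def subgroupoid_def)
next
  fix g assume "g \<in> fixing_set G R E \<beta> (invariant_subring G R E \<beta> H)"
  then have g: "g \<in> carrier G" and fix_g: "\<And>t. t \<in> invariant_subring G R E \<beta> H \<Longrightarrow> trl g t = t \<otimes> u g"
    by (auto simp: fixing_set_def)
  let ?e = "gcod G g"
  have e: "?e \<in> identities G" by (rule gcod_identities[OF g])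
  have eG: "?e \<in> carrier G" by (rule identity_closed[OF e])
  show "g \<in> H"
  proof (rule ccontr)
    assume "g \<notin> H"
    then have "gmult G (ginv G ?e) g \<notin> H"
      by (simp add: ginv_identity[OF e] gmult_gcod[OF g])
    moreover have "trl ?e t \<otimes> u g = trl g t \<otimes> u g" if "t \<in> invariant_subring G R E \<beta> H" for t
      using that fix_g[OF that] trl_identity[OF e, of t] u_gcod[OF g] by (simp add: invariant_iff)
    ultimately have "u g = \<zero>"
      using invariants_separate[OF H eG g gcod_identity[OF e], of "u g"] u_E[OF g] E_gcod[OF g] by simp
    with u_nonzero[OF g] show False by simp
  qed
qed

text \<open>With the fixing set known to be \<open>H\<close>, this is
  \<open>invariants_separate\<close> in contrapositive form.\<close>

lemma invariant_subring_strong: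
  assumes H: "wide_subgroupoid H G"
  shows "strong G R E \<beta> (invariant_subring G R E \<beta> H)"
  unfolding strong_def fixing_set_invariant_subring[OF H]
  using invariants_separate[OF H] by metis

end

section \<open>The Galois correspondence\<close>

context algebra
begin

lemma subalgebra_is_algebra:
  assumes "unital_subalgebra T R M"
  shows "algebra R (M\<lparr>carrier := T\<rparr>)"
proof -
  have T: "subring T M" and TM: "T \<subseteq> carrier M"
    and smult: "\<And>k t. k \<in> carrier R \<Longrightarrow> t \<in> T \<Longrightarrow> k \<odot>\<^bsub>M\<^esub> t \<in> T"
    using assms subringE(1) by (auto simp: unital_subalgebra_def)
  show ?thesis
  proof (rule algebraI[OF R_cring])
    show "cring (M\<lparr>carrier := T\<rparr>)"
      using subcring_iff[OF TM] subcringI'[OF T] by blast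
  qed (use smult TM in \<open>auto simp: subset_iff smult_l_distr smult_r_distr smult_assoc1 smult_assoc2\<close>)
qed

lemma subalgebra_finsum:
  assumes T: "unital_subalgebra T R M" and "finite I" "f \<in> I \<rightarrow> T"
  shows "finsum (M\<lparr>carrier := T\<rparr>) f I = finsum M f I"
proof -
  interpret A: algebra R "M\<lparr>carrier := T\<rparr>"
    by (rule subalgebra_is_algebra[OF T])
  have TM: "T \<subseteq> carrier M"
    using T subringE(1) by (auto simp: unital_subalgebra_def)
  show ?thesis
    using finsum_additive[of "M\<lparr>carrier := T\<rparr>" M "\<lambda>x. x" I f] assms TM A.abelian_monoid_axioms abelian_monoid_axioms
    by auto
qed

lemma separable_subalgebraE:
  assumes T: "unital_subalgebra T R M" and sep: "separable_algebra R (M\<lparr>carrier := T\<rparr>)"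
  obtains S :: "('c \<times> 'c) set" and a b where "finite S" "a \<in> S \<rightarrow> T" "b \<in> S \<rightarrow> T"
    "(\<Oplus>\<^bsub>M\<^esub>i\<in>S. a i \<otimes>\<^bsub>M\<^esub> b i) = \<one>\<^bsub>M\<^esub>"
    "\<forall>\<sigma>. \<sigma> \<in> T \<rightarrow> carrier M \<and>
      (\<forall>v\<in>T. \<forall>w\<in>T. \<sigma> (v \<oplus>\<^bsub>M\<^esub> w) = \<sigma> v \<oplus>\<^bsub>M\<^esub> \<sigma> w \<and> \<sigma> (v \<otimes>\<^bsub>M\<^esub> w) = \<sigma> v \<otimes>\<^bsub>M\<^esub> \<sigma> w) \<and>
      (\<forall>k\<in>carrier R. \<forall>v\<in>T. \<sigma> (k \<odot>\<^bsub>M\<^esub> v) = k \<odot>\<^bsub>M\<^esub> \<sigma> v) \<longrightarrow>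
      (\<forall>t\<in>T. t \<otimes>\<^bsub>M\<^esub> \<sigma> \<one>\<^bsub>M\<^esub> \<otimes>\<^bsub>M\<^esub> (\<Oplus>\<^bsub>M\<^esub>i\<in>S. a i \<otimes>\<^bsub>M\<^esub> \<sigma> (b i)) = \<sigma> t \<otimes>\<^bsub>M\<^esub> (\<Oplus>\<^bsub>M\<^esub>i\<in>S. a i \<otimes>\<^bsub>M\<^esub> \<sigma> (b i)))"
proof -
  let ?A = "M\<lparr>carrier := T\<rparr>"
  have TM: "t \<in> T \<Longrightarrow> t \<in> carrier M" for t
    using T subringE(1) by (auto simp: unital_subalgebra_def)
  have oneT: "\<one>\<^bsub>M\<^esub> \<in> T"
    using T subringE(3) by (auto simp: unital_subalgebra_def)
  have smultT: "k \<in> carrier R \<Longrightarrow> t \<in> T \<Longrightarrow> k \<odot>\<^bsub>M\<^esub> t \<in> T" for k t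
    using T by (auto simp: unital_subalgebra_def)
  have multT: "t \<in> T \<Longrightarrow> w \<in> T \<Longrightarrow> t \<otimes>\<^bsub>M\<^esub> w \<in> T" for t w
    using T subringE(6) by (auto simp: unital_subalgebra_def)
  interpret A: algebra R ?A
    by (rule subalgebra_is_algebra[OF T])
  interpret A: tensor_square R ?A ..
  obtain e where e: "e \<in> carrier A.P" "A.mu e = \<one>\<^bsub>?A\<^esub>"
    and comm: "\<And>t. t \<in> carrier ?A \<Longrightarrow>
      A.J +>\<^bsub>A.P\<^esub> (A.single \<one>\<^bsub>R\<^esub> (t, \<one>\<^bsub>?A\<^esub>) \<otimes>\<^bsub>A.P\<^esub> e) = A.J +>\<^bsub>A.P\<^esub> (A.single \<one>\<^bsub>R\<^esub> (\<one>\<^bsub>?A\<^esub>, t) \<otimes>\<^bsub>A.P\<^esub> e)"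
    using A.separable_algebraE[OF sep] by blast
  \<comment> \<open>A representative of the idempotent is a finitely supported function on pairs.
    Its support indexes the sum, and its values are absorbed into the left factors.\<close>
  define S where "S = A.supp e"
  define a where "a = (\<lambda>q. e q \<odot>\<^bsub>M\<^esub> fst q)"
  define b where "b = (snd :: 'c \<times> 'c \<Rightarrow> 'c)"
  have S: "finite S" "S \<subseteq> T \<times> T"
    using e(1) unfolding A.P_carrier_iff S_def by auto
  have eR: "e q \<in> carrier R" for q
    by (rule A.P_coeff[OF e(1)])
  have fs: "fst q \<in> T" "snd q \<in> T" if "q \<in> S" for q
    using that S(2) by auto
  have a: "a \<in> S \<rightarrow> T" and b: "b \<in> S \<rightarrow> T"
    using fs eR smultT by (auto simp: a_def b_def)
  have "A.mu e = (\<Oplus>\<^bsub>M\<^esub>q\<in>S. e q \<odot>\<^bsub>M\<^esub> (fst q \<otimes>\<^bsub>M\<^esub> snd q))"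
    unfolding A.mu_def A.lin_ext_def S_def[symmetric]
    using subalgebra_finsum[OF T S(1), of "\<lambda>q. e q \<odot>\<^bsub>M\<^esub> (fst q \<otimes>\<^bsub>M\<^esub> snd q)"] fs eR multT smultT
    by simp
  also have "\<dots> = (\<Oplus>\<^bsub>M\<^esub>q\<in>S. a q \<otimes>\<^bsub>M\<^esub> b q)"
    using fs eR TM by (intro finsum_cong'[OF refl]) (auto simp: a_def b_def smult_assoc2)
  finally have one: "(\<Oplus>\<^bsub>M\<^esub>q\<in>S. a q \<otimes>\<^bsub>M\<^esub> b q) = \<one>\<^bsub>M\<^esub>"
    using e(2) by simp
  have "t \<otimes>\<^bsub>M\<^esub> \<sigma> \<one>\<^bsub>M\<^esub> \<otimes>\<^bsub>M\<^esub> (\<Oplus>\<^bsub>M\<^esub>i\<in>S. a i \<otimes>\<^bsub>M\<^esub> \<sigma> (b i)) = \<sigma> t \<otimes>\<^bsub>M\<^esub> (\<Oplus>\<^bsub>M\<^esub>i\<in>S. a i \<otimes>\<^bsub>M\<^esub> \<sigma> (b i))"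
    if \<sigma>: "\<sigma> \<in> T \<rightarrow> carrier M"
      and hom: "\<forall>v\<in>T. \<forall>w\<in>T. \<sigma> (v \<oplus>\<^bsub>M\<^esub> w) = \<sigma> v \<oplus>\<^bsub>M\<^esub> \<sigma> w \<and> \<sigma> (v \<otimes>\<^bsub>M\<^esub> w) = \<sigma> v \<otimes>\<^bsub>M\<^esub> \<sigma> w"
      and smult: "\<forall>k\<in>carrier R. \<forall>v\<in>T. \<sigma> (k \<odot>\<^bsub>M\<^esub> v) = k \<odot>\<^bsub>M\<^esub> \<sigma> v"
      and t: "t \<in> T" for \<sigma> t
  proof -
    let ?\<phi> = "\<lambda>q. fst q \<otimes>\<^bsub>M\<^esub> \<sigma> (snd q)"
    have \<sigma>M: "v \<in> T \<Longrightarrow> \<sigma> v \<in> carrier M" for v using \<sigma> by auto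
    have \<phi>: "?\<phi> \<in> carrier ?A \<times> carrier ?A \<rightarrow> carrier M"
      using \<sigma>M TM by auto
    have bil: "A.algebra_bilinear M ?\<phi>"
      unfolding A.algebra_bilinear_def
    proof (intro conjI ballI)
      show "?\<phi> \<in> carrier ?A \<times> carrier ?A \<rightarrow> carrier M" by (rule \<phi>)
    qed (simp_all add: TM \<sigma>M hom smult l_distr r_distr smult_assoc2 mult_smult m_assoc m_lcomm)
    let ?L = "A.lin_ext M ?\<phi>"
    have L_e: "?L e = (\<Oplus>\<^bsub>M\<^esub>i\<in>S. a i \<otimes>\<^bsub>M\<^esub> \<sigma> (b i))"
      unfolding A.lin_ext_def S_def[symmetric]
      using fs eR TM \<sigma>M by (intro finsum_cong'[OF refl]) (auto simp: a_def b_def smult_assoc2)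
    have sP: "A.single \<one>\<^bsub>R\<^esub> (t, \<one>\<^bsub>M\<^esub>) \<in> carrier A.P" "A.single \<one>\<^bsub>R\<^esub> (\<one>\<^bsub>M\<^esub>, t) \<in> carrier A.P"
      using t oneT by (simp_all add: A.single_closed)
    have "?L (A.single \<one>\<^bsub>R\<^esub> (t, \<one>\<^bsub>M\<^esub>) \<otimes>\<^bsub>A.P\<^esub> e) = ?L (A.single \<one>\<^bsub>R\<^esub> (\<one>\<^bsub>M\<^esub>, t) \<otimes>\<^bsub>A.P\<^esub> e)"
      using comm[of t] t by (intro A.lin_ext_coset[OF algebra_axioms bil] A.P.m_closed sP e(1)) simp_all
    then have "?L (A.single \<one>\<^bsub>R\<^esub> (t, \<one>\<^bsub>M\<^esub>)) \<otimes>\<^bsub>M\<^esub> ?L e = ?L (A.single \<one>\<^bsub>R\<^esub> (\<one>\<^bsub>M\<^esub>, t)) \<otimes>\<^bsub>M\<^esub> ?L e"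
      unfolding A.lin_ext_mult[OF algebra_axioms bil sP(1) e(1)] A.lin_ext_mult[OF algebra_axioms bil sP(2) e(1)] .
    then show ?thesis
      unfolding L_e using t oneT TM \<sigma>M
      by (simp add: A.lin_ext_single[OF module_axioms \<phi>])
  qed
  then show ?thesis
    by (intro that[OF S(1) a b one] allI impI ballI) (elim conjE)
qed

end

section \<open>The two directions of the correspondence\<close>

context galois_groupoid_action
begin

lemma invariant_subring_separable:
  assumes H: "wide_subgroupoid H G"
  shows "separable_algebra K (R\<lparr>carrier := invariant_subring G R E \<beta> H\<rparr>)"
proof -
  let ?T = "invariant_subring G R E \<beta> H"
  let ?A = "R\<lparr>carrier := ?T\<rparr>"
  have HG: "H \<subseteq> carrier G"
    using H by (auto simp: wide_subgroupoid_def subgroupoid_def)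
  have T: "unital_subalgebra ?T K R"
    by (rule invariant_subalgebra[OF HG])
  have TR: "t \<in> ?T \<Longrightarrow> t \<in> carrier R" for t
    by (simp add: invariant_iff)
  have smultT: "k \<in> carrier K \<Longrightarrow> t \<in> ?T \<Longrightarrow> k \<odot> t \<in> ?T" for k t
    using T by (auto simp: unital_subalgebra_def)
  have multT: "t \<in> ?T \<Longrightarrow> w \<in> ?T \<Longrightarrow> t \<otimes> w \<in> ?T" for t w
    using T subringE(6) by (auto simp: unital_subalgebra_def)
  interpret A: algebra K ?A
    by (rule subalgebra_is_algebra[OF T])
  interpret A: tensor_square K ?A ..
  obtain c where c: "c \<in> carrier R" "tr H c = \<one>"
    by (rule tr_surjective[OF H])
  define a where "a = (\<lambda>i. tr H (c \<otimes> x i))"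
  define b where "b = (\<lambda>i. tr H (y i))"
  have a: "i \<in> N \<Longrightarrow> a i \<in> ?T" and b: "i \<in> N \<Longrightarrow> b i \<in> ?T" for i
    using c by (simp_all add: a_def b_def tr_invariant[OF H])
  show ?thesis
  proof (rule A.separable_algebraI[OF finite_N, of a b])
    show "a \<in> N \<rightarrow> carrier ?A" "b \<in> N \<rightarrow> carrier ?A"
      using a b by auto
    have "(\<Oplus>\<^bsub>?A\<^esub>i\<in>N. a i \<otimes>\<^bsub>?A\<^esub> b i) = (\<Oplus>i\<in>N. a i \<otimes> b i)"
      using subalgebra_finsum[OF T finite_N, of "\<lambda>i. a i \<otimes> b i"] a b multT by simp
    \<comment> \<open>Linearity of the trace over the invariants pulls \<open>b i\<close> inside the
      trace defining \<open>a i\<close>, so that \<open>sum_x_tr_y\<close> at 1 collapses the whole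
      sum to \<open>tr H c\<close>.\<close>
    also have "\<dots> = (\<Oplus>i\<in>N. tr H (c \<otimes> (x i \<otimes> tr H (y i \<otimes> \<one>))))"
    proof (intro finsum_cong'[OF refl] Pi_I)
      fix i assume i: "i \<in> N"
      have "a i \<otimes> b i = b i \<otimes> tr H (c \<otimes> x i)"
        using a[OF i] b[OF i] TR by (simp add: a_def m_comm)
      also have "\<dots> = tr H (b i \<otimes> (c \<otimes> x i))"
        using c i by (intro tr_mult_invariant[symmetric, OF HG b[OF i]]) simp
      also have "b i \<otimes> (c \<otimes> x i) = c \<otimes> (x i \<otimes> tr H (y i \<otimes> \<one>))"
      proof -
        have "tr H (y i \<otimes> \<one>) = b i" using i by (simp add: b_def)
        then show ?thesis
          using c i TR[OF b[OF i]] by (simp add: m_comm[of "b i"] m_assoc)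
      qed
      finally show "a i \<otimes> b i = tr H (c \<otimes> (x i \<otimes> tr H (y i \<otimes> \<one>)))" .
    qed (use c HG in auto)
    also have "\<dots> = tr H (\<Oplus>i\<in>N. c \<otimes> (x i \<otimes> tr H (y i \<otimes> \<one>)))"
      using c HG by (intro tr_finsum[symmetric, OF HG finite_N]) auto
    also have "(\<Oplus>i\<in>N. c \<otimes> (x i \<otimes> tr H (y i \<otimes> \<one>))) = c \<otimes> (\<Oplus>i\<in>N. x i \<otimes> tr H (y i \<otimes> \<one>))"
      using c HG by (intro finsum_rdistr[symmetric] finite_N) auto
    also have "\<dots> = c"
      using c by (simp only: sum_x_tr_y[OF H one_closed] r_one)
    finally show "(\<Oplus>\<^bsub>?A\<^esub>i\<in>N. a i \<otimes>\<^bsub>?A\<^esub> b i) = \<one>\<^bsub>?A\<^esub>"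
      using c by simp
    fix t assume "t \<in> carrier ?A"
    then have t: "t \<in> ?T" and tR: "t \<in> carrier R" using TR by auto
    \<comment> \<open>The membership conditions stand below the existential quantifier, so that
      \<open>k\<close> can be chosen as a total function of both indices.\<close>
    have "\<forall>i j. \<exists>k. i \<in> N \<longrightarrow> j \<in> N \<longrightarrow> k \<in> carrier K \<and> tr (carrier G) (y j \<otimes> (t \<otimes> x i)) = k \<odot> \<one>"
    proof (intro allI)
      fix i j
      show "\<exists>k. i \<in> N \<longrightarrow> j \<in> N \<longrightarrow> k \<in> carrier K \<and> tr (carrier G) (y j \<otimes> (t \<otimes> x i)) = k \<odot> \<one>"
      proof (cases "i \<in> N \<and> j \<in> N")
        case True
        then have "y j \<otimes> (t \<otimes> x i) \<in> carrier R"
          using tR by simp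
        then show ?thesis
          by (rule tr_G_scalar) blast
      qed blast
    qed
    then obtain k where k: "\<And>i j. i \<in> N \<Longrightarrow> j \<in> N \<Longrightarrow> k i j \<in> carrier K"
      and tr_k: "\<And>i j. i \<in> N \<Longrightarrow> j \<in> N \<Longrightarrow> tr (carrier G) (y j \<otimes> (t \<otimes> x i)) = k i j \<odot> \<one>"
      by metis
    have k_mult: "k i j \<odot> \<one> \<otimes> z = k i j \<odot> z" if "i \<in> N" "j \<in> N" "z \<in> carrier R" for i j z
      using that k by (simp add: smult_assoc2)
    have tx: "t \<otimes> x i = (\<Oplus>j\<in>N. k i j \<odot> x j)" if i: "i \<in> N" for i
    proof -
      have "t \<otimes> x i = (\<Oplus>j\<in>N. x j \<otimes> tr (carrier G) (y j \<otimes> (t \<otimes> x i)))"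
        using sum_x_tr_y[OF wide_G, of "t \<otimes> x i"] i tR by simp
      also have "\<dots> = (\<Oplus>j\<in>N. k i j \<odot> x j)"
        using i k k_mult by (intro finsum_cong'[OF refl]) (auto simp: tr_k m_comm[of "x _"])
      finally show ?thesis .
    qed
    \<comment> \<open>\<open>sum_tr_x_y\<close> at \<open>y j \<otimes> t\<close> produces the
      traces of \<open>y j \<otimes> t \<otimes> x i\<close>, hence the coefficients of
      \<open>tx\<close> again, now summed over the other index.\<close>
    have yt: "t \<otimes> y j = (\<Oplus>i\<in>N. k i j \<odot> y i)" if j: "j \<in> N" for j
    proof -
      have "t \<otimes> y j = (\<Oplus>i\<in>N. tr (carrier G) (y j \<otimes> t \<otimes> x i) \<otimes> y i)"
        using sum_tr_x_y[of "y j \<otimes> t"] j tR by (simp add: m_comm)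
      also have "\<dots> = (\<Oplus>i\<in>N. k i j \<odot> y i)"
        using j k k_mult tR by (intro finsum_cong'[OF refl]) (auto simp: tr_k m_assoc)
      finally show ?thesis .
    qed
    have ta: "t \<otimes> a i = (\<Oplus>j\<in>N. k i j \<odot> a j)" if i: "i \<in> N" for i
    proof -
      have "t \<otimes> a i = tr H (c \<otimes> (t \<otimes> x i))"
        unfolding a_def using tr_mult_invariant[OF HG t, of "c \<otimes> x i"] c i tR by (simp add: m_lcomm)
      also have "c \<otimes> (t \<otimes> x i) = (\<Oplus>j\<in>N. k i j \<odot> (c \<otimes> x j))"
        unfolding tx[OF i] using c i k
        by (subst finsum_rdistr[OF finite_N]) (auto simp: mult_smult intro!: finsum_cong'[OF refl])
      also have "tr H \<dots> = (\<Oplus>j\<in>N. tr H (k i j \<odot> (c \<otimes> x j)))"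
        using c i k by (intro tr_finsum[OF HG finite_N]) auto
      also have "\<dots> = (\<Oplus>j\<in>N. k i j \<odot> a j)"
        unfolding a_def using c i k HG by (intro finsum_cong'[OF refl]) (auto simp: tr_smult)
      finally show ?thesis .
    qed
    have tb: "t \<otimes> b j = (\<Oplus>i\<in>N. k i j \<odot> b i)" if j: "j \<in> N" for j
    proof -
      have "t \<otimes> b j = tr H (t \<otimes> y j)"
        unfolding b_def using tr_mult_invariant[OF HG t, of "y j"] j by simp
      also have "\<dots> = (\<Oplus>i\<in>N. tr H (k i j \<odot> y i))"
        unfolding yt[OF j] using j k by (intro tr_finsum[OF HG finite_N]) auto
      also have "\<dots> = (\<Oplus>i\<in>N. k i j \<odot> b i)"
        unfolding b_def using j k HG by (intro finsum_cong'[OF refl]) (auto simp: tr_smult)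
      finally show ?thesis .
    qed
    have "(\<Oplus>\<^bsub>?A\<^esub>j\<in>N. k i j \<odot>\<^bsub>?A\<^esub> a j) = (\<Oplus>j\<in>N. k i j \<odot> a j)" if "i \<in> N" for i
      using subalgebra_finsum[OF T finite_N, of "\<lambda>j. k i j \<odot> a j"] that k a smultT by simp
    moreover have "(\<Oplus>\<^bsub>?A\<^esub>i\<in>N. k i j \<odot>\<^bsub>?A\<^esub> b i) = (\<Oplus>i\<in>N. k i j \<odot> b i)" if "j \<in> N" for j
      using subalgebra_finsum[OF T finite_N, of "\<lambda>i. k i j \<odot> b i"] that k b smultT by simp
    ultimately show "\<exists>k. (\<forall>i\<in>N. \<forall>j\<in>N. k i j \<in> carrier K) \<and>
        (\<forall>i\<in>N. t \<otimes>\<^bsub>?A\<^esub> a i = (\<Oplus>\<^bsub>?A\<^esub>j\<in>N. k i j \<odot>\<^bsub>?A\<^esub> a j)) \<and>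
        (\<forall>j\<in>N. t \<otimes>\<^bsub>?A\<^esub> b j = (\<Oplus>\<^bsub>?A\<^esub>i\<in>N. k i j \<odot>\<^bsub>?A\<^esub> b i))"
      using ta tb k by (intro exI[of _ k]) simp
  qed
qed

text \<open>A translate ignores whatever lies outside the source component of its arrow
  (\<open>trl_u_gdom\<close>). Hence the unit left behind by one fixing arrow is invisible to the
  next, and composites and inverses fix \<open>T\<close> as well.\<close>

lemma fixing_set_wide:
  assumes T: "T \<subseteq> carrier R"
  shows "wide_subgroupoid (fixing_set G R E \<beta> T) G"
proof -
  let ?H = "fixing_set G R E \<beta> T"
  have TR: "t \<in> T \<Longrightarrow> t \<in> carrier R" for t using T by auto
  have ident: "identities G \<subseteq> ?H"
    using identity_closed TR by (auto simp: fixing_set_def trl_identity)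
  have "ginv G g \<in> ?H" if "g \<in> ?H" for g
  proof -
    from that have g: "g \<in> carrier G" and fix_g: "\<And>t. t \<in> T \<Longrightarrow> trl g t = t \<otimes> u g"
      by (auto simp: fixing_set_def)
    have g': "ginv G g \<in> carrier G" by (rule ginv_closed[OF g])
    have "trl (ginv G g) t = t \<otimes> u (ginv G g)" if t: "t \<in> T" for t
    proof -
      have "trl (ginv G g) t = trl (ginv G g) (t \<otimes> u g)"
        using trl_u_gdom[OF g' TR[OF t]] u_gcod[OF g] by (simp add: gdom_ginv[OF g])
      also have "\<dots> = trl (ginv G g) (trl g t)"
        by (simp only: fix_g[OF t])
      also have "\<dots> = trl (gdom G g) t"
        using trl_comp[OF g' g gdom_ginv[OF g] TR[OF t]] by (simp add: gdom_def)
      also have "\<dots> = t \<otimes> u (ginv G g)"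
        using trl_identity[OF gdom_identities[OF g] TR[OF t]] by (simp add: u_ginv[OF g])
      finally show ?thesis .
    qed
    with g' show ?thesis by (simp add: fixing_set_def)
  qed
  moreover have "gmult G g h \<in> ?H" if gH: "g \<in> ?H" and hH: "h \<in> ?H" and gh: "gdom G g = gcod G h" for g h
  proof -
    have g: "g \<in> carrier G" and fix_g: "\<And>t. t \<in> T \<Longrightarrow> trl g t = t \<otimes> u g"
      and h: "h \<in> carrier G" and fix_h: "\<And>t. t \<in> T \<Longrightarrow> trl h t = t \<otimes> u h"
      using gH hH by (auto simp: fixing_set_def)
    have ghG: "gmult G g h \<in> carrier G" by (rule gmult_closed[OF g h gh])
    have "trl (gmult G g h) t = t \<otimes> u (gmult G g h)" if t: "t \<in> T" for t
    proof -
      have "trl (gmult G g h) t = trl g (t \<otimes> u h)"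
        using trl_comp[OF g h gh TR[OF t]] fix_h[OF t] by simp
      also have "\<dots> = trl g t"
        using trl_u_gdom[OF g TR[OF t]] u_gcod[OF h] gh by simp
      finally show ?thesis
        using fix_g[OF t] u_gcod[OF g] u_gcod[OF ghG] gcod_gmult[OF g h gh] by simp
    qed
    with ghG show ?thesis by (simp add: fixing_set_def)
  qed
  moreover have "?H \<noteq> {}"
    using ident gdom_identities nonempty by blast
  ultimately show ?thesis
    using ident by (auto simp: wide_subgroupoid_def subgroupoid_def fixing_set_def)
qed

lemma invariant_subring_fixing_set:
  assumes T: "unital_subalgebra T K R" and sep: "separable_algebra K (R\<lparr>carrier := T\<rparr>)"
    and strong: "strong G R E \<beta> T"
  shows "invariant_subring G R E \<beta> (fixing_set G R E \<beta> T) = T"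
proof -
  let ?H = "fixing_set G R E \<beta> T"
  have subring: "subring T R" and TR: "t \<in> T \<Longrightarrow> t \<in> carrier R"
    and smultT: "k \<in> carrier K \<Longrightarrow> t \<in> T \<Longrightarrow> k \<odot> t \<in> T" for t k
    using T subringE(1) by (auto simp: unital_subalgebra_def)
  have H: "wide_subgroupoid ?H G"
    by (rule fixing_set_wide) (rule subringE(1)[OF subring])
  have HG: "?H \<subseteq> carrier G"
    unfolding fixing_set_def by blast
  obtain S :: "('r \<times> 'r) set" and a b where S: "finite S" and aT: "a \<in> S \<rightarrow> T" and bT: "b \<in> S \<rightarrow> T"
    and one: "(\<Oplus>i\<in>S. a i \<otimes> b i) = \<one>"
    and comm: "\<forall>\<sigma>. \<sigma> \<in> T \<rightarrow> carrier R \<and>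
      (\<forall>v\<in>T. \<forall>w\<in>T. \<sigma> (v \<oplus> w) = \<sigma> v \<oplus> \<sigma> w \<and> \<sigma> (v \<otimes> w) = \<sigma> v \<otimes> \<sigma> w) \<and>
      (\<forall>k\<in>carrier K. \<forall>v\<in>T. \<sigma> (k \<odot> v) = k \<odot> \<sigma> v) \<longrightarrow>
      (\<forall>t\<in>T. t \<otimes> \<sigma> \<one> \<otimes> (\<Oplus>i\<in>S. a i \<otimes> \<sigma> (b i)) = \<sigma> t \<otimes> (\<Oplus>i\<in>S. a i \<otimes> \<sigma> (b i)))"
    by (rule separable_subalgebraE[OF T sep])
  have a: "i \<in> S \<Longrightarrow> a i \<in> carrier R" and b: "i \<in> S \<Longrightarrow> b i \<in> carrier R"
    and ai: "i \<in> S \<Longrightarrow> a i \<in> T" and bi: "i \<in> S \<Longrightarrow> b i \<in> T" for i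
    using aT bT TR by auto
  define \<epsilon> where "\<epsilon> g = (\<Oplus>i\<in>S. a i \<otimes> trl g (b i))" for g
  have \<epsilon>R: "\<epsilon> g \<in> carrier R" if "g \<in> carrier G" for g
    unfolding \<epsilon>_def using a b that by (auto intro: finsum_closed)
  have \<epsilon>_u: "\<epsilon> g \<otimes> u g = \<epsilon> g" if g: "g \<in> carrier G" for g
  proof -
    have "\<epsilon> g \<otimes> u g = (\<Oplus>i\<in>S. a i \<otimes> trl g (b i) \<otimes> u g)"
      unfolding \<epsilon>_def using S a b g by (intro finsum_ldistr) auto
    also have "\<dots> = \<epsilon> g"
      unfolding \<epsilon>_def using a b g by (intro finsum_cong'[OF refl]) (auto simp: m_assoc trl_u)
    finally show ?thesis .
  qed
  have absorb: "(\<Oplus>i\<in>S. a i \<otimes> (b i \<otimes> w)) = w" if w: "w \<in> carrier R" for w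
  proof -
    have "(\<Oplus>i\<in>S. a i \<otimes> (b i \<otimes> w)) = (\<Oplus>i\<in>S. a i \<otimes> b i) \<otimes> w"
      using S a b w by (subst finsum_ldistr) (auto simp: m_assoc intro!: finsum_cong'[OF refl])
    then show ?thesis using one w by simp
  qed
  have \<epsilon>_comm: "trl g t \<otimes> \<epsilon> g = t \<otimes> \<epsilon> g" if g: "g \<in> carrier G" and t: "t \<in> T" for g t
  proof -
    \<comment> \<open>The separability clause is used for \<open>trl g\<close>, whose value at 1 is
      \<open>u g\<close>; that unit is then absorbed by \<open>\<epsilon> g\<close>.\<close>
    have "t \<otimes> trl g \<one> \<otimes> \<epsilon> g = trl g t \<otimes> \<epsilon> g"
      unfolding \<epsilon>_def using g TR
      by (intro comm[THEN spec, THEN mp, THEN bspec, of "trl g", OF _ t])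
         (auto simp: trl_add trl_mult trl_smult)
    moreover have "t \<otimes> trl g \<one> \<otimes> \<epsilon> g = t \<otimes> \<epsilon> g"
      using \<epsilon>_u[OF g] \<epsilon>R[OF g] TR[OF t] g by (simp add: trl_one m_assoc m_comm[of "u g"])
    ultimately show ?thesis by simp
  qed
  \<comment> \<open>Multiplication by \<open>\<epsilon> g\<close> replaces each
    \<open>trl g (b i)\<close> by \<open>b i\<close>, and the sum of the
    \<open>a i \<otimes> b i\<close> is 1.\<close>
  have \<epsilon>_idem: "\<epsilon> g \<otimes> \<epsilon> g = \<epsilon> g" if g: "g \<in> carrier G" for g
  proof -
    have "\<epsilon> g \<otimes> \<epsilon> g = (\<Oplus>i\<in>S. a i \<otimes> trl g (b i)) \<otimes> \<epsilon> g"
      by (simp add: \<epsilon>_def)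
    also have "\<dots> = (\<Oplus>i\<in>S. a i \<otimes> trl g (b i) \<otimes> \<epsilon> g)"
      using S a b g \<epsilon>R by (intro finsum_ldistr) auto
    also have "\<dots> = (\<Oplus>i\<in>S. a i \<otimes> (b i \<otimes> \<epsilon> g))"
      using a b g \<epsilon>R by (intro finsum_cong'[OF refl]) (auto simp: m_assoc \<epsilon>_comm bi)
    also have "\<dots> = \<epsilon> g"
      by (rule absorb[OF \<epsilon>R[OF g]])
    finally show ?thesis .
  qed
  have \<epsilon>_value: "\<epsilon> g = (if g \<in> ?H then u g else \<zero>)" if g: "g \<in> carrier G" for g
  proof (cases "g \<in> ?H")
    case True
    then have "\<epsilon> g = (\<Oplus>i\<in>S. a i \<otimes> (b i \<otimes> u g))"
      unfolding \<epsilon>_def using a b g bi by (intro finsum_cong'[OF refl]) (auto simp: fixing_set_def)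
    also have "\<dots> = u g"
      using g by (intro absorb) simp
    finally show ?thesis using True by simp
  next
    case False
    \<comment> \<open>Strongness is applied to the target identity of \<open>g\<close> and
      \<open>g\<close> itself, for which the arrow to be tested is again \<open>g\<close>. The
      idempotent \<open>\<epsilon> g\<close> cannot separate them, by
      \<open>\<epsilon>_comm\<close>.\<close>
    let ?e = "gcod G g"
    have e: "?e \<in> identities G" by (rule gcod_identities[OF g])
    have eG: "?e \<in> carrier G" by (rule identity_closed[OF e])
    have "\<epsilon> g = \<zero>"
    proof (rule ccontr)
      assume nz: "\<epsilon> g \<noteq> \<zero>"
      have "\<epsilon> g \<in> E ?e"
        using E_mult(2)[OF g u_E[OF g] \<epsilon>R[OF g]] \<epsilon>_u[OF g] E_gcod[OF g] by simp
      moreover have "gmult G (ginv G ?e) g \<notin> ?H"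
        using False by (simp add: ginv_identity[OF e] gmult_gcod[OF g])
      ultimately obtain t where t: "t \<in> T" "trl ?e t \<otimes> \<epsilon> g \<noteq> trl g t \<otimes> \<epsilon> g"
        using strong[unfolded strong_def, rule_format, OF eG g, of "\<epsilon> g"] gcod_identity[OF e] \<epsilon>_idem[OF g] nz
        by blast
      have "trl ?e t \<otimes> \<epsilon> g = t \<otimes> (\<epsilon> g \<otimes> u g)"
        using trl_identity[OF e TR[OF t(1)]] u_gcod[OF g] eG TR[OF t(1)] \<epsilon>R[OF g]
        by (simp add: m_assoc m_comm[of "u ?e"])
      then show False
        using t(2) \<epsilon>_u[OF g] \<epsilon>_comm[OF g t(1)] by simp
    qed
    with False show ?thesis by simp
  qed
  have tr_T: "tr ?H w \<in> T" if w: "w \<in> carrier R" for w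
  proof -
    have "(\<Oplus>i\<in>S. a i \<otimes> tr (carrier G) (b i \<otimes> w)) = (\<Oplus>i\<in>S. \<Oplus>g\<in>carrier G. a i \<otimes> trl g (b i) \<otimes> trl g w)"
    proof (intro finsum_cong'[OF refl] Pi_I finsum_closed)
      fix i assume i: "i \<in> S"
      have "a i \<otimes> tr (carrier G) (b i \<otimes> w) = (\<Oplus>g\<in>carrier G. a i \<otimes> trl g (b i \<otimes> w))"
        unfolding tr_def using a b i w finite_G by (intro finsum_rdistr) auto
      also have "\<dots> = (\<Oplus>g\<in>carrier G. a i \<otimes> trl g (b i) \<otimes> trl g w)"
        using a b i w by (intro finsum_cong'[OF refl]) (auto simp: trl_mult m_assoc)
      finally show "a i \<otimes> tr (carrier G) (b i \<otimes> w) = (\<Oplus>g\<in>carrier G. a i \<otimes> trl g (b i) \<otimes> trl g w)" .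
    qed (use a b w in auto)
    also have "\<dots> = (\<Oplus>g\<in>carrier G. \<Oplus>i\<in>S. a i \<otimes> trl g (b i) \<otimes> trl g w)"
      using a b w S finite_G by (intro finsum_swap) auto
    also have "\<dots> = (\<Oplus>g\<in>carrier G. \<epsilon> g \<otimes> trl g w)"
      unfolding \<epsilon>_def using a b w S
      by (intro finsum_cong'[OF refl] finsum_ldistr[symmetric]) (auto intro!: finsum_closed)
    \<comment> \<open>By \<open>\<epsilon>_value\<close> the idempotents cut the sum over
      \<open>G\<close> down to the arrows fixing \<open>T\<close>.\<close>
    also have "\<dots> = tr ?H w"
      unfolding tr_def
    proof (rule add.finprod_mono_neutral_cong_right[OF finite_G HG])
    qed (use w HG in \<open>auto simp: \<epsilon>_value u_trl\<close>)
    finally have eq: "tr ?H w = (\<Oplus>i\<in>S. a i \<otimes> tr (carrier G) (b i \<otimes> w))" ..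
    \<comment> \<open>A trace over all of \<open>G\<close> is a scalar, so each summand is a scalar
      multiple of \<open>a i\<close> and stays in \<open>T\<close>.\<close>
    have summand: "a i \<otimes> tr (carrier G) (b i \<otimes> w) \<in> T" if i: "i \<in> S" for i
    proof -
      obtain k where k: "k \<in> carrier K" "tr (carrier G) (b i \<otimes> w) = k \<odot> \<one>"
        using tr_G_scalar[of "b i \<otimes> w"] b[OF i] w by auto
      then show ?thesis
        using smultT[OF k(1) ai[OF i]] a[OF i] by (simp add: mult_smult)
    qed
    interpret A: algebra K "R\<lparr>carrier := T\<rparr>"
      by (rule subalgebra_is_algebra[OF T])
    have "finsum (R\<lparr>carrier := T\<rparr>) (\<lambda>i. a i \<otimes> tr (carrier G) (b i \<otimes> w)) S \<in> carrier (R\<lparr>carrier := T\<rparr>)"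
      using summand by (intro A.finsum_closed) auto
    then show ?thesis
      using subalgebra_finsum[OF T S, of "\<lambda>i. a i \<otimes> tr (carrier G) (b i \<otimes> w)"] summand
      by (simp add: eq)
  qed
  obtain c where c: "c \<in> carrier R" "tr ?H c = \<one>"
    by (rule tr_surjective[OF H])
  show ?thesis
  proof (intro equalityI subsetI)
    fix z assume z: "z \<in> invariant_subring G R E \<beta> ?H"
    then have zR: "z \<in> carrier R" by (simp add: invariant_iff)
    have "z = tr ?H (z \<otimes> c)"
      using tr_mult_invariant[OF HG z c(1)] c(2) zR by simp
    then show "z \<in> T"
      using tr_T[of "z \<otimes> c"] zR c(1) by simp
  next
    fix t assume "t \<in> T"
    then show "t \<in> invariant_subring G R E \<beta> ?H"
      using TR by (simp add: invariant_iff fixing_set_def)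
  qed
qed

lemma galois_correspondence:
  "bij_betw (\<lambda>H. invariant_subring G R E \<beta> H) {H. wide_subgroupoid H G}
    {T. unital_subalgebra T K R \<and> separable_algebra K (R\<lparr>carrier := T\<rparr>) \<and> strong G R E \<beta> T}"
proof (rule bij_betw_byWitness[where f' = "fixing_set G R E \<beta>"])
  show "\<forall>H\<in>{H. wide_subgroupoid H G}. fixing_set G R E \<beta> (invariant_subring G R E \<beta> H) = H"
    using fixing_set_invariant_subring by blast
  show "\<forall>T\<in>{T. unital_subalgebra T K R \<and> separable_algebra K (R\<lparr>carrier := T\<rparr>) \<and> strong G R E \<beta> T}.
      invariant_subring G R E \<beta> (fixing_set G R E \<beta> T) = T"
    using invariant_subring_fixing_set by blast
  show "invariant_subring G R E \<beta> ` {H. wide_subgroupoid H G}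
      \<subseteq> {T. unital_subalgebra T K R \<and> separable_algebra K (R\<lparr>carrier := T\<rparr>) \<and> strong G R E \<beta> T}"
    using invariant_subalgebra invariant_subring_separable invariant_subring_strong
    by (auto simp: wide_subgroupoid_def subgroupoid_def)
  show "fixing_set G R E \<beta> ` {T. unital_subalgebra T K R \<and> separable_algebra K (R\<lparr>carrier := T\<rparr>) \<and> strong G R E \<beta> T}
      \<subseteq> {H. wide_subgroupoid H G}"
    using fixing_set_wide subringE(1) by (auto simp: unital_subalgebra_def)
qed

end

theorem theorem5p5:
  fixes G :: "('g, 'z) groupoid_scheme"
    and K :: "('k, 'x) ring_scheme"
    and R :: "('k, 'r, 'y) module_scheme"
    and E :: "'g \<Rightarrow> 'r set"
    and \<beta> :: "'g \<Rightarrow> 'r \<Rightarrow> 'r"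
  assumes "groupoid_action G K R E \<beta>"
    and "finite (carrier G)"
    and "\<one>\<^bsub>K\<^esub> \<noteq> \<zero>\<^bsub>K\<^esub>"
    and "faithful_module K R"
    and "\<forall>e\<in>identities G. \<exists>u. is_ideal_one R (E e) u"
    and "internal_direct_sum R (identities G) E"
    and "invariant_subring G R E \<beta> (carrier G) = (\<lambda>k. k \<odot>\<^bsub>R\<^esub> \<one>\<^bsub>R\<^esub>) ` carrier K"
    and "galois_extension G R E \<beta>"
    and "\<forall>g\<in>carrier G. faithfully_projective_module K (R\<lparr>carrier := E g\<rparr>)"
  shows "bij_betw (\<lambda>H. invariant_subring G R E \<beta> H)
    {H. wide_subgroupoid H G}
    {T. unital_subalgebra T K R \<and> separable_algebra K (R\<lparr>carrier := T\<rparr>) \<and> strong G R E \<beta> T}"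
proof -
  interpret groupoid_action G K R E \<beta> by fact
  interpret unital_groupoid_action G K R E \<beta>
    using assms(2,5,6) by unfold_locales auto
  obtain m :: nat and x y where xy: "x \<in> {1..m} \<rightarrow> carrier R" "y \<in> {1..m} \<rightarrow> carrier R"
    "\<And>g. g \<in> carrier G \<Longrightarrow> (\<Oplus>\<^bsub>R\<^esub>i\<in>{1..m}. x i \<otimes>\<^bsub>R\<^esub> translate G R E \<beta> g (y i)) =
        (if g \<in> identities G then ideal_one R (E g) else \<zero>\<^bsub>R\<^esub>)"
    using assms(8) unfolding galois_extension_def by blast
  \<comment> \<open>If the unit of \<open>E g\<close> were zero, so would be \<open>E g\<close>, and
    then 1 in \<open>K\<close> would annihilate it, against faithfulness. Over the zero ring this
    could happen: \<open>R\<close> is then zero and all its invariant subrings coincide.\<close>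
  have "ideal_one R (E g) \<noteq> \<zero>\<^bsub>R\<^esub>" if g: "g \<in> carrier G" for g
  proof
    assume z: "ideal_one R (E g) = \<zero>\<^bsub>R\<^esub>"
    have "w = \<zero>\<^bsub>R\<^esub>" if "w \<in> E g" for w
      using u_mult[OF g that] E_carrier[OF g that] z by simp
    then have "\<one>\<^bsub>K\<^esub> \<odot>\<^bsub>R\<^esub> w = \<zero>\<^bsub>R\<^esub>" if "w \<in> E g" for w
      using that E_carrier[OF g that] by simp
    moreover have "faithful_module K (R\<lparr>carrier := E g\<rparr>)"
      using assms(9) g by (simp add: faithfully_projective_module_def)
    ultimately have "\<one>\<^bsub>K\<^esub> = \<zero>\<^bsub>K\<^esub>"
      unfolding faithful_module_def by auto
    with assms(3) show False by simp
  qed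
  then interpret galois_groupoid_action G K R E \<beta> "{1..m}" x y
    using xy assms(7) by unfold_locales auto
  show ?thesis
    by (rule galois_correspondence)
qed

end
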